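(* Let $\sigma$ be a connected skew Young diagram whose topmost row is row $1$. Then, as formal power series, $$s_\sigma \;=\; \sum_{\mu\supseteq\sigma}(-1)^{|A(\mu/\sigma)|}\, b_{\sigma,\mu}\, G_\mu,$$ where the sum is over skew shapes $\mu\supseteq\sigma$ (containment convention below) and $b_{\sigma,\mu}$ is the product of (1) the number of row-weakly-bounded, reverse row-strict tableaux of shape $A(\mu/\sigma)$, and (2) the number of row-bounded, semistandard tableaux of shape $B(\mu/\sigma)$.
   Context: Boxes are pairs $(i,j)$ of positive integers, $i$ the row index (increasing downward), $j$ the column index (increasing to the right); $(i,j)\preceq(i',j')$ iff $i\le i'$, $j\le j'$. A skew Young diagram (skew shape) is a finite set of boxes closed under intervals; connected means its Hasse diagram under $\preceq$ is connected. Rows are numbered so that the top row of $\sigma$ is row 1. Containment convention: $\mu\supseteq\sigma$ means every box of $\sigma$ is in $\mu$ and every box of $\mu$ is in the same column as some box of $\sigma$; then $\mu\setminus\sigma$ splits into $A(\mu/\sigma)$ (boxes above boxes of $\sigma$ in their column) and $B(\mu/\sigma)$ (boxes below). A tableau assigns a positive integer to each box; semistandard: rows weakly increasing left to right, columns strictly increasing top to bottom; reverse row-strict: rows strictly decreasing left to right, columns weakly decreasing top to bottom; row-bounded: $T(i,j)<i$; row-weakly-bounded: $T(i,j)\le i$. Content $c(T)$: $i$-th entry is the number of occurrences of label $i$; $\mathbf{x}^c=\prod x_i^{c_i}$. A set-valued tableau assigns a nonempty finite set of positive integers to each box; it is semistandard if along rows $\max$ of each box $\le\min$ of the next box to the right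 and down columns $\max$ of each box $<\min$ of the box below; $|T|$ is the total number of labels. $s_\sigma=\sum_T\mathbf{x}^{c(T)}$ over semistandard tableaux of shape $\sigma$; $G_\mu=\sum_T(-1)^{|T|-|\mu|}\mathbf{x}^{c(T)}$ over semistandard set-valued tableaux of shape $\mu$. *)

theory Defs
  imports Main "HOL-Library.FuncSet" "HOL-Library.Poly_Mapping"
begin

section \<open>Formal power series in countably many variables\<close>

text \<open>A series is its coefficient function on finitely supported exponent vectors. The variable
  with index 0 is a dummy: labels are positive, so it never occurs in the series below.\<close>

type_synonym exponent = "nat \<Rightarrow>\<^sub>0 nat"
type_synonym series = "exponent \<Rightarrow> int"

definition monomial :: "exponent \<Rightarrow> series" where
  "monomial c = (\<lambda>d. if d = c then 1 else 0)"

definition scale :: "int \<Rightarrow> series \<Rightarrow> series" where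
  "scale a F = (\<lambda>d. a * F d)"

text \<open>A possibly infinite family of series has a sum if each coefficient receives only finitely
  many nonzero contributions; the sum is then taken coefficientwise.\<close>

definition formally_summable :: "('i \<Rightarrow> series) \<Rightarrow> 'i set \<Rightarrow> bool" where
  "formally_summable F I \<longleftrightarrow> (\<forall>d. finite {i \<in> I. F i d \<noteq> 0})"

definition formal_sum :: "('i \<Rightarrow> series) \<Rightarrow> 'i set \<Rightarrow> series" where
  "formal_sum F I = (\<lambda>d. \<Sum>i \<in> {i \<in> I. F i d \<noteq> 0}. F i d)"

section \<open>Skew shapes\<close>

text \<open>A box is a pair (row, column); rows increase downward.\<close>

type_synonym box = "nat \<times> nat"

definition box_le :: "box \<Rightarrow> box \<Rightarrow> bool" where
  "box_le a b \<longleftrightarrow> fst a \<le> fst b \<and> snd a \<le> snd b"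

definition skew_shape :: "box set \<Rightarrow> bool" where
  "skew_shape S \<longleftrightarrow> finite S \<and> S \<subseteq> {1..} \<times> {1..} \<and>
     (\<forall>a\<in>S. \<forall>b\<in>S. \<forall>c. box_le a c \<and> box_le c b \<longrightarrow> c \<in> S)"

definition covers :: "box set \<Rightarrow> box \<Rightarrow> box \<Rightarrow> bool" where
  "covers S a b \<longleftrightarrow> a \<in> S \<and> b \<in> S \<and> a \<noteq> b \<and> box_le a b \<and>
     (\<forall>c\<in>S. box_le a c \<and> box_le c b \<longrightarrow> c = a \<or> c = b)"

definition connected_shape :: "box set \<Rightarrow> bool" where
  "connected_shape S \<longleftrightarrow>
     (\<forall>a\<in>S. \<forall>b\<in>S. (a, b) \<in> {(p, q). covers S p q \<or> covers S q p}\<^sup>*)"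

definition top_row :: "box set \<Rightarrow> nat" where
  "top_row S = Min (fst ` S)"

definition col_contains :: "box set \<Rightarrow> box set \<Rightarrow> bool" where
  "col_contains \<mu> \<sigma> \<longleftrightarrow> \<sigma> \<subseteq> \<mu> \<and> (\<forall>(i, j)\<in>\<mu>. \<exists>i'. (i', j) \<in> \<sigma>)"

definition above :: "box set \<Rightarrow> box set \<Rightarrow> box set" where
  "above \<mu> \<sigma> = {(i, j). (i, j) \<in> \<mu> - \<sigma> \<and> (\<exists>i'. (i', j) \<in> \<sigma> \<and> i < i')}"

definition below :: "box set \<Rightarrow> box set \<Rightarrow> box set" where
  "below \<mu> \<sigma> = {(i, j). (i, j) \<in> \<mu> - \<sigma> \<and> (\<exists>i'. (i', j) \<in> \<sigma> \<and> i' < i)}"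

section \<open>Tableaux\<close>

text \<open>Fillings are extensional functions (\<^term>\<open>undefined\<close> off the shape), so that sets of fillings
  can be counted and summed over.\<close>

definition tableaux :: "box set \<Rightarrow> (box \<Rightarrow> nat) set" where
  "tableaux S = S \<rightarrow>\<^sub>E {1..}"

definition semistandard :: "box set \<Rightarrow> (box \<Rightarrow> nat) \<Rightarrow> bool" where
  "semistandard S T \<longleftrightarrow>
     (\<forall>i j j'. (i, j) \<in> S \<and> (i, j') \<in> S \<and> j < j' \<longrightarrow> T (i, j) \<le> T (i, j')) \<and>
     (\<forall>i i' j. (i, j) \<in> S \<and> (i', j) \<in> S \<and> i < i' \<longrightarrow> T (i, j) < T (i', j))"

definition reverse_row_strict :: "box set \<Rightarrow> (box \<Rightarrow> nat) \<Rightarrow> bool" where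
  "reverse_row_strict S T \<longleftrightarrow>
     (\<forall>i j j'. (i, j) \<in> S \<and> (i, j') \<in> S \<and> j < j' \<longrightarrow> T (i, j) > T (i, j')) \<and>
     (\<forall>i i' j. (i, j) \<in> S \<and> (i', j) \<in> S \<and> i < i' \<longrightarrow> T (i, j) \<ge> T (i', j))"

definition row_bounded :: "box set \<Rightarrow> (box \<Rightarrow> nat) \<Rightarrow> bool" where
  "row_bounded S T \<longleftrightarrow> (\<forall>(i, j)\<in>S. T (i, j) < i)"

definition row_weakly_bounded :: "box set \<Rightarrow> (box \<Rightarrow> nat) \<Rightarrow> bool" where
  "row_weakly_bounded S T \<longleftrightarrow> (\<forall>(i, j)\<in>S. T (i, j) \<le> i)"

text \<open>The entry of the content at a label \<open>k\<close> is the number of occurrences of \<open>k\<close>; see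
  \<open>lookup_content\<close> and \<open>lookup_sv_content\<close> below.\<close>

definition content :: "box set \<Rightarrow> (box \<Rightarrow> nat) \<Rightarrow> exponent" where
  "content S T = (\<Sum>b\<in>S. Poly_Mapping.single (T b) 1)"

definition sv_tableaux :: "box set \<Rightarrow> (box \<Rightarrow> nat set) set" where
  "sv_tableaux S = S \<rightarrow>\<^sub>E {L. finite L \<and> L \<noteq> {} \<and> L \<subseteq> {1..}}"

definition sv_semistandard :: "box set \<Rightarrow> (box \<Rightarrow> nat set) \<Rightarrow> bool" where
  "sv_semistandard S T \<longleftrightarrow>
     (\<forall>i j. (i, j) \<in> S \<and> (i, j + 1) \<in> S \<longrightarrow> Max (T (i, j)) \<le> Min (T (i, j + 1))) \<and>
     (\<forall>i j. (i, j) \<in> S \<and> (i + 1, j) \<in> S \<longrightarrow> Max (T (i, j)) < Min (T (i + 1, j)))"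

definition sv_content :: "box set \<Rightarrow> (box \<Rightarrow> nat set) \<Rightarrow> exponent" where
  "sv_content S T = (\<Sum>b\<in>S. \<Sum>k\<in>T b. Poly_Mapping.single k 1)"

definition sv_size :: "box set \<Rightarrow> (box \<Rightarrow> nat set) \<Rightarrow> nat" where
  "sv_size S T = (\<Sum>b\<in>S. card (T b))"

section \<open>Schur and Grothendieck series and the coefficients\<close>

definition SSYT :: "box set \<Rightarrow> (box \<Rightarrow> nat) set" where
  "SSYT S = {T \<in> tableaux S. semistandard S T}"

definition SVT :: "box set \<Rightarrow> (box \<Rightarrow> nat set) set" where
  "SVT S = {T \<in> sv_tableaux S. sv_semistandard S T}"

definition schur :: "box set \<Rightarrow> series" where
  "schur \<sigma> = formal_sum (\<lambda>T. monomial (content \<sigma> T)) (SSYT \<sigma>)"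

text \<open>The truncated subtraction below is exact, since every box holds at least one label.\<close>

definition grothendieck :: "box set \<Rightarrow> series" where
  "grothendieck \<mu> =
     formal_sum (\<lambda>T. scale ((-1) ^ (sv_size \<mu> T - card \<mu>)) (monomial (sv_content \<mu> T))) (SVT \<mu>)"

definition b_coeff :: "box set \<Rightarrow> box set \<Rightarrow> nat" where
  "b_coeff \<sigma> \<mu> =
     card {T \<in> tableaux (above \<mu> \<sigma>).
             row_weakly_bounded (above \<mu> \<sigma>) T \<and> reverse_row_strict (above \<mu> \<sigma>) T} *
     card {T \<in> tableaux (below \<mu> \<sigma>).
             row_bounded (below \<mu> \<sigma>) T \<and> semistandard (below \<mu> \<sigma>) T}"

section \<open>Well-definedness\<close>

lemma lookup_content:
  assumes "finite S"
  shows "Poly_Mapping.lookup (content S T) k = card {b \<in> S. T b = k}"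
  using assms
  by (simp add: content_def lookup_sum lookup_single when_def card_eq_sum sum.inter_filter
      del: sum_constant)

lemma lookup_sv_content:
  assumes "finite S" and "T \<in> sv_tableaux S"
  shows "Poly_Mapping.lookup (sv_content S T) k = card {b \<in> S. k \<in> T b}"
proof -
  have "(\<Sum>l\<in>T b. Poly_Mapping.lookup (Poly_Mapping.single l (1::nat)) k)
      = (if k \<in> T b then 1 else 0)" if "b \<in> S" for b
  proof -
    have "finite (T b)" using assms(2) that by (auto simp: sv_tableaux_def PiE_def)
    then show ?thesis by (simp add: lookup_single when_def)
  qed
  then have "Poly_Mapping.lookup (sv_content S T) k = (\<Sum>b\<in>S. if k \<in> T b then 1 else (0::nat))"
    by (simp add: sv_content_def lookup_sum del: One_nat_def)
  also have "\<dots> = card {b \<in> S. k \<in> T b}"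
    using assms(1) by (simp add: card_eq_sum sum.inter_filter del: sum_constant One_nat_def)
  finally show ?thesis .
qed

lemma schur_summable:
  assumes "finite S"
  shows "formally_summable (\<lambda>T. monomial (content S T)) (SSYT S)"
  unfolding formally_summable_def
proof
  fix d :: exponent
  have "{T \<in> SSYT S. monomial (content S T) d \<noteq> 0} \<subseteq> S \<rightarrow>\<^sub>E Poly_Mapping.keys d"
  proof
    fix T assume "T \<in> {T \<in> SSYT S. monomial (content S T) d \<noteq> 0}"
    then have T: "T \<in> S \<rightarrow>\<^sub>E {1..}" and d: "d = content S T"
      by (auto simp: SSYT_def tableaux_def monomial_def split: if_splits)
    have "T b \<in> Poly_Mapping.keys d" if "b \<in> S" for b
      using that assms unfolding d in_keys_iff lookup_content[OF assms] by (cases b) auto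
    with T show "T \<in> S \<rightarrow>\<^sub>E Poly_Mapping.keys d" by (auto simp: PiE_def)
  qed
  then show "finite {T \<in> SSYT S. monomial (content S T) d \<noteq> 0}"
    by (rule finite_subset) (simp add: finite_PiE assms)
qed

lemma grothendieck_summable:
  assumes "finite S"
  shows "formally_summable
    (\<lambda>T. scale ((-1) ^ (sv_size S T - card S)) (monomial (sv_content S T))) (SVT S)"
  unfolding formally_summable_def
proof
  fix d :: exponent
  let ?X = "{T \<in> SVT S. scale ((-1) ^ (sv_size S T - card S)) (monomial (sv_content S T)) d \<noteq> 0}"
  have "?X \<subseteq> S \<rightarrow>\<^sub>E Pow (Poly_Mapping.keys d)"
  proof
    fix T assume "T \<in> ?X"
    then have T: "T \<in> sv_tableaux S" and d: "d = sv_content S T"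
      by (auto simp: SVT_def scale_def monomial_def split: if_splits)
    have "T b \<subseteq> Poly_Mapping.keys d" if "b \<in> S" for b
    proof
      fix k assume "k \<in> T b"
      with that have "{b \<in> S. k \<in> T b} \<noteq> {}" by blast
      with assms show "k \<in> Poly_Mapping.keys d"
        unfolding d in_keys_iff lookup_sv_content[OF assms T] by (simp only: card_eq_0_iff) simp
    qed
    with T show "T \<in> S \<rightarrow>\<^sub>E Pow (Poly_Mapping.keys d)" by (auto simp: sv_tableaux_def PiE_def)
  qed
  then show "finite ?X"
    by (rule finite_subset) (simp add: finite_PiE assms)
qed

end

theory Submission
  imports Defs
begin

text \<open>
  A skew shape occupying \<open>width\<close> consecutive columns is a pair \<open>a \<le> d\<close> of weakly decreasing row-length
  functions, and adding labels one at a time turns both series into products of one-variable transfer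
  operators. For Schur series the operator \<open>U(x)\<close> adds a horizontal strip. For Grothendieck series
  it also allows a factor \<open>1 - x\<close> at every addable corner whose column the strip has not met;
  summing over all larger lower boundaries (a telescoping sum) makes this operator \<open>V(x)\<close>
  independent of the shape.

  Let \<open>D\<^sub>k\<close> be the signed removal of vertical strips in rows \<open>\<ge> k\<close>. Then \<open>D\<^sub>k\<close> turns the operator
  with corner factors in rows \<open>\<le> k\<close> into the one with corner factors in rows \<open>< k\<close>, so
  \<open>D\<^sub>1 D\<^sub>2 \<dots> V(x) = U(x) D\<^sub>1 D\<^sub>2 \<dots>\<close>. The matrix of \<open>D\<^sub>1 D\<^sub>2 \<dots>\<close> is the signed count of
  row-weakly-bounded reverse row-strict tableaux. The inverse of \<open>D\<^sub>k\<close> removes horizontal strips in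
  rows \<open>\<ge> k\<close> without sign, so the inverse matrix counts semistandard tableaux with labels at most their
  row index. Splitting such a tableau at the boxes holding their own row index
  leaves the row-bounded tableaux together with a free choice of a larger boundary.
\<close>

section \<open>Row-length functions and strips\<close>

text \<open>The row bounds in \<open>b_coeff\<close> are the row thresholds of the operators: label
  \<open>k\<close> marks the strip handled by \<open>D\<^sub>k\<close> or its inverse, and both
  leave the rows above row \<open>k\<close> alone. One operator cannot remove all corner factors at
  once. In a row within reach of \<open>D\<^sub>k\<close>, keeping or removing one box gives x^m -
  x^(m+1), hence a factor \<open>1 - x\<close>; rows out of reach must get theirs from corners. If
  boxes are removed before the horizontal strip is added, row i of the intermediate shape governs
  the corner in row i + 1, so corners in rows 1..k are needed; if they are removed afterwards, row i
  governs the corner in row i, and rows 1..k-1 suffice. This offset makes \<open>D\<^sub>k\<close>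
  trade exactly one row of corners and forces the whole sequence of operators. Infinite products
  never occur. With n variables and an upper boundary of at most h rows, h + n operators are enough.
  The identity is therefore proved for finitely many values in any commutative ring, then
  instantiated with polynomials and compared coefficient by coefficient.\<close>

lemma sum_prod_rows:
  fixes g :: "nat \<Rightarrow> nat \<Rightarrow> 'r::comm_ring_1"
  assumes "\<And>i. i \<le> N \<Longrightarrow> finite (S i)"
  shows "(\<Sum>c\<in>{c. (\<forall>i\<le>N. c i \<in> S i) \<and> (\<forall>i>N. c i = 0)}. \<Prod>i\<le>N. g i (c i))
       = (\<Prod>i\<le>N. \<Sum>v\<in>S i. g i v)"
proof -
  have "(\<Prod>i\<le>N. \<Sum>v\<in>S i. g i v) = (\<Sum>c\<in>PiE {..N} S. \<Prod>i\<le>N. g i (c i))"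
    by (rule prod_sum_PiE) (use assms in auto)
  also have "\<dots> = (\<Sum>c\<in>{c. (\<forall>i\<le>N. c i \<in> S i) \<and> (\<forall>i>N. c i = 0)}. \<Prod>i\<le>N. g i (c i))"
    by (rule sum.reindex_bij_witness[where i = "\<lambda>c. restrict c {..N}"
          and j = "\<lambda>c i. if i \<le> N then c i else 0"])
      (auto simp: PiE_def extensional_def fun_eq_iff)
  finally show ?thesis ..
qed

locale columns =
  fixes off width :: nat
begin

text \<open>Partitions with at most \<open>N\<close> parts of size at most \<open>width\<close>,
  extended by a full row 0. The bound \<open>N\<close> gives finite sets and records how far down
  the operators can reach.\<close>

definition shapes_upto :: "nat \<Rightarrow> (nat \<Rightarrow> nat) set" where
  "shapes_upto N = {a. antimono a \<and> a 0 = width \<and> (\<forall>i>N. a i = 0)}"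

definition shapes :: "(nat \<Rightarrow> nat) set" where
  "shapes = (\<Union>N. shapes_upto N)"

text \<open>Rows are numbered from 1. Row 0 is full in every shape (\<open>a 0 = width\<close>), so it never meets a
  skew shape; it bounds row 1 in the strip conditions below.\<close>

definition skew :: "(nat \<Rightarrow> nat) \<Rightarrow> (nat \<Rightarrow> nat) \<Rightarrow> box set" where
  "skew d a = {(i, j). off + a i < j \<and> j \<le> off + d i}"

definition hstrip :: "(nat \<Rightarrow> nat) \<Rightarrow> (nat \<Rightarrow> nat) \<Rightarrow> bool" where
  "hstrip a d \<longleftrightarrow> a \<in> shapes \<and> d \<in> shapes \<and> (\<forall>i. a i \<le> d i \<and> d (Suc i) \<le> a i)"

definition vstrip_from :: "nat \<Rightarrow> (nat \<Rightarrow> nat) \<Rightarrow> (nat \<Rightarrow> nat) \<Rightarrow> bool" where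
  "vstrip_from k c a \<longleftrightarrow> c \<in> shapes \<and> a \<in> shapes \<and>
     (\<forall>i. c i \<le> a i \<and> a i \<le> c i + (if i < k then 0 else 1))"

definition hstrip_from :: "nat \<Rightarrow> (nat \<Rightarrow> nat) \<Rightarrow> (nat \<Rightarrow> nat) \<Rightarrow> bool" where
  "hstrip_from k c a \<longleftrightarrow> hstrip c a \<and> (\<forall>i<k. c i = a i)"

text \<open>The corner in row \<open>Suc i\<close> is addable to \<open>d\<close> and lies in a column not met by the strip
  \<open>d / a\<close> exactly if \<open>d (Suc i) < a i\<close>. The bound \<open>cap\<close> selects the corners that are counted: none for
  Schur series, those inside a given shape for Grothendieck series.\<close>

definition corners :: "(nat \<Rightarrow> nat) \<Rightarrow> (nat \<Rightarrow> nat) \<Rightarrow> (nat \<Rightarrow> nat) \<Rightarrow> nat set" where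
  "corners cap a d = {i. d (Suc i) < a i \<and> d (Suc i) < cap (Suc i)}"

definition vweight :: "(nat \<Rightarrow> nat) \<Rightarrow> 'r \<Rightarrow> (nat \<Rightarrow> nat) \<Rightarrow> (nat \<Rightarrow> nat) \<Rightarrow> 'r::comm_ring_1" where
  "vweight cap x a d = x ^ card (skew d a) * (1 - x) ^ card (corners cap a d)"

text \<open>Used as a cap, it admits exactly the corners in rows at most \<open>k\<close>; with
  \<open>rect 0\<close> no corner counts and \<open>vweight\<close> is the Schur weight.\<close>

definition rect :: "nat \<Rightarrow> nat \<Rightarrow> nat" where
  "rect k i = (if i \<le> k then width else 0)"

lemma shapes_upto_mono: "M \<le> N \<Longrightarrow> shapes_upto M \<subseteq> shapes_upto N"
  by (auto simp: shapes_upto_def)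

lemma shapes_le_width: "a \<in> shapes \<Longrightarrow> a i \<le> width"
  unfolding shapes_def shapes_upto_def by (auto dest: antimonoD[of a 0 i])

lemma shapes_antimono: "a \<in> shapes \<Longrightarrow> i \<le> j \<Longrightarrow> a j \<le> a i"
  unfolding shapes_def shapes_upto_def by (auto dest: antimonoD)

lemma shapes_0: "a \<in> shapes \<Longrightarrow> a 0 = width"
  unfolding shapes_def shapes_upto_def by auto

lemma shapes_upto_shapes: "a \<in> shapes_upto N \<Longrightarrow> a \<in> shapes"
  by (auto simp: shapes_def)

lemma shapes_obtain2:
  assumes "a \<in> shapes" "b \<in> shapes"
  obtains N where "a \<in> shapes_upto N" "b \<in> shapes_upto N"
proof -
  obtain M M' where "a \<in> shapes_upto M" "b \<in> shapes_upto M'"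
    using assms by (auto simp: shapes_def)
  then have "a \<in> shapes_upto (max M M')" "b \<in> shapes_upto (max M M')"
    using shapes_upto_mono[of M "max M M'"] shapes_upto_mono[of M' "max M M'"] by auto
  then show thesis by (rule that)
qed

lemma shapesI:
  assumes "a 0 = width" "\<And>i. a (Suc i) \<le> a i" "\<And>i. i > N \<Longrightarrow> a i = 0"
  shows "a \<in> shapes_upto N" "a \<in> shapes"
  using assms by (auto simp: shapes_def shapes_upto_def antimono_iff_le_Suc)

lemma finite_shapes_upto: "finite (shapes_upto N)"
proof (rule finite_subset)
  show "shapes_upto N \<subseteq> {f. \<forall>x. (x \<in> {..N} \<longrightarrow> f x \<in> {..width}) \<and> (x \<notin> {..N} \<longrightarrow> f x = 0)}"
    using shapes_le_width by (auto simp: shapes_upto_def shapes_def)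
  show "finite \<dots>" by (rule finite_set_of_finite_funs) auto
qed

text \<open>Interlacing allows one new row per horizontal strip. This is the source of every bound
  of the form \<open>M + length xs\<close> or \<open>h + n\<close>.\<close>

lemma hstrip_upto: "hstrip a d \<Longrightarrow> a \<in> shapes_upto N \<Longrightarrow> d \<in> shapes_upto (Suc N)"
  unfolding hstrip_def shapes_upto_def shapes_def
  by (auto simp: less_Suc_eq_0_disj Suc_less_eq2) (metis le_zero_eq)

lemma le_upto: "d \<in> shapes \<Longrightarrow> (\<And>i. d i \<le> a i) \<Longrightarrow> a \<in> shapes_upto N \<Longrightarrow> d \<in> shapes_upto N"
  unfolding shapes_upto_def shapes_def by auto (metis le_zero_eq)

lemma finite_below: "a \<in> shapes \<Longrightarrow> finite {d \<in> shapes. \<forall>i. d i \<le> a i}"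
  by (metis (mono_tags, lifting) UN_E finite_shapes_upto finite_subset le_upto mem_Collect_eq
      shapes_def subsetI)

lemma finite_hstrip: "finite {d. hstrip a d}"
proof (cases "a \<in> shapes")
  case True
  then obtain N where "a \<in> shapes_upto N" by (auto simp: shapes_def)
  then have "{d. hstrip a d} \<subseteq> shapes_upto (Suc N)" using hstrip_upto by auto
  then show ?thesis using finite_shapes_upto finite_subset by blast
qed (simp add: hstrip_def)

lemma finite_vstrip: "finite {c. vstrip_from k c a}"
proof (cases "a \<in> shapes")
  case True
  show ?thesis by (rule finite_subset[OF _ finite_below[OF True]]) (auto simp: vstrip_from_def)
qed (simp add: vstrip_from_def)

lemma finite_hstrip_from: "finite {c. hstrip_from k c a}"
proof (cases "a \<in> shapes")
  case True
  show ?thesis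
    by (rule finite_subset[OF _ finite_below[OF True]]) (auto simp: hstrip_from_def hstrip_def)
qed (simp add: hstrip_from_def hstrip_def)

lemma skew_Sigma: "d \<in> shapes_upto N \<Longrightarrow> skew d a = (SIGMA i:{..N}. {off + a i<..off + d i})"
  by (auto simp: skew_def shapes_upto_def) (metis add.right_neutral le_add1 leD le_less_trans not_less)

lemma finite_skew: "d \<in> shapes \<Longrightarrow> finite (skew d a)"
  by (auto simp: shapes_def skew_Sigma)

lemma card_skew: "d \<in> shapes_upto N \<Longrightarrow> card (skew d a) = (\<Sum>i\<le>N. d i - a i)"
  by (simp add: skew_Sigma)

lemma corners_subset: "a \<in> shapes_upto N \<Longrightarrow> corners cap a d \<subseteq> {..N}"
  by (auto simp: corners_def shapes_upto_def) (metis not_less not_less0)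

lemma vweight_prod:
  assumes "a \<in> shapes_upto N" "d \<in> shapes_upto N"
  shows "vweight cap x a d = (\<Prod>i\<le>N. x ^ (d i - a i) *
           (if d (Suc i) < a i \<and> d (Suc i) < cap (Suc i) then 1 - x else 1))"
proof -
  have "(1 - x) ^ card (corners cap a d) = (\<Prod>i\<in>{..N} \<inter> corners cap a d. 1 - x)"
    using corners_subset[OF assms(1)] by (simp add: Int_absorb1)
  also have "\<dots> = (\<Prod>i\<le>N. if i \<in> corners cap a d then 1 - x else 1)"
    by (simp add: prod.If_cases)
  finally show ?thesis
    by (simp add: vweight_def card_skew[OF assms(2)] power_sum prod.distrib corners_def
        cong: if_cong)
qed

lemma sign_prod:
  assumes "a \<in> shapes_upto N"
  shows "(- 1) ^ card (skew a c) = (\<Prod>i\<le>N. (- 1 :: 'r::comm_ring_1) ^ (a i - c i))"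
  by (simp add: card_skew[OF assms] power_sum)

text \<open>For fixed \<open>a\<close> and \<open>b\<close> both sums factor over the rows. The two products differ only in the
  exponents \<open>eL\<close> and \<open>eR\<close> of \<open>1 - x\<close>, and \<open>eL i - eR (Suc i)\<close> is a telescoping difference.\<close>

lemma vstrip_hstrip_kernel:
  fixes x :: "'r::comm_ring_1"
  assumes "a \<in> shapes" "b \<in> shapes" "1 \<le> k"
  shows "(\<Sum>c | vstrip_from k c a \<and> hstrip c b. (- 1) ^ card (skew a c) * vweight (rect k) x c b)
       = (\<Sum>d | hstrip a d \<and> vstrip_from k b d.
            vweight (rect (k - 1)) x a d * (- 1) ^ card (skew d b))"
proof -
  obtain N where N: "a \<in> shapes_upto N" "b \<in> shapes_upto N"
    using shapes_obtain2 assms by metis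
  \<comment> \<open>One spare row: \<open>d\<close> may occupy row \<open>Suc N\<close>, and
    \<open>a M = b M = 0\<close> closes the telescoping sum below.\<close>
  define M where "M = Suc N"
  have M: "a \<in> shapes_upto M" "b \<in> shapes_upto M" "a M = 0" "b M = 0"
    and a0: "a 0 = width" "b 0 = width"
    using N by (auto simp: shapes_upto_def M_def)
  have anti: "a (Suc i) \<le> a i" "b (Suc i) \<le> b i" for i
    using assms shapes_antimono by auto
  have large: "a i = 0" "b i = 0" if "i \<ge> M" for i using N that by (auto simp: shapes_upto_def M_def)
  \<comment> \<open>With \<open>a\<close> and \<open>b\<close> fixed, the rows of the intermediate
    shape vary independently: \<open>b (Suc i) \<le> c i \<le> b i\<close> already forces
    \<open>c\<close> to decrease, and \<open>a i \<le> d i \<le> a (i - 1)\<close> does the same for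
    \<open>d\<close>.\<close>
  define C where "C i = {c. c \<le> a i \<and> a i \<le> c + (if i < k then 0 else 1) \<and> b (Suc i) \<le> c \<and> c \<le> b i}" for i
  define D where "D i = {d. a i \<le> d \<and> (0 < i \<longrightarrow> d \<le> a (i - 1)) \<and> b i \<le> d \<and> d \<le> b i + (if i < k then 0 else 1)}" for i
  have finC: "finite (C i)" for i by (rule finite_subset[of _ "{..a i}"]) (auto simp: C_def)
  have finD: "finite (D i)" for i by (rule finite_subset[of _ "{..b i + 1}"]) (auto simp: D_def)
  have Cset: "{c. vstrip_from k c a \<and> hstrip c b} = {c. (\<forall>i\<le>M. c i \<in> C i) \<and> (\<forall>i>M. c i = 0)}"
    (is "?A = ?B")
  proof
    show "?A \<subseteq> ?B" using large
      by (auto simp: C_def vstrip_from_def hstrip_def) (metis le_zero_eq less_imp_le_nat)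
    show "?B \<subseteq> ?A"
    proof
      fix c assume c: "c \<in> ?B"
      have CC: "c i \<le> a i \<and> a i \<le> c i + (if i < k then 0 else 1) \<and> b (Suc i) \<le> c i \<and> c i \<le> b i" for i
        using c large[of i] large[of "Suc i"] by (cases "i \<le> M") (auto simp: C_def)
      have "c \<in> shapes"
        by (rule shapesI[of _ M])
          (use CC[of 0] assms(3) a0 CC c in \<open>auto intro: le_trans split: if_splits\<close>)
      then show "c \<in> ?A" using CC assms by (auto simp: vstrip_from_def hstrip_def)
    qed
  qed
  have Dset: "{d. hstrip a d \<and> vstrip_from k b d} = {c. (\<forall>i\<le>M. c i \<in> D i) \<and> (\<forall>i>M. c i = 0)}"
    (is "?A = ?B")
  proof
    show "?A \<subseteq> ?B"
    proof
      fix d assume d: "d \<in> ?A"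
      then have "d \<in> shapes_upto M" using hstrip_upto N by (auto simp: M_def)
      moreover have "d i \<le> a (i - 1)" if "0 < i" for i
        using d that by (cases i) (auto simp: hstrip_def)
      ultimately show "d \<in> ?B"
        using d by (auto simp: D_def vstrip_from_def hstrip_def shapes_upto_def)
    qed
    show "?B \<subseteq> ?A"
    proof
      fix d assume d: "d \<in> ?B"
      have DD: "a i \<le> d i \<and> d (Suc i) \<le> a i \<and> b i \<le> d i \<and> d i \<le> b i + (if i < k then 0 else 1)" for i
      proof -
        have "a i \<le> d i \<and> b i \<le> d i \<and> d i \<le> b i + (if i < k then 0 else 1)"
          using d large[of i] by (cases "i \<le> M") (auto simp: D_def)
        moreover have "d (Suc i) \<le> a i"
          using d by (cases "Suc i \<le> M") (fastforce simp: D_def)+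
        ultimately show ?thesis by blast
      qed
      have "d \<in> shapes"
        by (rule shapesI[of _ M])
          (use DD[of 0] assms(3) a0 DD d in \<open>auto intro: le_trans split: if_splits\<close>)
      then show "d \<in> ?A" using DD assms by (auto simp: vstrip_from_def hstrip_def)
    qed
  qed
  \<comment> \<open>The part of the row factor common to both sides. If
    \<open>a i = Suc (b i)\<close>, the one overhanging box must be removed, which leaves only its
    sign.\<close>
  define l where "l i = (if a i \<le> b i then x ^ (b i - a i) else -1)" for i
  define eL where "eL i = (of_bool (a i \<le> b i \<and> b (Suc i) < a i) :: nat)" for i
  define eR where "eR i = (case i of 0 \<Rightarrow> 0
      | Suc j \<Rightarrow> (of_bool (a i \<le> b i \<and> b i < a j) :: nat))" for i
  define ok where "ok i \<longleftrightarrow> a i \<le> b i \<or> (a i = Suc (b i) \<and> k \<le> i)" for i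
  have left: "(\<Sum>v\<in>C i. (- 1) ^ (a i - v) * (x ^ (b i - v) *
      (if b (Suc i) < v \<and> b (Suc i) < rect k (Suc i) then 1 - x else 1)))
    = (if ok i \<and> b (Suc i) \<le> a i then l i * (1 - x) ^ eL i else 0)" (is "?s = ?t") for i
  proof -
    consider (bad) "\<not> ok i \<or> a i < b (Suc i)"
      | (neg) "a i = Suc (b i)" "k \<le> i"
      | (eq) "a i \<le> b i" "a i = b (Suc i)"
      | (low) "a i \<le> b i" "b (Suc i) < a i" "i < k"
      | (high) "a i \<le> b i" "b (Suc i) < a i" "k \<le> i"
      unfolding ok_def using not_le by fastforce
    then show ?thesis
    proof cases
      case bad
      then have "C i = {}" by (auto simp: C_def ok_def split: if_splits)
      then show ?thesis using bad by auto
    next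
      case neg
      then have "C i = {b i}" using anti[of i] by (auto simp: C_def)
      then show ?thesis using neg anti[of i] by (auto simp: ok_def l_def eL_def rect_def)
    next
      case eq
      then have "C i = {a i}" by (auto simp: C_def)
      then show ?thesis using eq by (auto simp: ok_def l_def eL_def)
    next
      case low
      then have "C i = {a i}" by (auto simp: C_def)
      then show ?thesis
        using low shapes_le_width[OF assms(1), of i] by (auto simp: ok_def l_def eL_def rect_def)
    next
      case high
      \<comment> \<open>The two choices contribute x^m - x^(m+1) with m = \<open>b i - a i\<close>.
        This replaces the factor \<open>1 - x\<close> that \<open>rect k\<close> withholds from the
        corner in row \<open>Suc i\<close>.\<close>
      then have "C i = {a i - 1, a i}" by (auto simp: C_def)
      moreover have "b i - (a i - Suc 0) = Suc (b i - a i)" "a i - Suc 0 \<noteq> a i" "a i - (a i - Suc 0) = 1"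
        using high by auto
      ultimately show ?thesis using high
        by (auto simp: ok_def l_def eL_def rect_def algebra_simps)
    qed
  qed
  have right: "(\<Sum>v\<in>D (Suc i). x ^ (v - a (Suc i)) *
      (if v < a i \<and> v < rect (k - 1) (Suc i) then 1 - x else 1) * (- 1) ^ (v - b (Suc i)))
    = (if ok (Suc i) \<and> b (Suc i) \<le> a i then l (Suc i) * (1 - x) ^ eR (Suc i) else 0)" (is "?s = ?t") for i
  proof -
    let ?j = "Suc i"
    consider (bad) "\<not> ok ?j \<or> a i < b ?j"
      | (neg) "a ?j = Suc (b ?j)" "k \<le> ?j"
      | (eq) "a ?j \<le> b ?j" "a i = b ?j"
      | (low) "a ?j \<le> b ?j" "b ?j < a i" "?j < k"
      | (high) "a ?j \<le> b ?j" "b ?j < a i" "k \<le> ?j"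
      unfolding ok_def using not_le by fastforce
    then show ?thesis
    proof cases
      case bad
      then have "D ?j = {}" by (auto simp: D_def ok_def split: if_splits)
      then show ?thesis using bad by auto
    next
      case neg
      then have "D ?j = {Suc (b ?j)}" using anti[of i] by (auto simp: D_def)
      moreover have "ok ?j" "b ?j \<le> a i" "l ?j = -1" "eR ?j = 0" "Suc (b ?j) - a ?j = 0"
        "rect (k - 1) ?j = 0" "Suc (b ?j) - b ?j = 1"
        using neg anti[of i] assms(3) unfolding ok_def l_def eR_def rect_def by auto
      ultimately show ?thesis by simp
    next
      case eq
      then have "D ?j = {b ?j}" by (auto simp: D_def)
      then show ?thesis using eq by (auto simp: ok_def l_def eR_def)
    next
      case low
      then have "D ?j = {b ?j}" by (auto simp: D_def)
      then show ?thesis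
        using low shapes_le_width[OF assms(1), of i] by (auto simp: ok_def l_def eR_def rect_def)
    next
      case high
      \<comment> \<open>Again x^m - x^(m+1): the optional extra box of \<open>d\<close> is removed
        with a sign, which makes up for the corner in row \<open>?j\<close> not counted by
        \<open>rect (k - 1)\<close>.\<close>
      then have "D ?j = {b ?j, Suc (b ?j)}" by (auto simp: D_def)
      moreover have "Suc (b ?j) - a ?j = Suc (b ?j - a ?j)" using high by auto
      ultimately show ?thesis using high
        by (auto simp: ok_def l_def eR_def rect_def algebra_simps)
    qed
  qed
  have "(\<Sum>c | vstrip_from k c a \<and> hstrip c b. (- 1) ^ card (skew a c) * vweight (rect k) x c b)
    = (\<Sum>c | vstrip_from k c a \<and> hstrip c b. \<Prod>i\<le>M. (- 1) ^ (a i - c i) * (x ^ (b i - c i) *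
      (if b (Suc i) < c i \<and> b (Suc i) < rect k (Suc i) then 1 - x else 1)))"
  proof (rule sum.cong[OF refl])
    fix c assume "c \<in> {c. vstrip_from k c a \<and> hstrip c b}"
    then have "c \<in> shapes_upto M" using le_upto[OF _ _ M(1)] by (auto simp: vstrip_from_def)
    then show "(- 1) ^ card (skew a c) * vweight (rect k) x c b = (\<Prod>i\<le>M. (- 1) ^ (a i - c i) * (x ^ (b i - c i) *
      (if b (Suc i) < c i \<and> b (Suc i) < rect k (Suc i) then 1 - x else 1)))"
      using M by (simp add: sign_prod[of _ M] vweight_prod[of _ M] prod.distrib)
  qed
  also have "\<dots> = (\<Prod>i\<le>M. if ok i \<and> b (Suc i) \<le> a i then l i * (1 - x) ^ eL i else 0)"
    unfolding Cset by (subst sum_prod_rows[OF finC, where g="\<lambda>i v. (- 1) ^ (a i - v) * (x ^ (b i - v) *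
      (if b (Suc i) < v \<and> b (Suc i) < rect k (Suc i) then 1 - x else 1))"]) (simp add: left)
  also have "\<dots> = (\<Prod>i\<le>M. if ok i \<and> (0 < i \<longrightarrow> b i \<le> a (i - 1)) then l i * (1 - x) ^ eR i else 0)"
  proof (cases "\<forall>i. ok i \<and> b (Suc i) \<le> a i")
    case True
    then have T': "ok i \<and> (0 < i \<longrightarrow> b i \<le> a (i - 1))" for i
      by (cases i) auto
    \<comment> \<open>\<open>t\<close> marks the rows where \<open>a\<close> overhangs
      \<open>b\<close>. Both \<open>eL i + t i\<close> and \<open>eR (Suc i) + t (Suc i)\<close>
      indicate whether \<open>b (Suc i) < a i\<close>, so the total exponents differ only by
      boundary terms, and \<open>t 0 = t M = 0\<close>.\<close>
    define t where "t i = (of_bool (b i < a i) :: nat)" for i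
    have "eL i + t i = eR (Suc i) + t (Suc i)" for i
      using True[rule_format, of i] True[rule_format, of "Suc i"] anti[of i]
      unfolding eL_def eR_def t_def ok_def by (auto simp: of_bool_def)
    then have "(\<Sum>i<n. eL i) = (\<Sum>i<n. eR (Suc i)) + t n" for n
    proof (induction n)
      case 0 then show ?case using a0 by (simp add: t_def)
    next
      case (Suc n)
      from Suc.prems[of n] Suc.IH[OF Suc.prems] show ?case by simp
    qed
    from this[of M] have "(\<Sum>i<M. eL i) = (\<Sum>i<M. eR (Suc i))" using M by (simp add: t_def)
    moreover have "(\<Sum>i\<le>M. eL i) = (\<Sum>i<M. eL i)"
      using M by (simp add: lessThan_Suc_atMost[symmetric] eL_def)
    moreover have "(\<Sum>i\<le>M. eR i) = (\<Sum>i<M. eR (Suc i))"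
      by (simp add: lessThan_Suc_atMost[symmetric] sum.lessThan_Suc_shift eR_def del: sum.lessThan_Suc)
    ultimately have "(\<Sum>i\<le>M. eL i) = (\<Sum>i\<le>M. eR i)" by simp
    then have "(\<Prod>i\<le>M. l i * (1 - x) ^ eL i) = (\<Prod>i\<le>M. l i * (1 - x) ^ eR i)"
      by (simp add: prod.distrib power_sum[symmetric])
    then show ?thesis using True T' by simp
  next
    case False
    \<comment> \<open>A violated condition kills both products, possibly in different rows:
      \<open>b (Suc i) \<le> a i\<close> belongs to row \<open>i\<close> on the left and to row
      \<open>Suc i\<close> on the right.\<close>
    then obtain i where i: "\<not> (ok i \<and> b (Suc i) \<le> a i)" by blast
    then have "i < M" using large[of i] large[of "Suc i"] by (cases "i < M") (auto simp: ok_def)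
    then have "(\<Prod>i\<le>M. if ok i \<and> b (Suc i) \<le> a i then l i * (1 - x) ^ eL i else 0) = 0"
      using i by (intro prod_zero) auto
    moreover have "(\<Prod>i\<le>M. if ok i \<and> (0 < i \<longrightarrow> b i \<le> a (i - 1)) then l i * (1 - x) ^ eR i else 0) = 0"
    proof (cases "ok i")
      case True
      then show ?thesis using i \<open>i < M\<close> by (intro prod_zero bexI[of _ "Suc i"]) auto
    next
      case False
      then show ?thesis using i \<open>i < M\<close> by (intro prod_zero bexI[of _ i]) auto
    qed
    ultimately show ?thesis by simp
  qed
  also have "\<dots> = (\<Prod>i\<le>M. \<Sum>v\<in>D i. x ^ (v - a i) *
      (if 0 < i \<and> v < a (i - 1) \<and> v < rect (k - 1) i then 1 - x else 1) * (- 1) ^ (v - b i))"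
  proof (rule prod.cong[OF refl])
    fix i assume "i \<in> {..M}"
    show "(if ok i \<and> (0 < i \<longrightarrow> b i \<le> a (i - 1)) then l i * (1 - x) ^ eR i else 0)
      = (\<Sum>v\<in>D i. x ^ (v - a i) *
      (if 0 < i \<and> v < a (i - 1) \<and> v < rect (k - 1) i then 1 - x else 1) * (- 1) ^ (v - b i))"
    proof (cases i)
      case 0
      \<comment> \<open>Row 0 is full, and \<open>1 \<le> k\<close> keeps the vertical strip out of
        it.\<close>
      then have "D i = {width}" using assms(3) a0 by (auto simp: D_def)
      then show ?thesis using 0 a0 by (simp add: ok_def l_def eR_def)
    next
      case (Suc j)
      then show ?thesis using right[of j] by simp
    qed
  qed
  also have "\<dots> = (\<Sum>d | hstrip a d \<and> vstrip_from k b d. \<Prod>i\<le>M. x ^ (d i - a i) *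
      (if 0 < i \<and> d i < a (i - 1) \<and> d i < rect (k - 1) i then 1 - x else 1) * (- 1) ^ (d i - b i))"
    unfolding Dset by (rule sum_prod_rows[OF finD, symmetric])
  also have "\<dots> = (\<Sum>d | hstrip a d \<and> vstrip_from k b d.
            vweight (rect (k - 1)) x a d * (- 1) ^ card (skew d b))"
  proof (rule sum.cong[OF refl])
    fix d assume "d \<in> {d. hstrip a d \<and> vstrip_from k b d}"
    then have d: "d \<in> shapes_upto M" using hstrip_upto N by (auto simp: M_def)
    let ?h = "\<lambda>i. if d (Suc i) < a i \<and> d (Suc i) < rect (k - 1) (Suc i) then 1 - x else 1"
    \<comment> \<open>Here a corner factor is indexed by its own row, in \<open>vweight_prod\<close>
      by the row above. The shift is harmless: row 0 has no corner, and \<open>a M = 0\<close>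
      excludes one below row \<open>M\<close>.\<close>
    have "(\<Prod>i\<le>M. if 0 < i \<and> d i < a (i - 1) \<and> d i < rect (k - 1) i then 1 - x else 1) = (\<Prod>i\<le>N. ?h i)"
      unfolding M_def by (simp add: prod.atMost_Suc_shift del: prod.atMost_Suc)
    also have "\<dots> = (\<Prod>i\<le>M. ?h i)" using M(3) by (simp add: M_def)
    finally show "(\<Prod>i\<le>M. x ^ (d i - a i) *
      (if 0 < i \<and> d i < a (i - 1) \<and> d i < rect (k - 1) i then 1 - x else 1) * (- 1) ^ (d i - b i))
      = vweight (rect (k - 1)) x a d * (- 1) ^ card (skew d b)"
      using M d by (simp add: sign_prod[of _ M] vweight_prod[of _ M] prod.distrib)
  qed
  finally show ?thesis .
qed

end

section \<open>Transfer operators\<close>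

context columns begin

definition Vop :: "(nat \<Rightarrow> nat) \<Rightarrow> 'r::comm_ring_1 \<Rightarrow> ((nat \<Rightarrow> nat) \<Rightarrow> 'r) \<Rightarrow> (nat \<Rightarrow> nat) \<Rightarrow> 'r" where
  "Vop cap x f a = (\<Sum>d | hstrip a d. vweight cap x a d * f d)"

definition Dop :: "nat \<Rightarrow> ((nat \<Rightarrow> nat) \<Rightarrow> 'r::comm_ring_1) \<Rightarrow> (nat \<Rightarrow> nat) \<Rightarrow> 'r" where
  "Dop k f a = (\<Sum>c | vstrip_from k c a. (- 1) ^ card (skew a c) * f c)"

definition Hop :: "nat \<Rightarrow> ((nat \<Rightarrow> nat) \<Rightarrow> 'r::comm_ring_1) \<Rightarrow> (nat \<Rightarrow> nat) \<Rightarrow> 'r" where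
  "Hop k f a = (\<Sum>c | hstrip_from k c a. f c)"

text \<open>The basis vector at \<open>q\<close>: a product of operators applied to
  \<open>delta q\<close> and evaluated at \<open>p\<close> is the matrix entry from \<open>p\<close>
  to \<open>q\<close>.\<close>

definition delta :: "(nat \<Rightarrow> nat) \<Rightarrow> (nat \<Rightarrow> nat) \<Rightarrow> 'r::comm_ring_1" where
  "delta q a = of_bool (a = q)"

text \<open>Matrix multiplication. \<open>B\<close> may be any finite set that contains the
  endpoints reached, so two different composites can be compared entry by entry over the same index
  set.\<close>

lemma sum_kernel_compose:
  fixes f :: "'a \<Rightarrow> 'r::comm_ring_1"
  assumes "finite {c. R c}" "finite B" "\<And>c b. R c \<Longrightarrow> S c b \<Longrightarrow> b \<in> B"
  shows "(\<Sum>c | R c. u c * (\<Sum>b | S c b. v c b * f b))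
       = (\<Sum>b\<in>B. (\<Sum>c | R c \<and> S c b. u c * v c b) * f b)"
proof -
  have "(\<Sum>c | R c. u c * (\<Sum>b | S c b. v c b * f b))
      = (\<Sum>c\<in>{c. R c}. \<Sum>b\<in>{b. b \<in> B \<and> S c b}. u c * v c b * f b)"
  proof (rule sum.cong[OF refl])
    fix c assume "c \<in> {c. R c}"
    then have "{b. S c b} = {b. b \<in> B \<and> S c b}" using assms(3) by auto
    then show "u c * (\<Sum>b | S c b. v c b * f b) = (\<Sum>b\<in>{b. b \<in> B \<and> S c b}. u c * v c b * f b)"
      by (simp add: sum_distrib_left mult.assoc)
  qed
  also have "\<dots> = (\<Sum>b\<in>B. \<Sum>c\<in>{c. c \<in> {c. R c} \<and> S c b}. u c * v c b * f b)"
    by (rule sum.swap_restrict) (use assms in auto)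
  finally show ?thesis by (simp add: sum_distrib_right)
qed

lemma Dop_Vop:
  fixes f :: "(nat \<Rightarrow> nat) \<Rightarrow> 'r::comm_ring_1"
  assumes "1 \<le> k"
  shows "Dop k (Vop (rect k) x f) = Vop (rect (k - 1)) x (Dop k f)"
proof
  fix a :: "nat \<Rightarrow> nat"
  show "Dop k (Vop (rect k) x f) a = Vop (rect (k - 1)) x (Dop k f) a"
  proof (cases "a \<in> shapes")
    case True
    define B where "B = (\<Union>c\<in>{c. vstrip_from k c a}. {b. hstrip c b}) \<union>
        (\<Union>d\<in>{d. hstrip a d}. {b. vstrip_from k b d})"
    have B: "finite B" by (auto simp: B_def finite_vstrip finite_hstrip)
    have sh: "b \<in> shapes" if "b \<in> B" for b
      using that by (auto simp: B_def hstrip_def vstrip_from_def)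
    have "(\<Sum>b\<in>B. (\<Sum>c | vstrip_from k c a \<and> hstrip c b. (- 1) ^ card (skew a c) * vweight (rect k) x c b) * f b)
      = (\<Sum>b\<in>B. (\<Sum>d | hstrip a d \<and> vstrip_from k b d.
            vweight (rect (k - 1)) x a d * (- 1) ^ card (skew d b)) * f b)"
      by (rule sum.cong[OF refl]) (simp only: vstrip_hstrip_kernel[OF True sh assms])
    moreover have "Dop k (Vop (rect k) x f) a = (\<Sum>b\<in>B. (\<Sum>c | vstrip_from k c a \<and> hstrip c b. (- 1) ^ card (skew a c) * vweight (rect k) x c b) * f b)"
      unfolding Dop_def Vop_def
      by (rule sum_kernel_compose[OF finite_vstrip B]) (auto simp: B_def)
    moreover have "Vop (rect (k - 1)) x (Dop k f) a = (\<Sum>b\<in>B. (\<Sum>d | hstrip a d \<and> vstrip_from k b d.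
            vweight (rect (k - 1)) x a d * (- 1) ^ card (skew d b)) * f b)"
      unfolding Dop_def Vop_def
      by (rule sum_kernel_compose[OF finite_hstrip B]) (auto simp: B_def)
    ultimately show ?thesis by simp
  qed (simp add: Dop_def Vop_def hstrip_def vstrip_from_def)
qed

text \<open>Everything cancels in the first row where \<open>b\<close> and \<open>a\<close> differ.
  The row above agrees, so \<open>c i \<le> b (i - 1)\<close> does not constrain \<open>c i\<close>
  there; either both \<open>a i\<close> and \<open>a i - 1\<close> are admissible, with opposite
  signs, or nothing is.\<close>

lemma vstrip_hstrip_inverse:
  assumes "a \<in> shapes" "b \<in> shapes"
  shows "(\<Sum>c | vstrip_from k c a \<and> hstrip_from k b c. (- 1) ^ card (skew a c))
       = (of_bool (b = a) :: 'r::comm_ring_1)"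
proof -
  obtain N where N: "a \<in> shapes_upto N" "b \<in> shapes_upto N"
    using shapes_obtain2 assms by metis
  have large: "a i = 0" "b i = 0" if "i > N" for i using N that by (auto simp: shapes_upto_def)
  have a0: "a 0 = width" "b 0 = width" using assms shapes_0 by auto
  have anti: "a (Suc i) \<le> a i" "b (Suc i) \<le> b i" for i
    using assms shapes_antimono by auto
  define C where "C i = {c. c \<le> a i \<and> a i \<le> c + (if i < k then 0 else 1) \<and> b i \<le> c \<and>
      (i < k \<longrightarrow> b i = c) \<and> (0 < i \<longrightarrow> c \<le> b (i - 1))}" for i
  have finC: "finite (C i)" for i by (rule finite_subset[of _ "{..a i}"]) (auto simp: C_def)
  have Cset: "{c. vstrip_from k c a \<and> hstrip_from k b c} = {c. (\<forall>i\<le>N. c i \<in> C i) \<and> (\<forall>i>N. c i = 0)}"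
    (is "?A = ?B")
  proof
    show "?A \<subseteq> ?B"
    proof
      fix c assume c: "c \<in> ?A"
      have "c i \<le> b (i - 1)" if "0 < i" for i
        using c that by (cases i) (auto simp: hstrip_from_def hstrip_def)
      then show "c \<in> ?B" using c large
        by (auto simp: C_def vstrip_from_def hstrip_def hstrip_from_def) (metis le_zero_eq)
    qed
    show "?B \<subseteq> ?A"
    proof
      fix c assume c: "c \<in> ?B"
      have CC: "c i \<le> a i \<and> a i \<le> c i + (if i < k then 0 else 1) \<and> b i \<le> c i \<and> (i < k \<longrightarrow> b i = c i) \<and> c (Suc i) \<le> b i" for i
      proof -
        have "c i \<le> a i \<and> a i \<le> c i + (if i < k then 0 else 1) \<and> b i \<le> c i \<and> (i < k \<longrightarrow> b i = c i)"
          using c large[of i] by (cases "i \<le> N") (auto simp: C_def)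
        moreover have "c (Suc i) \<le> b i"
          using c by (cases "Suc i \<le> N") (fastforce simp: C_def)+
        ultimately show ?thesis by blast
      qed
      have "c \<in> shapes"
        by (rule shapesI[of _ N]) (use CC[of 0] a0 CC c in \<open>auto intro: le_trans\<close>)
      then show "c \<in> ?A" using CC assms by (auto simp: vstrip_from_def hstrip_def hstrip_from_def)
    qed
  qed
  have "(\<Sum>c | vstrip_from k c a \<and> hstrip_from k b c. (- 1) ^ card (skew a c))
      = (\<Sum>c | vstrip_from k c a \<and> hstrip_from k b c. \<Prod>i\<le>N. (- 1 :: 'r) ^ (a i - c i))"
    by (simp add: sign_prod[OF N(1)])
  also have "\<dots> = (\<Prod>i\<le>N. \<Sum>v\<in>C i. (- 1) ^ (a i - v))"
    unfolding Cset by (rule sum_prod_rows[OF finC])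
  also have "\<dots> = of_bool (b = a)"
  proof (cases "b = a")
    case True
    have "C i = {a i}" for i
      using True anti(1)[of "i - 1"] by (cases i) (auto simp: C_def)
    then show ?thesis using True by simp
  next
    case False
    define i where "i = (LEAST i. b i \<noteq> a i)"
    have i: "b i \<noteq> a i" unfolding i_def by (rule LeastI_ex) (use False in auto)
    have "b j = a j" if "j < i" for j using not_less_Least that unfolding i_def by blast
    moreover have "0 < i" using i a0 by (cases i) auto
    ultimately have prev: "b (i - 1) = a (i - 1)" by simp
    have "i \<le> N" using i large[of i] by (cases "i \<le> N") auto
    have "(\<Sum>v\<in>C i. (- 1 :: 'r) ^ (a i - v)) = 0"
    proof (cases "k \<le> i \<and> b i < a i")
      case True
      then have "C i = {a i - 1, a i}"
        using anti(1)[of "i - 1"] \<open>0 < i\<close> prev by (auto simp: C_def)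
      moreover have "a i - 1 \<noteq> a i" "a i - (a i - 1) = 1" using True by auto
      ultimately show ?thesis by simp
    next
      case False
      then have "C i = {}" using i by (auto simp: C_def)
      then show ?thesis by simp
    qed
    then show ?thesis using False \<open>i \<le> N\<close> by (auto intro!: prod_zero)
  qed
  finally show ?thesis .
qed

lemma Dop_Hop:
  fixes f :: "(nat \<Rightarrow> nat) \<Rightarrow> 'r::comm_ring_1"
  assumes "a \<in> shapes"
  shows "Dop k (Hop k f) a = f a"
proof -
  define B where "B = insert a (\<Union>c\<in>{c. vstrip_from k c a}. {b. hstrip_from k b c})"
  have B: "finite B" by (auto simp: B_def finite_vstrip finite_hstrip_from)
  have sh: "b \<in> shapes" if "b \<in> B" for b
    using that assms by (auto simp: B_def hstrip_from_def hstrip_def)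
  have "Dop k (Hop k f) a
      = (\<Sum>b\<in>B. (\<Sum>c | vstrip_from k c a \<and> hstrip_from k b c. (- 1) ^ card (skew a c) * 1) * f b)"
    using sum_kernel_compose[of "\<lambda>c. vstrip_from k c a" B "\<lambda>c b. hstrip_from k b c"
        "\<lambda>c. (- 1) ^ card (skew a c)" "\<lambda>_ _. 1" f] B
    by (simp add: Dop_def Hop_def finite_vstrip B_def) blast
  also have "\<dots> = (\<Sum>b\<in>B. of_bool (b = a) * f b)"
    by (intro sum.cong arg_cong2[where f = times] refl)
      (simp add: vstrip_hstrip_inverse[OF assms sh])
  also have "\<dots> = (\<Sum>b\<in>B. if b = a then f b else 0)" by (intro sum.cong) auto
  also have "\<dots> = f a" using B by (simp add: B_def)
  finally show ?thesis .
qed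

lemma Dop_cong: "(\<And>c. c \<in> shapes \<Longrightarrow> f c = g c) \<Longrightarrow> Dop k f = Dop k g"
  unfolding Dop_def by (intro ext sum.cong) (auto simp: vstrip_from_def)

lemma foldr_Dop_cong:
  "(\<And>c. c \<in> shapes \<Longrightarrow> f c = g c) \<Longrightarrow> a \<in> shapes \<Longrightarrow> foldr Dop ks f a = foldr Dop ks g a"
  by (induction ks arbitrary: a) (auto intro: fun_cong[OF Dop_cong])

text \<open>\<open>foldr\<close> applies \<open>Dop K\<close> first while \<open>fold\<close>
  applies \<open>Hop K\<close> last, so inverse pairs meet and cancel from the inside outwards. The
  congruence rule is needed because \<open>Dop_Hop\<close> speaks only about values at
  shapes.\<close>

lemma foldr_Dop_Hop:
  "a \<in> shapes \<Longrightarrow> foldr Dop [1..<Suc K] (fold Hop [1..<Suc K] f) a = f a"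
proof (induction K arbitrary: a)
  case (Suc K)
  have "foldr Dop [1..<Suc (Suc K)] (fold Hop [1..<Suc (Suc K)] f) a
      = foldr Dop [1..<Suc K] (Dop (Suc K) (Hop (Suc K) (fold Hop [1..<Suc K] f))) a"
    by simp
  also have "\<dots> = foldr Dop [1..<Suc K] (fold Hop [1..<Suc K] f) a"
    by (rule foldr_Dop_cong) (use Dop_Hop Suc.prems in auto)
  finally show ?case using Suc by simp
qed simp

text \<open>Each \<open>Dop k\<close> finds the cap \<open>rect k\<close> left by its predecessor
  and lowers it to \<open>rect (k - 1)\<close>; the innermost one starts from
  \<open>rect K\<close>.\<close>

lemma foldr_Dop_Vop:
  "foldr Dop [1..<Suc K] (Vop (rect K) x f) = Vop (rect 0) x (foldr Dop [1..<Suc K] f)"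
proof (induction K arbitrary: f)
  case (Suc K)
  have "foldr Dop [1..<Suc (Suc K)] (Vop (rect (Suc K)) x f)
      = foldr Dop [1..<Suc K] (Dop (Suc K) (Vop (rect (Suc K)) x f))" by simp
  also have "\<dots> = Vop (rect 0) x (foldr Dop [1..<Suc (Suc K)] f)"
    using Dop_Vop[of "Suc K" x f] Suc[of "Dop (Suc K) f"] by simp
  finally show ?case .
qed simp

lemma foldr_Dop_foldr_Vop:
  "foldr Dop [1..<Suc K] (foldr (Vop (rect K)) xs f) = foldr (Vop (rect 0)) xs (foldr Dop [1..<Suc K] f)"
  by (induction xs) (simp_all only: foldr.simps o_def id_apply foldr_Dop_Vop)

section \<open>Iterated transfer operators and truncation\<close>

lemma foldr_Vop_Cons:
  "foldr (Vop cap) (x # xs) f a = (\<Sum>d | hstrip a d. vweight cap x a d * foldr (Vop cap) xs f d)"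
  by (simp only: foldr.simps o_apply Vop_def[of cap x "foldr (Vop cap) xs f"])

text \<open>Only endpoints with at most \<open>M + length xs\<close> rows are ever evaluated, so an
  identity known just for such shapes may be substituted under the operators.\<close>

lemma foldr_Vop_cong:
  "(\<And>c. c \<in> shapes_upto (M + length xs) \<Longrightarrow> f c = g c) \<Longrightarrow> a \<in> shapes_upto M \<Longrightarrow>
   foldr (Vop cap) xs f a = foldr (Vop cap) xs g a"
proof (induction xs arbitrary: a M)
  case (Cons x xs)
  have "foldr (Vop cap) xs f d = foldr (Vop cap) xs g d" if "hstrip a d" for d
    by (rule Cons.IH[of "Suc M"]) (use Cons.prems hstrip_upto[OF that] in auto)
  then show ?case by (auto simp: foldr_Vop_Cons simp del: foldr.simps intro!: sum.cong)
qed simp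

lemma foldr_Vop_zero:
  "(\<And>c. c \<in> shapes_upto (M + length xs) \<Longrightarrow> (\<forall>i. a i \<le> c i) \<Longrightarrow> f c = 0) \<Longrightarrow> a \<in> shapes_upto M \<Longrightarrow>
   foldr (Vop cap) xs f a = 0"
proof (induction xs arbitrary: a M)
  case (Cons x xs)
  have "foldr (Vop cap) xs f d = 0" if d: "hstrip a d" for d
  proof (rule Cons.IH[of "Suc M"])
    fix c assume "c \<in> shapes_upto (Suc M + length xs)" "\<forall>i. d i \<le> c i"
    moreover have "a i \<le> d i" for i using d by (simp add: hstrip_def)
    ultimately show "f c = 0" using Cons.prems(1)[of c] le_trans by fastforce
  qed (use Cons.prems hstrip_upto[OF d] in auto)
  then show ?case by (simp add: foldr_Vop_Cons del: foldr.simps)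
qed simp

lemma foldr_Vop_sum:
  assumes "finite I"
  shows "foldr (Vop cap) xs (\<lambda>c. \<Sum>i\<in>I. w i * g i c) a = (\<Sum>i\<in>I. w i * foldr (Vop cap) xs (g i) a)"
proof (induction xs arbitrary: a)
  case (Cons x xs)
  have "foldr (Vop cap) (x # xs) (\<lambda>c. \<Sum>i\<in>I. w i * g i c) a
      = (\<Sum>d | hstrip a d. \<Sum>i\<in>I. w i * (vweight cap x a d * foldr (Vop cap) xs (g i) d))"
    by (simp add: foldr_Vop_Cons Cons.IH sum_distrib_left mult.left_commute del: foldr.simps)
  also have "\<dots> = (\<Sum>i\<in>I. w i * foldr (Vop cap) (x # xs) (g i) a)"
    by (subst sum.swap) (simp add: foldr_Vop_Cons sum_distrib_left del: foldr.simps)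
  finally show ?case .
qed simp

text \<open>Truncating all shapes at \<open>\<kappa>\<close> turns the unrestricted operator into the one in which
  non-maximal labels only occur inside \<open>\<kappa>\<close>: the lengths \<open>\<ge> \<kappa> i\<close> of row \<open>i\<close> contribute a telescoping sum.\<close>

lemma telescope_power:
  fixes x :: "'r::comm_ring_1"
  assumes "m \<le> n" "e \<le> m"
  shows "(\<Sum>v\<in>{m..n}. x ^ (v - e) * (if v < n then 1 - x else 1)) = x ^ (m - e)"
  using assms(1)
proof (induction n rule: dec_induct)
  case (step n)
  have "(\<Sum>v\<in>{m..Suc n}. x ^ (v - e) * (if v < Suc n then 1 - x else 1))
      = (\<Sum>v\<in>{m..n}. x ^ (v - e) * (if v < n then 1 - x else 1)) - x ^ (n - e) + x ^ (n - e) * (1 - x)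
        + x ^ (Suc n - e)"
  proof -
    have "{m..Suc n} = insert (Suc n) (insert n {m..<n})" "{m..n} = insert n {m..<n}" using step by auto
    then show ?thesis by simp
  qed
  then show ?case using step assms(2) by (simp add: algebra_simps Suc_diff_le)
qed simp

lemma min_shapes: "a \<in> shapes \<Longrightarrow> \<kappa> \<in> shapes \<Longrightarrow> (\<lambda>i. min (a i) (\<kappa> i)) \<in> shapes"
  by (erule (1) shapes_obtain2)
    (rule shapes_upto_shapes, auto simp: shapes_upto_def antimono_def min_le_iff_disj)

lemma hstrip_min: "hstrip a d \<Longrightarrow> \<kappa> \<in> shapes \<Longrightarrow> hstrip (\<lambda>i. min (a i) (\<kappa> i)) (\<lambda>i. min (d i) (\<kappa> i))"
  using shapes_antimono[of \<kappa>] by (auto simp: hstrip_def min_shapes min_le_iff_disj)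

lemma Vop_truncate:
  fixes f :: "(nat \<Rightarrow> nat) \<Rightarrow> 'r::comm_ring_1"
  assumes "a \<in> shapes_upto M" "M < K" "\<kappa> \<in> shapes"
    and supp: "\<And>t. \<not> (\<forall>i. t i \<le> \<kappa> i) \<Longrightarrow> f t = 0"
  shows "Vop (rect K) x (\<lambda>d. f (\<lambda>i. min (d i) (\<kappa> i))) a = Vop \<kappa> x f (\<lambda>i. min (a i) (\<kappa> i))"
proof -
  let ?\<pi> = "\<lambda>d i. min (d i) (\<kappa> i)"
  have a: "a \<in> shapes" using assms shapes_upto_shapes by auto
  \<comment> \<open>The total weight of all \<open>d\<close> with the same truncation
    \<open>t\<close> is computed row by row; \<open>supp\<close> makes the shapes \<open>t\<close>
    inside \<open>\<kappa>\<close> the only relevant ones.\<close>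
  have ker: "(\<Sum>d\<in>{d. d \<in> {d. hstrip a d} \<and> ?\<pi> d = t}. vweight (rect K) x a d) = vweight \<kappa> x (?\<pi> a) t"
    if t: "hstrip (?\<pi> a) t" and tk: "\<forall>i. t i \<le> \<kappa> i" for t
  proof -
    define C where "C i = {v. (case i of 0 \<Rightarrow> v = width | Suc j \<Rightarrow> v \<le> a j) \<and> a i \<le> v \<and> min v (\<kappa> i) = t i}" for i
    have finC: "finite (C i)" for i
      by (rule finite_subset[OF _ finite_atMost[of width]])
        (use shapes_le_width[OF a, of "i - 1"] in \<open>cases i; force simp: C_def\<close>)
    have large: "a i = 0" if "i > M" for i using assms that by (auto simp: shapes_upto_def)
    have tt: "t 0 = width" "t (Suc i) \<le> min (a i) (\<kappa> i)" "min (a i) (\<kappa> i) \<le> t i" "t (Suc i) \<le> t i" for i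
      using t shapes_0 shapes_antimono[of t i "Suc i"] by (auto simp: hstrip_def)
    have tM: "t \<in> shapes_upto (Suc M)" "?\<pi> a \<in> shapes_upto M"
    proof -
      show "?\<pi> a \<in> shapes_upto M" using min_shapes[OF a assms(3)] le_upto[OF _ _ assms(1)] by auto
      then show "t \<in> shapes_upto (Suc M)" using hstrip_upto[OF t] by auto
    qed
    have Cset: "{d. d \<in> {d. hstrip a d} \<and> ?\<pi> d = t} = {c. (\<forall>i\<le>Suc M. c i \<in> C i) \<and> (\<forall>i>Suc M. c i = 0)}"
      (is "?A = ?B")
    proof
      show "?A \<subseteq> ?B"
      proof
        fix d assume d: "d \<in> ?A"
        then have "d \<in> shapes_upto (Suc M)" using hstrip_upto assms by auto
        then show "d \<in> ?B" using d by (auto simp: C_def hstrip_def shapes_upto_def split: nat.splits)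
      qed
      show "?B \<subseteq> ?A"
      proof
        fix d assume d: "d \<in> ?B"
        have dC: "d i \<in> C i" for i
        proof (cases "i \<le> Suc M")
          case False
          then have "t i = 0" using tM by (auto simp: shapes_upto_def)
          then show ?thesis using d large[of i] large[of "i - 1"] False
            by (auto simp: C_def split: nat.splits)
        qed (use d in auto)
        have DD: "a i \<le> d i \<and> d (Suc i) \<le> a i \<and> min (d i) (\<kappa> i) = t i" for i
          using dC[of i] dC[of "Suc i"] by (auto simp: C_def)
        have "d \<in> shapes"
          by (rule shapesI[of _ "Suc M"]) (use dC[of 0] DD d in \<open>auto simp: C_def intro: le_trans\<close>)
        then show "d \<in> ?A" using DD a by (auto simp: hstrip_def)
      qed
    qed
    have row: "(\<Sum>v\<in>C (Suc i). x ^ (v - a (Suc i)) * (if v < a i then 1 - x else 1))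
        = x ^ (t (Suc i) - min (a (Suc i)) (\<kappa> (Suc i))) *
          (if t (Suc i) < min (a i) (\<kappa> i) \<and> t (Suc i) < \<kappa> (Suc i) then 1 - x else 1)" for i
    proof (cases "t (Suc i) < \<kappa> (Suc i)")
      case True
      moreover have "\<kappa> (Suc i) \<le> \<kappa> i" using shapes_antimono[OF assms(3)] by simp
      moreover have "C (Suc i) = {t (Suc i)}" using True tt(2)[of i] tt(3)[of "Suc i"] by (auto simp: C_def)
      ultimately show ?thesis using tt(2)[of i] tt(3)[of "Suc i"] by auto
    next
      \<comment> \<open>Now row \<open>Suc i\<close> reaches \<open>\<kappa>\<close>, so its true
        length is free between \<open>max a \<kappa>\<close> and \<open>a i\<close>. The sum
        telescopes to the power at the lower end, and there max(a, \<kappa>) - a = \<kappa> - min(a,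
        \<kappa>).\<close>
      case False
      then have eq: "t (Suc i) = \<kappa> (Suc i)" using tk by (simp add: order_antisym)
      have "a (Suc i) \<le> a i" using shapes_antimono[OF a] by simp
      moreover have "C (Suc i) = {max (a (Suc i)) (\<kappa> (Suc i))..a i}" by (auto simp: C_def eq)
      ultimately show ?thesis
        using telescope_power[of "max (a (Suc i)) (\<kappa> (Suc i))" "a i" "a (Suc i)" x] tt(2)[of i] eq
        by (auto simp: max_def min_def split: if_splits)
    qed
    have "(\<Sum>d\<in>{d. d \<in> {d. hstrip a d} \<and> ?\<pi> d = t}. vweight (rect K) x a d)
      = (\<Sum>d\<in>{d. d \<in> {d. hstrip a d} \<and> ?\<pi> d = t}. \<Prod>i\<le>Suc M. case i of 0 \<Rightarrow> 1
          | Suc j \<Rightarrow> x ^ (d i - a i) * (if d i < a j then 1 - x else 1))"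
    proof (rule sum.cong[OF refl])
      fix d assume "d \<in> {d. d \<in> {d. hstrip a d} \<and> ?\<pi> d = t}"
      then have d: "d \<in> shapes_upto (Suc M)" "d 0 = width" "hstrip a d"
        using hstrip_upto assms shapes_0 by (auto simp: hstrip_def)
      \<comment> \<open>A corner in row \<open>Suc i\<close> requires \<open>0 < a i\<close>, hence
        \<open>i \<le> M < K\<close>: the cap \<open>rect K\<close> excludes nothing here.\<close>
      have lt: "d (Suc i) < a i \<and> d (Suc i) < rect K (Suc i) \<longleftrightarrow> d (Suc i) < a i" for i
        using assms(2) large[of i] shapes_le_width[OF a, of i] by (cases "i \<le> M") (auto simp: rect_def)
      have "a \<in> shapes_upto (Suc M)" using assms shapes_upto_mono[of M "Suc M"] by auto
      then have "vweight (rect K) x a d = (\<Prod>i\<le>Suc M. x ^ (d i - a i)) * (\<Prod>i\<le>Suc M. if d (Suc i) < a i then 1 - x else 1)"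
        using vweight_prod[OF _ d(1), of a "rect K" x] by (simp only: lt prod.distrib)
      also have "(\<Prod>i\<le>Suc M. if d (Suc i) < a i then 1 - x else 1) = (\<Prod>i\<le>M. if d (Suc i) < a i then 1 - x else 1)"
        using large by simp
      also have "(\<Prod>i\<le>Suc M. x ^ (d i - a i)) = (\<Prod>i\<le>M. x ^ (d (Suc i) - a (Suc i)))"
        using d shapes_0[OF a] by (simp add: prod.atMost_Suc_shift del: prod.atMost_Suc)
      finally show "vweight (rect K) x a d = (\<Prod>i\<le>Suc M. case i of 0 \<Rightarrow> 1
          | Suc j \<Rightarrow> x ^ (d i - a i) * (if d i < a j then 1 - x else 1))"
        by (simp add: prod.atMost_Suc_shift prod.distrib del: prod.atMost_Suc)
    qed
    also have "\<dots> = (\<Prod>i\<le>Suc M. \<Sum>v\<in>C i. case i of 0 \<Rightarrow> 1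
          | Suc j \<Rightarrow> x ^ (v - a i) * (if v < a j then 1 - x else 1))"
      unfolding Cset by (rule sum_prod_rows[OF finC])
    also have "\<dots> = (\<Prod>i\<le>M. x ^ (t (Suc i) - min (a (Suc i)) (\<kappa> (Suc i))) *
          (if t (Suc i) < min (a i) (\<kappa> i) \<and> t (Suc i) < \<kappa> (Suc i) then 1 - x else 1))"
    proof -
      have "C 0 = {width}" using shapes_0[OF a] shapes_0[OF assms(3)] tt(1) by (auto simp: C_def)
      then show ?thesis by (simp add: prod.atMost_Suc_shift row del: prod.atMost_Suc)
    qed
    also have "\<dots> = (\<Prod>i\<le>Suc M. x ^ (t i - ?\<pi> a i)) *
        (\<Prod>i\<le>Suc M. if t (Suc i) < ?\<pi> a i \<and> t (Suc i) < \<kappa> (Suc i) then 1 - x else 1)"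
    proof -
      have "(\<Prod>i\<le>Suc M. x ^ (t i - ?\<pi> a i)) = (\<Prod>i\<le>M. x ^ (t (Suc i) - ?\<pi> a (Suc i)))"
        using tt(1) shapes_0[OF a] shapes_0[OF assms(3)] by (simp add: prod.atMost_Suc_shift del: prod.atMost_Suc)
      moreover have "(\<Prod>i\<le>Suc M. if t (Suc i) < ?\<pi> a i \<and> t (Suc i) < \<kappa> (Suc i) then 1 - x else 1)
        = (\<Prod>i\<le>M. if t (Suc i) < ?\<pi> a i \<and> t (Suc i) < \<kappa> (Suc i) then 1 - x else 1)"
        using large by simp
      ultimately show ?thesis by (simp only: prod.distrib)
    qed
    also have "\<dots> = vweight \<kappa> x (?\<pi> a) t"
      using vweight_prod[OF subsetD[OF shapes_upto_mono[of M "Suc M"] tM(2)] tM(1), of \<kappa> x] by (simp add: prod.distrib)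
    finally show ?thesis .
  qed
  have "Vop (rect K) x (\<lambda>d. f (?\<pi> d)) a = (\<Sum>d | hstrip a d. vweight (rect K) x a d * f (?\<pi> d))"
    by (simp add: Vop_def)
  also have "\<dots> = (\<Sum>t | hstrip (?\<pi> a) t. \<Sum>d\<in>{d. d \<in> {d. hstrip a d} \<and> ?\<pi> d = t}. vweight (rect K) x a d * f (?\<pi> d))"
    by (rule sum.group[symmetric]) (use finite_hstrip hstrip_min[OF _ assms(3)] in auto)
  also have "\<dots> = (\<Sum>t | hstrip (?\<pi> a) t. (\<Sum>d\<in>{d. d \<in> {d. hstrip a d} \<and> ?\<pi> d = t}. vweight (rect K) x a d) * f t)"
    by (auto simp: sum_distrib_right intro!: sum.cong)
  also have "\<dots> = Vop \<kappa> x f (?\<pi> a)" unfolding Vop_def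
    by (rule sum.cong[OF refl]) (use ker supp in \<open>force\<close>)
  finally show ?thesis .
qed

text \<open>Every label may lengthen the shape by a row, and \<open>Vop_truncate\<close> needs
  \<open>rect K\<close> to see all corners at each step; hence the bound on
  \<open>M + length xs\<close>.\<close>

lemma foldr_Vop_truncate:
  assumes "\<kappa> \<in> shapes"
    and supp: "\<And>t. \<not> (\<forall>i. t i \<le> \<kappa> i) \<Longrightarrow> f t = 0"
  shows "a \<in> shapes_upto M \<Longrightarrow> M + length xs \<le> K \<Longrightarrow>
    foldr (Vop (rect K)) xs (\<lambda>d. f (\<lambda>i. min (d i) (\<kappa> i))) a = foldr (Vop \<kappa>) xs f (\<lambda>i. min (a i) (\<kappa> i))"
proof (induction xs arbitrary: a M)
  case (Cons x xs)
  have "foldr (Vop (rect K)) (x # xs) (\<lambda>d. f (\<lambda>i. min (d i) (\<kappa> i))) a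
      = Vop (rect K) x (\<lambda>d. foldr (Vop \<kappa>) xs f (\<lambda>i. min (d i) (\<kappa> i))) a"
    unfolding foldr.simps o_apply Vop_def[of "rect K" x]
  proof (rule sum.cong[OF refl])
    fix d assume "d \<in> {d. hstrip a d}"
    then have "d \<in> shapes_upto (Suc M)" using Cons.prems hstrip_upto by auto
    from Cons.IH[OF this] Cons.prems
    show "vweight (rect K) x a d * foldr (Vop (rect K)) xs (\<lambda>d. f (\<lambda>i. min (d i) (\<kappa> i))) d
      = vweight (rect K) x a d * foldr (Vop \<kappa>) xs f (\<lambda>i. min (d i) (\<kappa> i))"
      by simp
  qed
  also have "\<dots> = Vop \<kappa> x (foldr (Vop \<kappa>) xs f) (\<lambda>i. min (a i) (\<kappa> i))"
  proof (rule Vop_truncate[OF Cons.prems(1) _ assms(1)])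
    show "foldr (Vop \<kappa>) xs f t = 0" if "\<not> (\<forall>i. t i \<le> \<kappa> i)" for t
      using that
    proof (induction xs arbitrary: t)
      case (Cons y ys)
      have "foldr (Vop \<kappa>) ys f d = 0" if "hstrip t d" for d
        using Cons that by (meson hstrip_def le_trans)
      then show ?case by (simp add: foldr_Vop_Cons del: foldr.simps)
    qed (simp add: supp)
  qed (use Cons.prems in simp)
  finally show ?case by simp
qed simp

end

section \<open>Removing one label from a tableau\<close>

text \<open>Label bounds are put into the range \<open>M b\<close> rather than into
  \<open>Q\<close>, so splitting off a label just shrinks the ranges. The type \<open>'l\<close> is
  a number for ordinary fillings and a set of numbers for set-valued ones.\<close>

definition tabsum :: "(box set \<Rightarrow> (box \<Rightarrow> 'l) \<Rightarrow> bool) \<Rightarrow> box set \<Rightarrow> (box \<Rightarrow> 'l set) \<Rightarrow>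
    ('l \<Rightarrow> 'r::comm_ring_1) \<Rightarrow> 'r" where
  "tabsum Q S M w = (\<Sum>T | T \<in> PiE S M \<and> Q S T. \<Prod>b\<in>S. w (T b))"

text \<open>A filling amounts to the set \<open>Y\<close> of boxes holding their distinguished value
  \<open>e b\<close> and a filling of the rest that avoids it; \<open>g\<close> parametrizes the
  admissible \<open>Y\<close> by shapes. The value depends on the box for the sake of the splitting
  by row index, and \<open>Q'\<close> differs from \<open>Q\<close> because a set-valued remainder
  can still contain the label inside larger sets.\<close>

lemma tabsum_split_gen:
  fixes w :: "'l \<Rightarrow> 'r::comm_ring_1"
  assumes fin: "finite S" "\<And>b. b \<in> S \<Longrightarrow> finite (M b)"
    and bij: "bij_betw g C {Y. Y \<subseteq> S \<and> (\<forall>b\<in>Y. e b \<in> M b) \<and> good Y}"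
    and Q: "\<And>Y T. Y \<subseteq> S \<Longrightarrow> \<forall>b\<in>Y. e b \<in> M b \<Longrightarrow> T \<in> PiE (S - Y) (\<lambda>b. M b - {e b}) \<Longrightarrow>
        Q S (\<lambda>b. if b \<in> Y then e b else T b) \<longleftrightarrow> good Y \<and> Q' Y T"
  shows "tabsum Q S M w = (\<Sum>c\<in>C. (\<Prod>b\<in>g c. w (e b)) * tabsum (\<lambda>_. Q' (g c)) (S - g c) (\<lambda>b. M b - {e b}) w)"
proof -
  define \<Y> where "\<Y> = {Y. Y \<subseteq> S \<and> (\<forall>b\<in>Y. e b \<in> M b) \<and> good Y}"
  define F where "F Y = {T. T \<in> PiE (S - Y) (\<lambda>b. M b - {e b}) \<and> Q' Y T}" for Y
  have "finite \<Y>" unfolding \<Y>_def using fin(1) by simp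
  moreover have finF: "finite (F Y)" for Y
    by (rule finite_subset[of _ "PiE (S - Y) (\<lambda>b. M b - {e b})"]) (auto simp: F_def fin intro!: finite_PiE)
  moreover have "tabsum Q S M w
      = (\<Sum>(Y, T)\<in>Sigma \<Y> F. (\<Prod>b\<in>Y. w (e b)) * (\<Prod>b\<in>S - Y. w (T b)))"
    unfolding tabsum_def
  proof (rule sum.reindex_bij_witness[where
        j = "\<lambda>T. ({b \<in> S. T b = e b}, restrict T (S - {b \<in> S. T b = e b}))" and
        i = "\<lambda>(Y, T) b. if b \<in> Y then e b else T b"])
    fix T assume T: "T \<in> {T. T \<in> PiE S M \<and> Q S T}"
    let ?Y = "{b \<in> S. T b = e b}" and ?T = "restrict T (S - {b \<in> S. T b = e b})"
    show eq: "(case (?Y, ?T) of (Y, T) \<Rightarrow> \<lambda>b. if b \<in> Y then e b else T b) = T"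
      using T by (auto simp: fun_eq_iff PiE_def extensional_def)
    have Y: "?Y \<subseteq> S" "\<forall>b\<in>?Y. e b \<in> M b" using T by (auto simp: PiE_iff)
    have T2: "?T \<in> PiE (S - ?Y) (\<lambda>b. M b - {e b})" using T by (auto simp: PiE_iff)
    have "(\<lambda>b. if b \<in> ?Y then e b else ?T b) = T" using eq by simp
    then have "good ?Y \<and> Q' ?Y ?T" using Q[OF Y T2] T by (simp only: mem_Collect_eq simp_thms)
    then show "(?Y, ?T) \<in> Sigma \<Y> F" using Y T2 unfolding \<Y>_def F_def by blast
    have "(\<Prod>b\<in>S. w (T b)) = (\<Prod>b\<in>?Y. w (T b)) * (\<Prod>b\<in>S - ?Y. w (T b))"
      using prod.subset_diff[OF Y(1) fin(1), of "\<lambda>b. w (T b)"] by (simp add: mult.commute)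
    then show "(case (?Y, ?T) of (Y, T) \<Rightarrow> (\<Prod>b\<in>Y. w (e b)) * (\<Prod>b\<in>S - Y. w (T b))) = (\<Prod>b\<in>S. w (T b))"
      by simp
  next
    fix YT assume "YT \<in> Sigma \<Y> F"
    then obtain Y T where YT: "YT = (Y, T)" "Y \<in> \<Y>" "T \<in> F Y" by auto
    then have Y: "Y \<subseteq> S" "\<forall>b\<in>Y. e b \<in> M b" "good Y" and T: "T \<in> PiE (S - Y) (\<lambda>b. M b - {e b})" "Q' Y T"
      by (auto simp: \<Y>_def F_def)
    let ?T = "\<lambda>b. if b \<in> Y then e b else T b"
    have [simp]: "{b \<in> S. ?T b = e b} = Y" using Y T by (auto simp: PiE_iff)
    show "({b \<in> S. (case YT of (Y, T) \<Rightarrow> \<lambda>b. if b \<in> Y then e b else T b) b = e b},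
        restrict (case YT of (Y, T) \<Rightarrow> \<lambda>b. if b \<in> Y then e b else T b)
          (S - {b \<in> S. (case YT of (Y, T) \<Rightarrow> \<lambda>b. if b \<in> Y then e b else T b) b = e b})) = YT"
      using T by (auto simp: YT fun_eq_iff PiE_iff extensional_def)
    show "(case YT of (Y, T) \<Rightarrow> \<lambda>b. if b \<in> Y then e b else T b) \<in> {T. T \<in> PiE S M \<and> Q S T}"
      using Q[OF Y(1,2) T(1)] Y T by (auto simp: YT PiE_iff extensional_def)
  qed
  ultimately have "tabsum Q S M w = (\<Sum>Y\<in>\<Y>. (\<Prod>b\<in>Y. w (e b)) * tabsum (\<lambda>_. Q' Y) (S - Y) (\<lambda>b. M b - {e b}) w)"
    by (simp add: sum.Sigma[symmetric] tabsum_def F_def sum_distrib_left)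
  also have "\<dots> = (\<Sum>c\<in>C. (\<Prod>b\<in>g c. w (e b)) * tabsum (\<lambda>_. Q' (g c)) (S - g c) (\<lambda>b. M b - {e b}) w)"
    by (rule sum.reindex_bij_betw[symmetric]) (use bij in \<open>simp add: \<Y>_def\<close>)
  finally show ?thesis .
qed

lemma tabsum_split:
  fixes w :: "'l \<Rightarrow> 'r::comm_ring_1"
  assumes "finite S" "\<And>b. b \<in> S \<Longrightarrow> finite (M b)"
    and "bij_betw g C {Y. Y \<subseteq> S \<and> (\<forall>b\<in>Y. e b \<in> M b) \<and> good Y}"
    and "\<And>Y T. Y \<subseteq> S \<Longrightarrow> \<forall>b\<in>Y. e b \<in> M b \<Longrightarrow> T \<in> PiE (S - Y) (\<lambda>b. M b - {e b}) \<Longrightarrow>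
        Q S (\<lambda>b. if b \<in> Y then e b else T b) \<longleftrightarrow> good Y \<and> Q (S - Y) T"
  shows "tabsum Q S M w = (\<Sum>c\<in>C. (\<Prod>b\<in>g c. w (e b)) * tabsum Q (S - g c) (\<lambda>b. M b - {e b}) w)"
  using tabsum_split_gen[where Q' = "\<lambda>Y. Q (S - Y)" and Q = Q and S = S and M = M and g = g
      and C = C and e = e and good = good and w = w] assms unfolding tabsum_def by blast

lemma tabsum_cong:
  "(\<And>b. b \<in> S \<Longrightarrow> M b = M' b) \<Longrightarrow> tabsum Q S M w = tabsum Q S M' w"
  unfolding tabsum_def using PiE_cong[of S M M'] by simp

lemma tabsum_empty_range: "b \<in> S \<Longrightarrow> M b = {} \<Longrightarrow> tabsum Q S M w = 0"
  by (auto simp: tabsum_def PiE_iff)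

lemma tabsum_empty_shape: "(\<And>T. Q {} T) \<Longrightarrow> tabsum Q {} M w = 1"
  by (simp add: tabsum_def)

lemma initial_segment:
  fixes A :: "nat set"
  assumes "A \<subseteq> {m<..n}" "\<And>j j'. j \<in> A \<Longrightarrow> m < j' \<Longrightarrow> j' < j \<Longrightarrow> j' \<in> A"
  shows "A = {m<..m + card A}"
proof (cases "A = {}")
  case False
  have f: "finite A" using assms(1) finite_subset by blast
  have "m < Max A" using Max_in[OF f False] assms(1) by auto
  have A: "A = {m<..Max A}"
  proof
    show "A \<subseteq> {m<..Max A}" using assms(1) Max_ge[OF f] by auto
    show "{m<..Max A} \<subseteq> A"
    proof
      fix j assume "j \<in> {m<..Max A}"
      then show "j \<in> A" using assms(2)[OF Max_in[OF f False], of j] Max_in[OF f False]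
        by (cases "j = Max A") auto
    qed
  qed
  have "card A = Max A - m" using arg_cong[OF A, of card] by (simp only: card_greaterThanAtMost)
  then have "m + card A = Max A" using \<open>m < Max A\<close> by simp
  then show ?thesis using A by simp
qed simp

lemma final_segment:
  fixes A :: "nat set"
  assumes "A \<subseteq> {m<..n}" "\<And>j j'. j \<in> A \<Longrightarrow> j' \<le> n \<Longrightarrow> j < j' \<Longrightarrow> j' \<in> A"
  shows "A = {n - card A<..n}"
proof (cases "A = {}")
  case False
  have f: "finite A" using assms(1) finite_subset by blast
  have *: "0 < Min A" "Min A \<le> n" using Min_in[OF f False] assms(1) by auto
  have A: "A = {Min A - 1<..n}"
  proof
    show "A \<subseteq> {Min A - 1<..n}" using assms(1) * by (force dest: Min_le[OF f])
    show "{Min A - 1<..n} \<subseteq> A"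
    proof
      fix j assume "j \<in> {Min A - 1<..n}"
      then show "j \<in> A" using assms(2)[OF Min_in[OF f False], of j] Min_in[OF f False]
        by (cases "j = Min A") auto
    qed
  qed
  have "card A = n - (Min A - 1)" using arg_cong[OF A, of card] by (simp only: card_greaterThanAtMost)
  then have "n - card A = Min A - 1" using * by simp
  then show ?thesis using A by simp
qed simp

section \<open>Positions of a single label as strips between row-length functions\<close>

context columns begin

lemma skew_row_card: "card {j. (i, j) \<in> skew d a} = d i - a i"
proof -
  have "{j. (i, j) \<in> skew d a} = {off + a i<..off + d i}" by (auto simp: skew_def)
  then show ?thesis by simp
qed

lemma skew_inj_left:
  assumes "skew c a = skew c' a" "\<And>i. a i \<le> c i" "\<And>i. a i \<le> c' i"
  shows "c = c'"
proof
  fix i show "c i = c' i"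
    using skew_row_card[of i c a] skew_row_card[of i c' a] assms(2)[of i] assms(3)[of i]
    by (simp add: assms(1))
qed

lemma skew_inj_right:
  assumes "skew a c = skew a c'" "\<And>i. c i \<le> a i" "\<And>i. c' i \<le> a i"
  shows "c = c'"
proof
  fix i show "c i = c' i"
    using skew_row_card[of i a c] skew_row_card[of i a c'] assms(2)[of i] assms(3)[of i]
    by (simp add: assms(1))
qed

lemma skew_diff_inner: "(\<And>i. a i \<le> c i) \<Longrightarrow> skew d a - skew c a = skew d c"
  by (auto simp: skew_def not_le) (meson add_le_cancel_left le_less_trans)

lemma skew_diff_outer: "(\<And>i. c i \<le> d i) \<Longrightarrow> skew d a - skew d c = skew c a"
  by (auto simp: skew_def not_less) (meson add_le_cancel_left le_trans)

lemma skew_self: "skew a a = {}"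
  by (auto simp: skew_def)

lemma skew_empty_iff: "(\<And>i. a i \<le> d i) \<Longrightarrow> skew d a = {} \<longleftrightarrow> d = a"
  using skew_inj_left[of d a a] by (auto simp: skew_self)

lemma rows_initial:
  assumes "Y \<subseteq> skew d a" "\<And>i. a i \<le> d i"
    "\<And>i j j'. (i, j) \<in> Y \<Longrightarrow> (i, j') \<in> skew d a \<Longrightarrow> j' < j \<Longrightarrow> (i, j') \<in> Y"
  obtains c where "Y = skew c a" "\<And>i. a i \<le> c i" "\<And>i. c i \<le> d i"
proof -
  define c where "c i = a i + card {j. (i, j) \<in> Y}" for i
  have row: "{j. (i, j) \<in> Y} = {off + a i<..off + a i + card {j. (i, j) \<in> Y}}" for i
    by (rule initial_segment[of _ _ "off + d i"]) (use assms in \<open>fastforce simp: skew_def\<close>)+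
  have "Y = skew c a"
  proof (rule set_eqI)
    fix b :: box
    obtain i j where "b = (i, j)" by fastforce
    then show "b \<in> Y \<longleftrightarrow> b \<in> skew c a" using eqset_imp_iff[OF row[of i], of j]
      by (simp add: skew_def c_def add.assoc)
  qed
  moreover have "c i \<le> d i" for i
  proof -
    have "card {j. (i, j) \<in> Y} \<le> card {off + a i<..off + d i}"
      by (rule card_mono) (use assms in \<open>auto simp: skew_def\<close>)
    then show ?thesis using assms(2)[of i] by (simp add: c_def)
  qed
  ultimately show thesis by (intro that) (auto simp: c_def)
qed

lemma rows_final:
  assumes "Y \<subseteq> skew d a" "\<And>i. a i \<le> d i"
    "\<And>i j j'. (i, j) \<in> Y \<Longrightarrow> (i, j') \<in> skew d a \<Longrightarrow> j < j' \<Longrightarrow> (i, j') \<in> Y"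
  obtains c where "Y = skew d c" "\<And>i. a i \<le> c i" "\<And>i. c i \<le> d i"
proof -
  define c where "c i = d i - card {j. (i, j) \<in> Y}" for i
  have le: "card {j. (i, j) \<in> Y} \<le> d i - a i" for i
  proof -
    have "card {j. (i, j) \<in> Y} \<le> card {off + a i<..off + d i}"
      by (rule card_mono) (use assms in \<open>auto simp: skew_def\<close>)
    then show ?thesis by simp
  qed
  have row: "{j. (i, j) \<in> Y} = {off + d i - card {j. (i, j) \<in> Y}<..off + d i}" for i
    by (rule final_segment[of _ "off + a i"]) (use assms in \<open>fastforce simp: skew_def\<close>)+
  have "Y = skew d c"
  proof (rule set_eqI)
    fix b :: box
    obtain i j where "b = (i, j)" by fastforce
    then show "b \<in> Y \<longleftrightarrow> b \<in> skew d c" using eqset_imp_iff[OF row[of i], of j] le[of i]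
      by (auto simp: skew_def c_def)
  qed
  moreover have "a i \<le> c i" for i using le[of i] assms(2)[of i] by (simp add: c_def)
  ultimately show thesis by (intro that) (auto simp: c_def)
qed

lemma shapes_between:
  assumes "a \<in> shapes" "d \<in> shapes" "\<And>i. a i \<le> c i" "\<And>i. c i \<le> d i" "\<And>i. c (Suc i) \<le> c i"
  shows "c \<in> shapes"
proof -
  obtain N where N: "d \<in> shapes_upto N" using assms(2) by (auto simp: shapes_def)
  show ?thesis
  proof (rule shapesI(2)[of c N])
    show "c 0 = width"
      using assms(3)[of 0] assms(4)[of 0] shapes_0[OF assms(1)] shapes_0[OF assms(2)] by simp
    show "c i = 0" if "N < i" for i
      using N that assms(4)[of i] by (simp add: shapes_upto_def)
  qed (rule assms(5))
qed

text \<open>These are the possible positions of the least label in a semistandard filling. Being on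
  top of each column amounts to interlacing: if \<open>c (Suc i)\<close> exceeded
  \<open>p i\<close>, the last box of \<open>Y\<close> in row \<open>Suc i\<close> would have a box
  of the diagram above it.\<close>

lemma bij_first_label:
  assumes p: "p \<in> shapes" and q: "q \<in> shapes" and le: "\<And>i. p i \<le> q i"
  shows "bij_betw (\<lambda>c. skew c p) {c. hstrip p c \<and> (\<forall>i. c i \<le> q i)}
    {Y. Y \<subseteq> skew q p \<and>
      (\<forall>i j j'. (i, j) \<in> Y \<and> (i, j') \<in> skew q p \<and> j' < j \<longrightarrow> (i, j') \<in> Y) \<and>
      (\<forall>i i' j. (i, j) \<in> Y \<and> (i', j) \<in> skew q p \<longrightarrow> i \<le> i')}"
    (is "bij_betw ?g ?C ?Y")
proof (rule bij_betw_imageI)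
  show "inj_on ?g ?C" by (rule inj_onI, rule skew_inj_left) (auto simp: hstrip_def)
  show "?g ` ?C = ?Y"
  proof
    show "?g ` ?C \<subseteq> ?Y"
    proof clarify
      fix c assume c: "hstrip p c" "\<forall>i. c i \<le> q i"
      have "i \<le> i'" if "(i, j) \<in> skew c p" "(i', j) \<in> skew q p" for i i' j
      proof (rule ccontr)
        assume "\<not> i \<le> i'"
        then have "c i \<le> c (Suc i')" using c shapes_antimono[of c "Suc i'" i] by (auto simp: hstrip_def)
        also have "\<dots> \<le> p i'" using c by (simp add: hstrip_def)
        finally show False using that by (auto simp: skew_def)
      qed
      moreover have "skew c p \<subseteq> skew q p" using c by (auto simp: skew_def intro: le_trans)
      moreover have "(i, j') \<in> skew c p" if "(i, j) \<in> skew c p" "(i, j') \<in> skew q p" "j' < j" for i j j'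
        using that by (auto simp: skew_def)
      ultimately show "skew c p \<subseteq> skew q p \<and>
          (\<forall>i j j'. (i, j) \<in> skew c p \<and> (i, j') \<in> skew q p \<and> j' < j \<longrightarrow> (i, j') \<in> skew c p) \<and>
          (\<forall>i i' j. (i, j) \<in> skew c p \<and> (i', j) \<in> skew q p \<longrightarrow> i \<le> i')" by blast
    qed
    show "?Y \<subseteq> ?g ` ?C"
    proof
      fix Y assume Y: "Y \<in> ?Y"
      then have Y1: "Y \<subseteq> skew q p" and Y2: "\<And>i j j'. (i, j) \<in> Y \<Longrightarrow> (i, j') \<in> skew q p \<Longrightarrow> j' < j \<Longrightarrow> (i, j') \<in> Y"
        by (blast)+
      obtain c where c: "Y = skew c p" "\<And>i. p i \<le> c i" "\<And>i. c i \<le> q i"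
        by (rule rows_initial[OF Y1 le], erule (2) Y2, rule that)
      have hs: "c (Suc i) \<le> p i" for i
      proof (rule ccontr)
        assume "\<not> c (Suc i) \<le> p i"
        then have "(Suc i, off + c (Suc i)) \<in> Y" "(i, off + c (Suc i)) \<in> skew q p"
          using shapes_antimono[OF p, of i "Suc i"] shapes_antimono[OF q, of i "Suc i"] c(3)[of "Suc i"]
          by (auto simp: skew_def c(1))
        then show False using Y by fastforce
      qed
      have "c \<in> shapes" by (rule shapes_between[OF p q c(2,3)]) (use hs c(2) le_trans in blast)
      then have "hstrip p c" using p hs c by (auto simp: hstrip_def)
      then show "Y \<in> ?g ` ?C" using c by auto
    qed
  qed
qed

text \<open>The mirror image for the greatest label. When labels are bounded by their row, label
  \<open>k\<close> lives in rows \<ge> \<open>k\<close>, which is the restriction built into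
  \<open>hstrip_from k\<close>.\<close>

lemma bij_last_label:
  assumes q: "q \<in> shapes" and d: "d \<in> shapes" and le: "\<And>i. q i \<le> d i"
  shows "bij_betw (\<lambda>c. skew d c) {c. hstrip_from k c d \<and> (\<forall>i. q i \<le> c i)}
    {Y. Y \<subseteq> skew d q \<and> (\<forall>b\<in>Y. k \<le> fst b) \<and>
      (\<forall>i j j'. (i, j) \<in> Y \<and> (i, j') \<in> skew d q \<and> j < j' \<longrightarrow> (i, j') \<in> Y) \<and>
      (\<forall>i i' j. (i, j) \<in> Y \<and> (i', j) \<in> skew d q \<longrightarrow> i' \<le> i)}"
    (is "bij_betw ?g ?C ?Y")
proof (rule bij_betw_imageI)
  show "inj_on ?g ?C" by (rule inj_onI, rule skew_inj_right) (auto simp: hstrip_def hstrip_from_def)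
  show "?g ` ?C = ?Y"
  proof
    show "?g ` ?C \<subseteq> ?Y"
    proof clarify
      fix c assume c: "hstrip_from k c d" "\<forall>i. q i \<le> c i"
      have "i' \<le> i" if "(i, j) \<in> skew d c" "(i', j) \<in> skew d q" for i i' j
      proof (rule ccontr)
        assume "\<not> i' \<le> i"
        then have "d i' \<le> d (Suc i)" using shapes_antimono[OF d, of "Suc i" i'] by auto
        also have "\<dots> \<le> c i" using c by (simp add: hstrip_from_def hstrip_def)
        finally show False using that by (auto simp: skew_def)
      qed
      moreover have "skew d c \<subseteq> skew d q" using c by (auto simp: skew_def) (meson add_le_cancel_left le_less_trans)
      moreover have "\<forall>b\<in>skew d c. k \<le> fst b" using c by (auto simp: skew_def hstrip_from_def not_less[symmetric])
      moreover have "(i, j') \<in> skew d c" if "(i, j) \<in> skew d c" "(i, j') \<in> skew d q" "j < j'" for i j j'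
        using that by (auto simp: skew_def)
      ultimately show "skew d c \<subseteq> skew d q \<and> (\<forall>b\<in>skew d c. k \<le> fst b) \<and>
          (\<forall>i j j'. (i, j) \<in> skew d c \<and> (i, j') \<in> skew d q \<and> j < j' \<longrightarrow> (i, j') \<in> skew d c) \<and>
          (\<forall>i i' j. (i, j) \<in> skew d c \<and> (i', j) \<in> skew d q \<longrightarrow> i' \<le> i)" by blast
    qed
    show "?Y \<subseteq> ?g ` ?C"
    proof
      fix Y assume Y: "Y \<in> ?Y"
      then have Y1: "Y \<subseteq> skew d q" and Y2: "\<And>i j j'. (i, j) \<in> Y \<Longrightarrow> (i, j') \<in> skew d q \<Longrightarrow> j < j' \<Longrightarrow> (i, j') \<in> Y"
        by (blast)+
      obtain c where c: "Y = skew d c" "\<And>i. q i \<le> c i" "\<And>i. c i \<le> d i"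
        by (rule rows_final[OF Y1 le], erule (2) Y2, rule that)
      have hs: "d (Suc i) \<le> c i" for i
      proof (rule ccontr)
        assume "\<not> d (Suc i) \<le> c i"
        then have "(i, off + d (Suc i)) \<in> Y" "(Suc i, off + d (Suc i)) \<in> skew d q"
          using shapes_antimono[OF q, of i "Suc i"] shapes_antimono[OF d, of i "Suc i"] c(2)[of i]
          by (auto simp: skew_def c(1))
        then show False using Y by fastforce
      qed
      have eq: "c i = d i" if "i < k" for i
      proof (rule ccontr)
        assume "c i \<noteq> d i"
        then have "(i, off + d i) \<in> Y" using c(3)[of i] by (auto simp: c(1) skew_def)
        then show False using Y that by fastforce
      qed
      have "c \<in> shapes" by (rule shapes_between[OF q d c(2,3)]) (use hs c(3) le_trans in blast)
      then have "hstrip_from k c d" using d hs c eq by (auto simp: hstrip_def hstrip_from_def)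
      then show "Y \<in> ?g ` ?C" using c by auto
    qed
  qed
qed

text \<open>In a reverse row-strict filling the least label can only end a row, and it propagates
  downwards in its column; such positions form a vertical strip.\<close>

lemma bij_reverse_label:
  assumes p': "p' \<in> shapes" and p: "p \<in> shapes" and le: "\<And>i. p' i \<le> p i"
  shows "bij_betw (\<lambda>c. skew p c) {c. vstrip_from k c p \<and> (\<forall>i. p' i \<le> c i)}
    {Y. Y \<subseteq> skew p p' \<and> (\<forall>b\<in>Y. k \<le> fst b) \<and>
      (\<forall>i j j'. (i, j) \<in> Y \<and> (i, j') \<in> skew p p' \<longrightarrow> j' \<le> j) \<and>
      (\<forall>i i' j. (i, j) \<in> Y \<and> (i', j) \<in> skew p p' \<and> i < i' \<longrightarrow> (i', j) \<in> Y)}"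
    (is "bij_betw ?g ?C ?Y")
proof (rule bij_betw_imageI)
  show "inj_on ?g ?C" by (rule inj_onI, rule skew_inj_right) (auto simp: vstrip_from_def)
  show "?g ` ?C = ?Y"
  proof
    show "?g ` ?C \<subseteq> ?Y"
    proof clarify
      fix c assume c: "vstrip_from k c p" "\<forall>i. p' i \<le> c i"
      have st: "j = off + p i \<and> k \<le> i \<and> c i < p i" if "(i, j) \<in> skew p c" for i j
      proof -
        have "p i \<le> c i + (if i < k then 0 else 1)" using c by (auto simp: vstrip_from_def)
        then show ?thesis using that by (auto simp: skew_def split: if_splits)
      qed
      have "(i', j) \<in> skew p c" if "(i, j) \<in> skew p c" "(i', j) \<in> skew p p'" "i < i'" for i i' j
      proof -
        have "c i' \<le> c i" using c that shapes_antimono[of c i i'] by (auto simp: vstrip_from_def)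
        then show ?thesis using st[OF that(1)] that by (auto simp: skew_def)
      qed
      moreover have "j' \<le> j" if "(i, j) \<in> skew p c" "(i, j') \<in> skew p p'" for i j j'
        using st[OF that(1)] that by (auto simp: skew_def)
      moreover have "skew p c \<subseteq> skew p p'" using c by (auto simp: skew_def) (meson add_le_cancel_left le_less_trans)
      ultimately show "skew p c \<subseteq> skew p p' \<and> (\<forall>b\<in>skew p c. k \<le> fst b) \<and>
          (\<forall>i j j'. (i, j) \<in> skew p c \<and> (i, j') \<in> skew p p' \<longrightarrow> j' \<le> j) \<and>
          (\<forall>i i' j. (i, j) \<in> skew p c \<and> (i', j) \<in> skew p p' \<and> i < i' \<longrightarrow> (i', j) \<in> skew p c)"
        using st by fastforce
    qed
    show "?Y \<subseteq> ?g ` ?C"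
    proof
      fix Y assume Y: "Y \<in> ?Y"
      then have Y1: "Y \<subseteq> skew p p'" and Y2': "\<And>i j j'. (i, j) \<in> Y \<Longrightarrow> (i, j') \<in> skew p p' \<Longrightarrow> j' \<le> j"
        by blast+
      have Y2: "\<And>i j j'. (i, j) \<in> Y \<Longrightarrow> (i, j') \<in> skew p p' \<Longrightarrow> j < j' \<Longrightarrow> (i, j') \<in> Y"
        using Y2' by (simp add: leD)
      obtain c where c: "Y = skew p c" "\<And>i. p' i \<le> c i" "\<And>i. c i \<le> p i"
        by (rule rows_final[OF Y1 le], erule (2) Y2, rule that)
      have eq: "c i = p i" if "i < k" for i
      proof (rule ccontr)
        assume "c i \<noteq> p i"
        then have "(i, off + p i) \<in> Y" using c(3)[of i] by (auto simp: c(1) skew_def)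
        then show False using Y that by fastforce
      qed
      have vs: "p i \<le> c i + 1" for i
      proof (rule ccontr)
        assume "\<not> p i \<le> c i + 1"
        then have "(i, off + c i + 1) \<in> Y" "(i, off + c i + 2) \<in> skew p p'"
          using c(2)[of i] by (auto simp: skew_def c(1))
        then show False using Y by fastforce
      qed
      \<comment> \<open>A failure needs two rows of \<open>p\<close> of equal length with the last
        box taken only from the upper one, contrary to closure downwards.\<close>
      have "c (Suc i) \<le> c i" for i
      proof (rule ccontr)
        assume a: "\<not> c (Suc i) \<le> c i"
        have "p (Suc i) \<le> p i" using shapes_antimono[OF p] by simp
        then have eq: "c (Suc i) = p i" "p (Suc i) = p i" "p i = c i + 1" using a vs[of i] c(3)[of "Suc i"] by auto
        have "p' (Suc i) \<le> c i" using shapes_antimono[OF p', of i "Suc i"] c(2)[of i] by simp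
        then have "(i, off + p i) \<in> Y" "(Suc i, off + p i) \<in> skew p p'" "(Suc i, off + p i) \<notin> Y"
          using eq by (auto simp: skew_def c(1))
        then show False using Y by fastforce
      qed
      then have "c \<in> shapes" by (rule shapes_between[OF p' p c(2,3)])
      then have "vstrip_from k c p" using p vs c eq by (auto simp: vstrip_from_def)
      then show "Y \<in> ?g ` ?C" using c by auto
    qed
  qed
qed

text \<open>Sets closed under moving right and down are what remains of the diagram outside an
  intermediate shape. The boxes that hold their own row index form such a set.\<close>

lemma bij_between:
  assumes q: "q \<in> shapes" and d: "d \<in> shapes" and le: "\<And>i. q i \<le> d i"
  shows "bij_betw (\<lambda>c. skew d c) {c \<in> shapes. (\<forall>i. q i \<le> c i) \<and> (\<forall>i. c i \<le> d i)}
    {Y. Y \<subseteq> skew d q \<and>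
      (\<forall>i j j'. (i, j) \<in> Y \<and> (i, j') \<in> skew d q \<and> j < j' \<longrightarrow> (i, j') \<in> Y) \<and>
      (\<forall>i i' j. (i, j) \<in> Y \<and> (i', j) \<in> skew d q \<and> i < i' \<longrightarrow> (i', j) \<in> Y)}"
    (is "bij_betw ?g ?C ?Y")
proof (rule bij_betw_imageI)
  show "inj_on ?g ?C" by (rule inj_onI, rule skew_inj_right) auto
  show "?g ` ?C = ?Y"
  proof
    show "?g ` ?C \<subseteq> ?Y"
    proof clarify
      fix c assume c: "c \<in> shapes" "\<forall>i. q i \<le> c i" "\<forall>i. c i \<le> d i"
      have "(i', j) \<in> skew d c" if "(i, j) \<in> skew d c" "(i', j) \<in> skew d q" "i < i'" for i i' j
        using shapes_antimono[OF c(1), of i i'] that by (auto simp: skew_def)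
      moreover have "skew d c \<subseteq> skew d q" using c by (auto simp: skew_def) (meson add_le_cancel_left le_less_trans)
      moreover have "(i, j') \<in> skew d c" if "(i, j) \<in> skew d c" "(i, j') \<in> skew d q" "j < j'" for i j j'
        using that by (auto simp: skew_def)
      ultimately show "skew d c \<subseteq> skew d q \<and>
          (\<forall>i j j'. (i, j) \<in> skew d c \<and> (i, j') \<in> skew d q \<and> j < j' \<longrightarrow> (i, j') \<in> skew d c) \<and>
          (\<forall>i i' j. (i, j) \<in> skew d c \<and> (i', j) \<in> skew d q \<and> i < i' \<longrightarrow> (i', j) \<in> skew d c)" by blast
    qed
    show "?Y \<subseteq> ?g ` ?C"
    proof
      fix Y assume Y: "Y \<in> ?Y"
      then have Y1: "Y \<subseteq> skew d q" and Y2: "\<And>i j j'. (i, j) \<in> Y \<Longrightarrow> (i, j') \<in> skew d q \<Longrightarrow> j < j' \<Longrightarrow> (i, j') \<in> Y"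
        by (blast)+
      obtain c where c: "Y = skew d c" "\<And>i. q i \<le> c i" "\<And>i. c i \<le> d i"
        by (rule rows_final[OF Y1 le], erule (2) Y2, rule that)
      have "c (Suc i) \<le> c i" for i
      proof (rule ccontr)
        assume a: "\<not> c (Suc i) \<le> c i"
        have "c i < c (Suc i)" "c (Suc i) \<le> d (Suc i)" "c (Suc i) \<le> d i" "q (Suc i) < c (Suc i)"
          using a shapes_antimono[OF q, of i "Suc i"] shapes_antimono[OF d, of i "Suc i"] c(2)[of i]
            c(3)[of "Suc i"] by linarith+
        then have "(i, off + c (Suc i)) \<in> Y" "(Suc i, off + c (Suc i)) \<in> skew d q" "(Suc i, off + c (Suc i)) \<notin> Y"
          by (simp_all add: skew_def c(1))
        then show False using Y lessI[of i] by blast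
      qed
      then have "c \<in> shapes" by (rule shapes_between[OF q d c(2,3)])
      then show "Y \<in> ?g ` ?C" using c by auto
    qed
  qed
qed

end

section \<open>Semistandard and reverse row-strict tableaux\<close>

text \<open>This and the next three predicates say which positions \<open>Y\<close> of the split-off
  label are compatible with \<open>S\<close>; they match the set sides of the four preceding
  bijections.\<close>

definition ssyt_first :: "box set \<Rightarrow> box set \<Rightarrow> bool" where
  "ssyt_first S Y \<longleftrightarrow> (\<forall>i j j'. (i, j) \<in> Y \<and> (i, j') \<in> S \<and> j' < j \<longrightarrow> (i, j') \<in> Y) \<and>
     (\<forall>i i' j. (i, j) \<in> Y \<and> (i', j) \<in> S \<longrightarrow> i \<le> i')"

definition ssyt_last :: "box set \<Rightarrow> box set \<Rightarrow> bool" where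
  "ssyt_last S Y \<longleftrightarrow> (\<forall>i j j'. (i, j) \<in> Y \<and> (i, j') \<in> S \<and> j < j' \<longrightarrow> (i, j') \<in> Y) \<and>
     (\<forall>i i' j. (i, j) \<in> Y \<and> (i', j) \<in> S \<longrightarrow> i' \<le> i)"

definition rrs_first :: "box set \<Rightarrow> box set \<Rightarrow> bool" where
  "rrs_first S Y \<longleftrightarrow> (\<forall>i j j'. (i, j) \<in> Y \<and> (i, j') \<in> S \<longrightarrow> j' \<le> j) \<and>
     (\<forall>i i' j. (i, j) \<in> Y \<and> (i', j) \<in> S \<and> i < i' \<longrightarrow> (i', j) \<in> Y)"

definition ssyt_diagonal :: "box set \<Rightarrow> box set \<Rightarrow> bool" where
  "ssyt_diagonal S Y \<longleftrightarrow> (\<forall>i j j'. (i, j) \<in> Y \<and> (i, j') \<in> S \<and> j < j' \<longrightarrow> (i, j') \<in> Y) \<and>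
     (\<forall>i i' j. (i, j) \<in> Y \<and> (i', j) \<in> S \<and> i < i' \<longrightarrow> (i', j) \<in> Y)"

lemma semistandardD:
  assumes "semistandard S T"
  shows "(i, j) \<in> S \<Longrightarrow> (i, j') \<in> S \<Longrightarrow> j < j' \<Longrightarrow> T (i, j) \<le> T (i, j')"
    and "(i, j) \<in> S \<Longrightarrow> (i', j) \<in> S \<Longrightarrow> i < i' \<Longrightarrow> T (i, j) < T (i', j)"
  using assms unfolding semistandard_def by blast+

lemma reverse_row_strictD:
  assumes "reverse_row_strict S T"
  shows "(i, j) \<in> S \<Longrightarrow> (i, j') \<in> S \<Longrightarrow> j < j' \<Longrightarrow> T (i, j') < T (i, j)"
    and "(i, j) \<in> S \<Longrightarrow> (i', j) \<in> S \<Longrightarrow> i < i' \<Longrightarrow> T (i', j) \<le> T (i, j)"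
  using assms unfolding reverse_row_strict_def by blast+

lemma semistandard_subset:
  "semistandard S f \<Longrightarrow> S' \<subseteq> S \<Longrightarrow> (\<And>b. b \<in> S' \<Longrightarrow> f b = g b) \<Longrightarrow> semistandard S' g"
  unfolding semistandard_def by (metis subsetD)

lemma reverse_row_strict_subset:
  "reverse_row_strict S f \<Longrightarrow> S' \<subseteq> S \<Longrightarrow> (\<And>b. b \<in> S' \<Longrightarrow> f b = g b) \<Longrightarrow> reverse_row_strict S' g"
  unfolding reverse_row_strict_def by (metis subsetD)

text \<open>All labels outside \<open>Y\<close> exceed \<open>l\<close>, so every comparison between
  \<open>Y\<close> and its complement reduces to a condition on positions alone.\<close>

lemma semistandard_split_first:
  assumes Y: "Y \<subseteq> S" and gt: "\<And>b. b \<in> S \<Longrightarrow> b \<notin> Y \<Longrightarrow> l < T b"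
  shows "semistandard S (\<lambda>b. if b \<in> Y then l else T b) \<longleftrightarrow> ssyt_first S Y \<and> semistandard (S - Y) T"
    (is "semistandard S ?T \<longleftrightarrow> _ \<and> ?C")
proof -
  let ?A = "\<forall>i j j'. (i, j) \<in> Y \<and> (i, j') \<in> S \<and> j' < j \<longrightarrow> (i, j') \<in> Y"
  let ?B = "\<forall>i i' j. (i, j) \<in> Y \<and> (i', j) \<in> S \<longrightarrow> i \<le> i'"
  have "semistandard S ?T \<longleftrightarrow> (?A \<and> ?B) \<and> ?C"
  proof
    assume ss: "semistandard S ?T"
    have ?A
    proof clarify
      fix i j j' assume "(i, j) \<in> Y" "(i, j') \<in> S" "j' < j"
      then have "?T (i, j') \<le> ?T (i, j)" using semistandardD(1)[OF ss] Y by blast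
      then show "(i, j') \<in> Y" using gt \<open>(i, j) \<in> Y\<close> \<open>(i, j') \<in> S\<close>
        by (cases "(i, j') \<in> Y") (auto simp: not_less[symmetric])
    qed
    moreover have ?B
    proof clarify
      fix i i' j assume *: "(i, j) \<in> Y" "(i', j) \<in> S"
      show "i \<le> i'"
      proof (rule ccontr)
        assume "\<not> i \<le> i'"
        then have "?T (i', j) < ?T (i, j)" using semistandardD(2)[OF ss] Y * by (meson not_le subsetD)
        then show False using gt * by (cases "(i', j) \<in> Y") (auto dest: less_trans)
      qed
    qed
    moreover have ?C by (rule semistandard_subset[OF ss]) auto
    ultimately show "(?A \<and> ?B) \<and> ?C" by blast
  next
    assume ABC: "(?A \<and> ?B) \<and> ?C"
    show "semistandard S ?T" unfolding semistandard_def
    proof (intro conjI allI impI)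
      fix i j j' assume *: "(i, j) \<in> S \<and> (i, j') \<in> S \<and> j < j'"
      show "?T (i, j) \<le> ?T (i, j')"
        using ABC * gt[of "(i, j')"] unfolding semistandard_def
        by (cases "(i, j) \<in> Y"; cases "(i, j') \<in> Y") (simp_all, blast+)
    next
      fix i i' j assume *: "(i, j) \<in> S \<and> (i', j) \<in> S \<and> i < i'"
      then have "(i', j) \<notin> Y" using ABC by (meson leD)
      then show "?T (i, j) < ?T (i', j)"
        using ABC * gt[of "(i', j)"] unfolding semistandard_def
        by (cases "(i, j) \<in> Y") simp_all
    qed
  qed
  then show ?thesis by (simp only: ssyt_first_def)
qed

lemma semistandard_split_last:
  assumes Y: "Y \<subseteq> S" and gt: "\<And>b. b \<in> S \<Longrightarrow> b \<notin> Y \<Longrightarrow> T b < l"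
  shows "semistandard S (\<lambda>b. if b \<in> Y then l else T b) \<longleftrightarrow> ssyt_last S Y \<and> semistandard (S - Y) T"
    (is "semistandard S ?T \<longleftrightarrow> _ \<and> ?C")
proof -
  let ?A = "\<forall>i j j'. (i, j) \<in> Y \<and> (i, j') \<in> S \<and> j < j' \<longrightarrow> (i, j') \<in> Y"
  let ?B = "\<forall>i i' j. (i, j) \<in> Y \<and> (i', j) \<in> S \<longrightarrow> i' \<le> i"
  have "semistandard S ?T \<longleftrightarrow> (?A \<and> ?B) \<and> ?C"
  proof
    assume ss: "semistandard S ?T"
    have ?A
    proof clarify
      fix i j j' assume "(i, j) \<in> Y" "(i, j') \<in> S" "j < j'"
      then have "?T (i, j) \<le> ?T (i, j')" using semistandardD(1)[OF ss] Y by blast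
      then show "(i, j') \<in> Y" using gt \<open>(i, j) \<in> Y\<close> \<open>(i, j') \<in> S\<close>
        by (cases "(i, j') \<in> Y") (auto simp: not_less[symmetric])
    qed
    moreover have ?B
    proof clarify
      fix i i' j assume *: "(i, j) \<in> Y" "(i', j) \<in> S"
      show "i' \<le> i"
      proof (rule ccontr)
        assume "\<not> i' \<le> i"
        then have "?T (i, j) < ?T (i', j)" using semistandardD(2)[OF ss] Y * by (meson not_le subsetD)
        then show False using gt * by (cases "(i', j) \<in> Y") (auto dest: less_trans)
      qed
    qed
    moreover have ?C by (rule semistandard_subset[OF ss]) auto
    ultimately show "(?A \<and> ?B) \<and> ?C" by blast
  next
    assume ABC: "(?A \<and> ?B) \<and> ?C"
    show "semistandard S ?T" unfolding semistandard_def
    proof (intro conjI allI impI)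
      fix i j j' assume *: "(i, j) \<in> S \<and> (i, j') \<in> S \<and> j < j'"
      show "?T (i, j) \<le> ?T (i, j')"
        using ABC * gt[of "(i, j)"] unfolding semistandard_def
        by (cases "(i, j) \<in> Y"; cases "(i, j') \<in> Y") (simp_all, blast+)
    next
      fix i i' j assume *: "(i, j) \<in> S \<and> (i', j) \<in> S \<and> i < i'"
      then have "(i, j) \<notin> Y" using ABC by (meson leD)
      then show "?T (i, j) < ?T (i', j)"
        using ABC * gt[of "(i, j)"] unfolding semistandard_def
        by (cases "(i', j) \<in> Y") simp_all
    qed
  qed
  then show ?thesis by (simp only: ssyt_last_def)
qed

lemma reverse_row_strict_split_first:
  assumes Y: "Y \<subseteq> S" and gt: "\<And>b. b \<in> S \<Longrightarrow> b \<notin> Y \<Longrightarrow> l < T b"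
  shows "reverse_row_strict S (\<lambda>b. if b \<in> Y then l else T b) \<longleftrightarrow> rrs_first S Y \<and> reverse_row_strict (S - Y) T"
    (is "reverse_row_strict S ?T \<longleftrightarrow> _ \<and> ?C")
proof -
  let ?A = "\<forall>i j j'. (i, j) \<in> Y \<and> (i, j') \<in> S \<longrightarrow> j' \<le> j"
  let ?B = "\<forall>i i' j. (i, j) \<in> Y \<and> (i', j) \<in> S \<and> i < i' \<longrightarrow> (i', j) \<in> Y"
  have "reverse_row_strict S ?T \<longleftrightarrow> (?A \<and> ?B) \<and> ?C"
  proof
    assume ss: "reverse_row_strict S ?T"
    have ?A
    proof clarify
      fix i j j' assume *: "(i, j) \<in> Y" "(i, j') \<in> S"
      show "j' \<le> j"
      proof (rule ccontr)
        assume "\<not> j' \<le> j"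
        then have "?T (i, j') < ?T (i, j)" using reverse_row_strictD(1)[OF ss] Y * by (meson not_le subsetD)
        then show False using gt * by (cases "(i, j') \<in> Y") (auto dest: less_trans)
      qed
    qed
    moreover have ?B
    proof clarify
      fix i i' j assume "(i, j) \<in> Y" "(i', j) \<in> S" "i < i'"
      then have "?T (i', j) \<le> ?T (i, j)" using reverse_row_strictD(2)[OF ss] Y by blast
      then show "(i', j) \<in> Y" using gt \<open>(i, j) \<in> Y\<close> \<open>(i', j) \<in> S\<close>
        by (cases "(i', j) \<in> Y") (auto simp: not_less[symmetric])
    qed
    moreover have ?C by (rule reverse_row_strict_subset[OF ss]) auto
    ultimately show "(?A \<and> ?B) \<and> ?C" by blast
  next
    assume ABC: "(?A \<and> ?B) \<and> ?C"
    show "reverse_row_strict S ?T" unfolding reverse_row_strict_def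
    proof (intro conjI allI impI)
      fix i j j' assume *: "(i, j) \<in> S \<and> (i, j') \<in> S \<and> j < j'"
      then have "(i, j) \<notin> Y" using ABC by (meson leD)
      then show "?T (i, j') < ?T (i, j)"
        using ABC * gt[of "(i, j)"] unfolding reverse_row_strict_def
        by (cases "(i, j') \<in> Y") simp_all
    next
      fix i i' j assume *: "(i, j) \<in> S \<and> (i', j) \<in> S \<and> i < i'"
      show "?T (i', j) \<le> ?T (i, j)"
        using ABC * gt[of "(i, j)"] unfolding reverse_row_strict_def
        by (cases "(i, j) \<in> Y"; cases "(i', j) \<in> Y") (simp_all, blast+)
    qed
  qed
  then show ?thesis by (simp only: rrs_first_def)
qed

text \<open>A column of an interval-closed shape holding \<open>i\<close> in row \<open>i\<close>, with all labels bounded by their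
  row, is forced to hold the row index in each lower row.\<close>

lemma semistandard_split_diagonal:
  assumes Y: "Y \<subseteq> S" and gt: "\<And>b. b \<in> S \<Longrightarrow> b \<notin> Y \<Longrightarrow> T b < fst b"
    and conv: "\<And>i i' i'' j. (i, j) \<in> S \<Longrightarrow> (i'', j) \<in> S \<Longrightarrow> i \<le> i' \<Longrightarrow> i' \<le> i'' \<Longrightarrow> (i', j) \<in> S"
  shows "semistandard S (\<lambda>b. if b \<in> Y then fst b else T b) \<longleftrightarrow> ssyt_diagonal S Y \<and> semistandard (S - Y) T"
    (is "semistandard S ?T \<longleftrightarrow> _ \<and> ?C")
proof -
  let ?A = "\<forall>i j j'. (i, j) \<in> Y \<and> (i, j') \<in> S \<and> j < j' \<longrightarrow> (i, j') \<in> Y"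
  let ?B = "\<forall>i i' j. (i, j) \<in> Y \<and> (i', j) \<in> S \<and> i < i' \<longrightarrow> (i', j) \<in> Y"
  have "semistandard S ?T \<longleftrightarrow> (?A \<and> ?B) \<and> ?C"
  proof
    assume ss: "semistandard S ?T"
    have ?A
    proof clarify
      fix i j j' assume "(i, j) \<in> Y" "(i, j') \<in> S" "j < j'"
      then have "?T (i, j) \<le> ?T (i, j')" using semistandardD(1)[OF ss] Y by blast
      then show "(i, j') \<in> Y" using gt[of "(i, j')"] \<open>(i, j) \<in> Y\<close> \<open>(i, j') \<in> S\<close>
        by (cases "(i, j') \<in> Y") auto
    qed
    moreover have ?B
    proof clarify
      fix i i' j assume *: "(i, j) \<in> Y" "(i', j) \<in> S" "i < i'"
      have "i \<le> i' \<Longrightarrow> (i', j) \<in> S \<longrightarrow> (i', j) \<in> Y" for i'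
      proof (induction i' rule: dec_induct)
        case (step m)
        show ?case
        proof
          assume S: "(Suc m, j) \<in> S"
          then have m: "(m, j) \<in> S" using conv[of i j "Suc m" m] * Y step.hyps by auto
          then have "?T (m, j) < ?T (Suc m, j)" using semistandardD(2)[OF ss m S] by simp
          then show "(Suc m, j) \<in> Y" using step.IH m gt[OF S] by (cases "(Suc m, j) \<in> Y") auto
        qed
      qed (use * in simp)
      then show "(i', j) \<in> Y" using * by simp
    qed
    moreover have ?C by (rule semistandard_subset[OF ss]) auto
    ultimately show "(?A \<and> ?B) \<and> ?C" by blast
  next
    assume ABC: "(?A \<and> ?B) \<and> ?C"
    show "semistandard S ?T" unfolding semistandard_def
    proof (intro conjI allI impI)
      fix i j j' assume *: "(i, j) \<in> S \<and> (i, j') \<in> S \<and> j < j'"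
      show "?T (i, j) \<le> ?T (i, j')"
      proof (cases "(i, j) \<in> Y")
        case True
        then have "(i, j') \<in> Y" using ABC * by blast
        then show ?thesis using True by simp
      next
        case False
        then show ?thesis
          using gt[of "(i, j)"] * semistandardD(1)[OF conjunct2[OF ABC], of i j j'] by auto
      qed
    next
      fix i i' j assume *: "(i, j) \<in> S \<and> (i', j) \<in> S \<and> i < i'"
      show "?T (i, j) < ?T (i', j)"
      proof (cases "(i, j) \<in> Y")
        case True
        then have "(i', j) \<in> Y" using ABC * by blast
        then show ?thesis using True * by simp
      next
        case False
        then show ?thesis
          using gt[of "(i, j)"] * semistandardD(2)[OF conjunct2[OF ABC], of i j i'] by auto
      qed
    qed
  qed
  then show ?thesis by (simp only: ssyt_diagonal_def)
qed

section \<open>One-label recursions for tableau sums\<close>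

context columns begin

lemma semistandard_sum_first:
  fixes x :: "nat \<Rightarrow> 'r::comm_ring_1"
  assumes p: "p \<in> shapes" and q: "q \<in> shapes" and le: "\<And>i. p i \<le> q i" and l: "l \<le> n"
  shows "tabsum semistandard (skew q p) (\<lambda>_. {l..n}) x =
    (\<Sum>c | hstrip p c \<and> (\<forall>i. c i \<le> q i). x l ^ card (skew c p) *
      tabsum semistandard (skew q c) (\<lambda>_. {Suc l..n}) x)"
proof -
  have "tabsum semistandard (skew q p) (\<lambda>_. {l..n}) x =
    (\<Sum>c | hstrip p c \<and> (\<forall>i. c i \<le> q i). (\<Prod>b\<in>skew c p. x l) *
      tabsum semistandard (skew q p - skew c p) (\<lambda>_. {l..n} - {l}) x)"
  proof (rule tabsum_split[where e = "\<lambda>_. l" and g = "\<lambda>c. skew c p" and good = "ssyt_first (skew q p)"])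
    show "finite (skew q p)" by (rule finite_skew[OF q])
    show "bij_betw (\<lambda>c. skew c p) {c. hstrip p c \<and> (\<forall>i. c i \<le> q i)} {Y. Y \<subseteq> skew q p \<and> (\<forall>b\<in>Y. l \<in> {l..n}) \<and> ssyt_first (skew q p) Y}"
      using bij_first_label[OF p q le] l by (simp add: ssyt_first_def)
    fix Y T assume "Y \<subseteq> skew q p" "T \<in> PiE (skew q p - Y) (\<lambda>_. {l..n} - {l})"
    then show "semistandard (skew q p) (\<lambda>b. if b \<in> Y then l else T b) \<longleftrightarrow> ssyt_first (skew q p) Y \<and> semistandard (skew q p - Y) T"
      by (intro semistandard_split_first) (force simp: PiE_iff)+
  qed auto
  also have "\<dots> = (\<Sum>c | hstrip p c \<and> (\<forall>i. c i \<le> q i). x l ^ card (skew c p) *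
      tabsum semistandard (skew q c) (\<lambda>_. {Suc l..n}) x)"
  proof (rule sum.cong[OF refl])
    fix c assume c: "c \<in> {c. hstrip p c \<and> (\<forall>i. c i \<le> q i)}"
    have "skew q p - skew c p = skew q c" by (rule skew_diff_inner) (use c in \<open>auto simp: hstrip_def\<close>)
    moreover have "{l..n} - {l} = {Suc l..n}" by auto
    ultimately show "(\<Prod>b\<in>skew c p. x l) *
      tabsum semistandard (skew q p - skew c p) (\<lambda>_. {l..n} - {l}) x = x l ^ card (skew c p) *
      tabsum semistandard (skew q c) (\<lambda>_. {Suc l..n}) x" by simp
  qed
  finally show ?thesis .
qed

lemma reverse_row_strict_sum_first:
  assumes p': "p' \<in> shapes" and p: "p \<in> shapes" and le: "\<And>i. p' i \<le> p i"
  shows "tabsum reverse_row_strict (skew p p') (\<lambda>b. {l..fst b}) (\<lambda>_. - 1) =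
    (\<Sum>c | vstrip_from l c p \<and> (\<forall>i. p' i \<le> c i). (- 1) ^ card (skew p c) *
      (tabsum reverse_row_strict (skew c p') (\<lambda>b. {Suc l..fst b}) (\<lambda>_. - 1) :: 'r::comm_ring_1))"
proof -
  have "tabsum reverse_row_strict (skew p p') (\<lambda>b. {l..fst b}) (\<lambda>_. - 1) =
    (\<Sum>c | vstrip_from l c p \<and> (\<forall>i. p' i \<le> c i). (\<Prod>b\<in>skew p c. - 1) *
      (tabsum reverse_row_strict (skew p p' - skew p c) (\<lambda>b. {l..fst b} - {l}) (\<lambda>_. - 1) :: 'r))"
  proof (rule tabsum_split[where e = "\<lambda>_. l" and g = "\<lambda>c. skew p c" and good = "rrs_first (skew p p')"])
    show "finite (skew p p')" by (rule finite_skew[OF p])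
    show "bij_betw (\<lambda>c. skew p c) {c. vstrip_from l c p \<and> (\<forall>i. p' i \<le> c i)} {Y. Y \<subseteq> skew p p' \<and> (\<forall>b\<in>Y. l \<in> {l..fst b}) \<and> rrs_first (skew p p') Y}"
      using bij_reverse_label[OF p' p le, of l] by (simp add: rrs_first_def)
    fix Y T assume "Y \<subseteq> skew p p'" "T \<in> PiE (skew p p' - Y) (\<lambda>b. {l..fst b} - {l})"
    then show "reverse_row_strict (skew p p') (\<lambda>b. if b \<in> Y then l else T b) \<longleftrightarrow> rrs_first (skew p p') Y \<and> reverse_row_strict (skew p p' - Y) T"
      by (intro reverse_row_strict_split_first) (force simp: PiE_iff)+
  qed auto
  also have "\<dots> = (\<Sum>c | vstrip_from l c p \<and> (\<forall>i. p' i \<le> c i). (- 1) ^ card (skew p c) *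
      tabsum reverse_row_strict (skew c p') (\<lambda>b. {Suc l..fst b}) (\<lambda>_. - 1))"
  proof (rule sum.cong[OF refl])
    fix c assume c: "c \<in> {c. vstrip_from l c p \<and> (\<forall>i. p' i \<le> c i)}"
    have "skew p p' - skew p c = skew c p'" by (rule skew_diff_outer) (use c in \<open>auto simp: vstrip_from_def\<close>)
    moreover have "{l..m} - {l} = {Suc l..m}" for m by auto
    ultimately show "(\<Prod>b\<in>skew p c. - 1) *
      tabsum reverse_row_strict (skew p p' - skew p c) (\<lambda>b. {l..fst b} - {l}) (\<lambda>_. - 1) =
      ((- 1) ^ card (skew p c) *
      tabsum reverse_row_strict (skew c p') (\<lambda>b. {Suc l..fst b}) (\<lambda>_. - 1) :: 'r)" by simp
  qed
  finally show ?thesis .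
qed

lemma semistandard_sum_last:
  assumes q: "q \<in> shapes" and d: "d \<in> shapes" and le: "\<And>i. q i \<le> d i"
  shows "tabsum semistandard (skew d q) (\<lambda>b. {1..min (Suc k) (fst b)}) (\<lambda>_. 1) =
    (\<Sum>c | hstrip_from (Suc k) c d \<and> (\<forall>i. q i \<le> c i).
      (tabsum semistandard (skew c q) (\<lambda>b. {1..min k (fst b)}) (\<lambda>_. 1) :: 'r::comm_ring_1))"
proof -
  have "tabsum semistandard (skew d q) (\<lambda>b. {1..min (Suc k) (fst b)}) (\<lambda>_. 1) =
    (\<Sum>c | hstrip_from (Suc k) c d \<and> (\<forall>i. q i \<le> c i). (\<Prod>b\<in>skew d c. 1) *
      (tabsum semistandard (skew d q - skew d c) (\<lambda>b. {1..min (Suc k) (fst b)} - {Suc k}) (\<lambda>_. 1) :: 'r))"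
  proof (rule tabsum_split[where e = "\<lambda>_. Suc k" and g = "\<lambda>c. skew d c" and good = "ssyt_last (skew d q)"])
    show "finite (skew d q)" by (rule finite_skew[OF d])
    show "bij_betw (\<lambda>c. skew d c) {c. hstrip_from (Suc k) c d \<and> (\<forall>i. q i \<le> c i)} {Y. Y \<subseteq> skew d q \<and> (\<forall>b\<in>Y. Suc k \<in> {1..min (Suc k) (fst b)}) \<and> ssyt_last (skew d q) Y}"
      using bij_last_label[OF q d le, of "Suc k"] by (simp add: ssyt_last_def)
    fix Y T assume "Y \<subseteq> skew d q" "T \<in> PiE (skew d q - Y) (\<lambda>b. {1..min (Suc k) (fst b)} - {Suc k})"
    then show "semistandard (skew d q) (\<lambda>b. if b \<in> Y then Suc k else T b) \<longleftrightarrow> ssyt_last (skew d q) Y \<and> semistandard (skew d q - Y) T"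
      by (intro semistandard_split_last) (force simp: PiE_iff)+
  qed auto
  also have "\<dots> = (\<Sum>c | hstrip_from (Suc k) c d \<and> (\<forall>i. q i \<le> c i).
      tabsum semistandard (skew c q) (\<lambda>b. {1..min k (fst b)}) (\<lambda>_. 1))"
  proof (rule sum.cong[OF refl])
    fix c assume c: "c \<in> {c. hstrip_from (Suc k) c d \<and> (\<forall>i. q i \<le> c i)}"
    have "skew d q - skew d c = skew c q"
      by (rule skew_diff_outer) (use c in \<open>auto simp: hstrip_from_def hstrip_def\<close>)
    moreover have "{1..min (Suc k) m} - {Suc k} = {1..min k m}" for m by auto
    ultimately show "(\<Prod>b\<in>skew d c. 1) *
      (tabsum semistandard (skew d q - skew d c) (\<lambda>b. {1..min (Suc k) (fst b)} - {Suc k}) (\<lambda>_. 1) :: 'r) =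
      tabsum semistandard (skew c q) (\<lambda>b. {1..min k (fst b)}) (\<lambda>_. 1)" by simp
  qed
  finally show ?thesis .
qed

lemma skew_row_pos: "a \<in> shapes \<Longrightarrow> d \<in> shapes \<Longrightarrow> b \<in> skew d a \<Longrightarrow> 1 \<le> fst b"
  using shapes_0[of a] shapes_0[of d] by (cases "fst b") (auto simp: skew_def)

lemma semistandard_sum_diagonal:
  assumes q: "q \<in> shapes" and d: "d \<in> shapes" and le: "\<And>i. q i \<le> d i"
  shows "tabsum semistandard (skew d q) (\<lambda>b. {1..fst b}) (\<lambda>_. 1) =
    (\<Sum>c | c \<in> shapes \<and> (\<forall>i. q i \<le> c i) \<and> (\<forall>i. c i \<le> d i).
      (tabsum semistandard (skew c q) (\<lambda>b. {1..<fst b}) (\<lambda>_. 1) :: 'r::comm_ring_1))"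
proof -
  have "tabsum semistandard (skew d q) (\<lambda>b. {1..fst b}) (\<lambda>_. 1) =
    (\<Sum>c | c \<in> shapes \<and> (\<forall>i. q i \<le> c i) \<and> (\<forall>i. c i \<le> d i). (\<Prod>b\<in>skew d c. 1) *
      (tabsum semistandard (skew d q - skew d c) (\<lambda>b. {1..fst b} - {fst b}) (\<lambda>_. 1) :: 'r))"
  proof (rule tabsum_split[where e = fst and g = "\<lambda>c. skew d c" and good = "ssyt_diagonal (skew d q)"])
    show "finite (skew d q)" by (rule finite_skew[OF d])
    have "Y \<subseteq> skew d q \<and> (\<forall>b\<in>Y. fst b \<in> {1..fst b}) \<longleftrightarrow> Y \<subseteq> skew d q" for Y
      using skew_row_pos[OF q d] by auto
    then show "bij_betw (\<lambda>c. skew d c) {c. c \<in> shapes \<and> (\<forall>i. q i \<le> c i) \<and> (\<forall>i. c i \<le> d i)}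
      {Y. Y \<subseteq> skew d q \<and> (\<forall>b\<in>Y. fst b \<in> {1..fst b}) \<and> ssyt_diagonal (skew d q) Y}"
      using bij_between[OF q d le] unfolding conj_assoc[symmetric] ssyt_diagonal_def by simp
    fix Y T assume *: "Y \<subseteq> skew d q" "T \<in> PiE (skew d q - Y) (\<lambda>b. {1..fst b} - {fst b})"
    show "semistandard (skew d q) (\<lambda>b. if b \<in> Y then fst b else T b) \<longleftrightarrow>
        ssyt_diagonal (skew d q) Y \<and> semistandard (skew d q - Y) T"
    proof (rule semistandard_split_diagonal[OF *(1)])
      show "T b < fst b" if "b \<in> skew d q" "b \<notin> Y" for b
        using PiE_mem[OF *(2), of b] that by auto
      show "(i', j) \<in> skew d q" if "(i, j) \<in> skew d q" "(i'', j) \<in> skew d q" "i \<le> i'" "i' \<le> i''" for i i' i'' j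
        using that shapes_antimono[OF q that(3)] shapes_antimono[OF d that(4)] by (auto simp: skew_def)
    qed
  qed auto
  also have "\<dots> = (\<Sum>c | c \<in> shapes \<and> (\<forall>i. q i \<le> c i) \<and> (\<forall>i. c i \<le> d i).
      tabsum semistandard (skew c q) (\<lambda>b. {1..<fst b}) (\<lambda>_. 1))"
  proof (rule sum.cong[OF refl])
    fix c assume c: "c \<in> {c. c \<in> shapes \<and> (\<forall>i. q i \<le> c i) \<and> (\<forall>i. c i \<le> d i)}"
    have "skew d q - skew d c = skew c q" by (rule skew_diff_outer) (use c in auto)
    moreover have "{1..m} - {m} = {1..<m}" for m :: nat by auto
    ultimately show "(\<Prod>b\<in>skew d c. 1) *
      (tabsum semistandard (skew d q - skew d c) (\<lambda>b. {1..fst b} - {fst b}) (\<lambda>_. 1) :: 'r) =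
      tabsum semistandard (skew c q) (\<lambda>b. {1..<fst b}) (\<lambda>_. 1)" by simp
  qed
  finally show ?thesis .
qed

section \<open>Iterated operators as tableau sums\<close>

lemma foldr_Vop_delta_zero:
  assumes "a \<in> shapes" "\<not> (\<forall>i. a i \<le> q i)"
  shows "foldr (Vop cap) xs (delta q) a = 0"
proof -
  obtain M where "a \<in> shapes_upto M" using assms by (auto simp: shapes_def)
  then show ?thesis by (rule foldr_Vop_zero[rotated]) (use assms in \<open>auto simp: delta_def\<close>)
qed

lemma tabsum_no_labels:
  assumes "\<And>i. p i \<le> q i" "\<And>T. Q {} T" "\<And>b. b \<in> skew q p \<Longrightarrow> M b = {}"
  shows "tabsum Q (skew q p) M w = of_bool (q = p)"
proof (cases "q = p")
  case True
  then show ?thesis using assms(2) by (simp add: skew_self tabsum_empty_shape)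
next
  case False
  then obtain b where "b \<in> skew q p" using skew_empty_iff[of p q] assms(1) by auto
  then show ?thesis using tabsum_empty_range[of b "skew q p" M Q w] assms(3) False by simp
qed

lemma semistandard_empty: "semistandard {} T" "reverse_row_strict {} T"
  by (auto simp: semistandard_def reverse_row_strict_def)

lemma vweight_rect_0: "vweight (rect 0) x a d = x ^ card (skew d a)"
  by (simp add: vweight_def corners_def rect_def)

text \<open>Both sides split off the least label. The operator also allows strips that leave
  \<open>q\<close>, but shapes only grow, so these never end at \<open>q\<close> and contribute
  nothing.\<close>

lemma foldr_Vop_semistandard:
  fixes x :: "nat \<Rightarrow> 'r::comm_ring_1"
  assumes q: "q \<in> shapes"
  shows "p \<in> shapes \<Longrightarrow> (\<And>i. p i \<le> q i) \<Longrightarrow>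
    foldr (Vop (rect 0)) (map x [l..<Suc n]) (delta q) p = tabsum semistandard (skew q p) (\<lambda>_. {l..n}) x"
proof (induction "Suc n - l" arbitrary: l p)
  case 0
  then have "map x [l..<Suc n] = []" by simp
  moreover have "tabsum semistandard (skew q p) (\<lambda>_. {l..n}) x = of_bool (q = p)"
    by (rule tabsum_no_labels) (use 0 semistandard_empty in auto)
  ultimately show ?case by (auto simp: delta_def simp del: upt_Suc)
next
  case (Suc k)
  then have l: "l \<le> n" "map x [l..<Suc n] = x l # map x [Suc l..<Suc n]"
    by (simp_all add: upt_conv_Cons del: upt_Suc)
  have "foldr (Vop (rect 0)) (map x [l..<Suc n]) (delta q) p
      = (\<Sum>c | hstrip p c. x l ^ card (skew c p) * foldr (Vop (rect 0)) (map x [Suc l..<Suc n]) (delta q) c)"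
    unfolding l(2) foldr_Vop_Cons vweight_rect_0 ..
  also have "\<dots> = (\<Sum>c | hstrip p c \<and> (\<forall>i. c i \<le> q i). x l ^ card (skew c p) *
      foldr (Vop (rect 0)) (map x [Suc l..<Suc n]) (delta q) c)"
  proof (rule sum.mono_neutral_right[OF finite_hstrip])
    have "foldr (Vop (rect 0)) (map x [Suc l..<Suc n]) (delta q) c = 0"
      if "hstrip p c" "\<not> (\<forall>i. c i \<le> q i)" for c
      by (rule foldr_Vop_delta_zero) (use that in \<open>auto simp: hstrip_def\<close>)
    then show "\<forall>c\<in>{c. hstrip p c} - {c. hstrip p c \<and> (\<forall>i. c i \<le> q i)}.
        x l ^ card (skew c p) * foldr (Vop (rect 0)) (map x [Suc l..<Suc n]) (delta q) c = 0"
      by (simp del: upt_Suc)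
  qed auto
  also have "\<dots> = (\<Sum>c | hstrip p c \<and> (\<forall>i. c i \<le> q i). x l ^ card (skew c p) *
      tabsum semistandard (skew q c) (\<lambda>_. {Suc l..n}) x)"
    by (rule sum.cong[OF refl]) (use Suc in \<open>auto simp: hstrip_def simp del: upt_Suc\<close>)
  also have "\<dots> = tabsum semistandard (skew q p) (\<lambda>_. {l..n}) x"
    by (rule semistandard_sum_first[symmetric]) (use Suc q l in auto)
  finally show ?case .
qed

text \<open>Finitely many operators suffice, since \<open>p\<close> has at most \<open>K\<close>
  rows and a label bounded by its row is then at most \<open>K\<close>. The weight
  \<open>- 1\<close> per box collects the signs of the vertical strips.\<close>

lemma foldr_Dop_reverse_row_strict:
  fixes f :: "(nat \<Rightarrow> nat) \<Rightarrow> 'r::comm_ring_1"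
  shows "p \<in> shapes_upto K \<Longrightarrow> foldr Dop [l..<Suc K] f p =
    (\<Sum>p' | p' \<in> shapes \<and> (\<forall>i. p' i \<le> p i).
      tabsum reverse_row_strict (skew p p') (\<lambda>b. {l..fst b}) (\<lambda>_. - 1) * f p')"
proof (induction "Suc K - l" arbitrary: l p)
  case 0
  have p: "p \<in> shapes" using 0 shapes_upto_shapes by auto
  have "(tabsum reverse_row_strict (skew p p') (\<lambda>b. {l..fst b}) (\<lambda>_. - 1) :: 'r) = of_bool (p = p')"
    if "\<forall>i. p' i \<le> p i" for p'
  proof (rule tabsum_no_labels)
    fix b assume b: "b \<in> skew p p'"
    then have "p (fst b) \<noteq> 0" by (auto simp: skew_def)
    then have "fst b \<le> K" using 0(2) by (auto simp: shapes_upto_def not_less[symmetric])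
    then show "{l..fst b} = {}" using 0(1) by simp
  qed (use that semistandard_empty in auto)
  then have "(\<Sum>p' | p' \<in> shapes \<and> (\<forall>i. p' i \<le> p i).
      tabsum reverse_row_strict (skew p p') (\<lambda>b. {l..fst b}) (\<lambda>_. - 1) * f p')
    = (\<Sum>p' | p' \<in> shapes \<and> (\<forall>i. p' i \<le> p i). if p = p' then f p' else 0)"
    by (intro sum.cong) auto
  also have "\<dots> = f p" using p finite_below[OF p] by simp
  finally show ?case using 0 by simp
next
  case (Suc k)
  then have l: "[l..<Suc K] = l # [Suc l..<Suc K]" by (simp add: upt_conv_Cons del: upt_Suc)
  have p: "p \<in> shapes" using Suc shapes_upto_shapes by auto
  let ?t = "\<lambda>l c p'. tabsum reverse_row_strict (skew c p') (\<lambda>b. {l..fst b}) (\<lambda>_. - 1) :: 'r"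
  have "foldr Dop [l..<Suc K] f p = (\<Sum>c | vstrip_from l c p. (- 1) ^ card (skew p c) *
      foldr Dop [Suc l..<Suc K] f c)"
    unfolding l foldr.simps o_apply Dop_def[of l] ..
  also have "\<dots> = (\<Sum>c | vstrip_from l c p. (- 1) ^ card (skew p c) *
      (\<Sum>p' | p' \<in> shapes \<and> (\<forall>i. p' i \<le> c i). ?t (Suc l) c p' * f p'))"
  proof (rule sum.cong[OF refl])
    fix c assume "c \<in> {c. vstrip_from l c p}"
    then have "c \<in> shapes_upto K" using le_upto[OF _ _ Suc.prems] by (auto simp: vstrip_from_def)
    then show "(- 1) ^ card (skew p c) * foldr Dop [Suc l..<Suc K] f c = (- 1) ^ card (skew p c) *
      (\<Sum>p' | p' \<in> shapes \<and> (\<forall>i. p' i \<le> c i). ?t (Suc l) c p' * f p')"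
      using Suc.hyps(1)[of "Suc l" c] Suc.hyps(2) by simp
  qed
  also have "\<dots> = (\<Sum>p'\<in>{p' \<in> shapes. \<forall>i. p' i \<le> p i}.
      (\<Sum>c | vstrip_from l c p \<and> (p' \<in> shapes \<and> (\<forall>i. p' i \<le> c i)). (- 1) ^ card (skew p c) * ?t (Suc l) c p') * f p')"
    by (rule sum_kernel_compose[OF finite_vstrip finite_below[OF p]])
      (auto simp: vstrip_from_def intro: le_trans)
  also have "\<dots> = (\<Sum>p'\<in>{p' \<in> shapes. \<forall>i. p' i \<le> p i}. ?t l p p' * f p')"
  proof (rule sum.cong[OF refl])
    fix p' assume p': "p' \<in> {p' \<in> shapes. \<forall>i. p' i \<le> p i}"
    then show "(\<Sum>c | vstrip_from l c p \<and> (p' \<in> shapes \<and> (\<forall>i. p' i \<le> c i)). (- 1) ^ card (skew p c) * ?t (Suc l) c p') * f p'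
      = ?t l p p' * f p'"
      by (subst reverse_row_strict_sum_first[of p' p l]) (use p in simp_all)
  qed
  finally show ?case .
qed

text \<open>\<open>fold\<close> leaves \<open>Hop K\<close> outermost, so the recursion splits off
  the greatest label; the restriction of \<open>Hop k\<close> to rows \<ge> \<open>k\<close> becomes
  the bound of a label by its row.\<close>

lemma fold_Hop_semistandard:
  assumes q: "q \<in> shapes"
  shows "d \<in> shapes \<Longrightarrow> fold Hop [1..<Suc K] (delta q) d =
    (if \<forall>i. q i \<le> d i then tabsum semistandard (skew d q) (\<lambda>b. {1..min K (fst b)}) (\<lambda>_. 1)
     else 0 :: 'r::comm_ring_1)"
proof (induction K arbitrary: d)
  case 0
  have "tabsum semistandard (skew d q) (\<lambda>b. {1..min 0 (fst b)}) (\<lambda>_. 1) = (of_bool (d = q) :: 'r)"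
    if "\<forall>i. q i \<le> d i"
    by (rule tabsum_no_labels) (use that semistandard_empty in auto)
  then show ?case by (auto simp: delta_def)
next
  case (Suc K)
  let ?t = "\<lambda>K c. tabsum semistandard (skew c q) (\<lambda>b. {1..min K (fst b)}) (\<lambda>_. 1) :: 'r"
  have "fold Hop [1..<Suc (Suc K)] (delta q) d = (\<Sum>c | hstrip_from (Suc K) c d. fold Hop [1..<Suc K] (delta q) c :: 'r)"
    by (simp add: Hop_def[of "Suc K"])
  also have "\<dots> = (\<Sum>c | hstrip_from (Suc K) c d. if \<forall>i. q i \<le> c i then ?t K c else 0)"
    by (rule sum.cong[OF refl], rule Suc.IH) (auto simp: hstrip_from_def hstrip_def)
  also have "\<dots> = (\<Sum>c | hstrip_from (Suc K) c d \<and> (\<forall>i. q i \<le> c i). ?t K c)"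
    using sum.inter_filter[OF finite_hstrip_from[of "Suc K" d], of "?t K" "\<lambda>c. \<forall>i. q i \<le> c i"] by simp
  also have "\<dots> = (if \<forall>i. q i \<le> d i then ?t (Suc K) d else 0)"
  proof (cases "\<forall>i. q i \<le> d i")
    case True
    then show ?thesis by (subst semistandard_sum_last[OF q Suc.prems]) simp_all
  next
    case False
    then have "{c. hstrip_from (Suc K) c d \<and> (\<forall>i. q i \<le> c i)} = {}"
      by (auto simp: hstrip_from_def hstrip_def) (meson le_trans)
    then show ?thesis using False by (simp only: if_False sum.empty)
  qed
  finally show ?case .
qed

end

section \<open>Set-valued tableaux\<close>

definition labelsets :: "nat \<Rightarrow> nat \<Rightarrow> nat set set" where
  "labelsets l n = {L. L \<noteq> {} \<and> L \<subseteq> {l..n}}"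

text \<open>The global sign of a set-valued tableau, distributed over its boxes; the subtraction is
  exact on nonempty finite label sets.\<close>

definition sv_weight :: "(nat \<Rightarrow> 'r::comm_ring_1) \<Rightarrow> nat set \<Rightarrow> 'r" where
  "sv_weight x L = (- 1) ^ (card L - 1) * (\<Prod>k\<in>L. x k)"

text \<open>The places where the least label may occur together with other labels, when
  \<open>Y\<close> consists of the boxes holding it alone.\<close>

definition outer_corners :: "box set \<Rightarrow> box set \<Rightarrow> box set" where
  "outer_corners S Y = {b \<in> S - Y. (\<forall>i<fst b. (i, snd b) \<notin> S) \<and>
     (\<forall>j<snd b. (fst b, j) \<in> S \<longrightarrow> (fst b, j) \<in> Y)}"

lemma finite_labelset: "L \<in> labelsets l n \<Longrightarrow> finite L"
  unfolding labelsets_def using finite_subset by blast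

lemma finite_labelsets: "finite (labelsets l n)"
  by (rule finite_subset[of _ "Pow {l..n}"]) (auto simp: labelsets_def)

lemma sv_semistandard_iff:
  assumes "\<forall>b\<in>S. finite (T b) \<and> T b \<noteq> {}"
  shows "sv_semistandard S T \<longleftrightarrow>
    (\<forall>i j. (i, j) \<in> S \<and> (i, j + 1) \<in> S \<longrightarrow> (\<forall>x\<in>T (i, j). \<forall>y\<in>T (i, j + 1). x \<le> y)) \<and>
    (\<forall>i j. (i, j) \<in> S \<and> (i + 1, j) \<in> S \<longrightarrow> (\<forall>x\<in>T (i, j). \<forall>y\<in>T (i + 1, j). x < y))"
proof -
  have "Max (T b) \<le> Min (T b') \<longleftrightarrow> (\<forall>x\<in>T b. \<forall>y\<in>T b'. x \<le> y)" if "b \<in> S" "b' \<in> S" for b b'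
    using bspec[OF assms that(1)] bspec[OF assms that(2)] by auto
  note A = this
  have B: "Max (T b) < Min (T b') \<longleftrightarrow> (\<forall>x\<in>T b. \<forall>y\<in>T b'. x < y)" if "b \<in> S" "b' \<in> S" for b b'
    using bspec[OF assms that(1)] bspec[OF assms that(2)] by auto
  show ?thesis unfolding sv_semistandard_def
    by (intro conj_cong iff_allI imp_cong refl) (simp_all add: A B)
qed

text \<open>The definition compares adjacent boxes only. Convexity supplies the boxes in between,
  and nonemptiness a label in each of them to chain through.\<close>

lemma sv_semistandard_row:
  assumes ne: "\<forall>b\<in>S. finite (T b) \<and> T b \<noteq> {}"
    and conv: "\<forall>i j j' j''. (i, j) \<in> S \<and> (i, j'') \<in> S \<and> j \<le> j' \<and> j' \<le> j'' \<longrightarrow> (i, j') \<in> S"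
    and ss: "sv_semistandard S T"
    and "(i, j) \<in> S" "(i, j') \<in> S" "j < j'" "x \<in> T (i, j)" "y \<in> T (i, j')"
  shows "x \<le> y"
proof -
  have st: "u \<le> v" if "(i, m) \<in> S" "(i, Suc m) \<in> S" "u \<in> T (i, m)" "v \<in> T (i, Suc m)" for m u v
    using ss that unfolding sv_semistandard_iff[OF ne] by auto
  have "Suc j \<le> j' \<Longrightarrow> (i, j') \<in> S \<longrightarrow> (\<forall>y\<in>T (i, j'). x \<le> y)"
  proof (induction j' rule: dec_induct)
    case base
    show ?case using st[OF assms(4)] assms(7) by blast
  next
    case (step m)
    show ?case
    proof (intro impI ballI)
      fix y assume y: "(i, Suc m) \<in> S" "y \<in> T (i, Suc m)"
      have m: "(i, m) \<in> S" using conv assms(4) y(1) step.hyps by (meson less_imp_le Suc_leD le_SucI order_refl)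
      then obtain z where z: "z \<in> T (i, m)" using ne by blast
      then show "x \<le> y" using step.IH m st[OF m y(1) z y(2)] by (meson le_trans)
    qed
  qed
  then show ?thesis using assms(5,6,8) by (simp add: Suc_le_eq)
qed

lemma sv_semistandard_col:
  assumes ne: "\<forall>b\<in>S. finite (T b) \<and> T b \<noteq> {}"
    and conv: "\<forall>i i' i'' j. (i, j) \<in> S \<and> (i'', j) \<in> S \<and> i \<le> i' \<and> i' \<le> i'' \<longrightarrow> (i', j) \<in> S"
    and ss: "sv_semistandard S T"
    and "(i, j) \<in> S" "(i', j) \<in> S" "i < i'" "x \<in> T (i, j)" "y \<in> T (i', j)"
  shows "x < y"
proof -
  have st: "u < v" if "(m, j) \<in> S" "(Suc m, j) \<in> S" "u \<in> T (m, j)" "v \<in> T (Suc m, j)" for m u v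
    using ss that unfolding sv_semistandard_iff[OF ne] by auto
  have "Suc i \<le> i' \<Longrightarrow> (i', j) \<in> S \<longrightarrow> (\<forall>y\<in>T (i', j). x < y)"
  proof (induction i' rule: dec_induct)
    case base
    show ?case using st[OF assms(4)] assms(7) by blast
  next
    case (step m)
    show ?case
    proof (intro impI ballI)
      fix y assume y: "(Suc m, j) \<in> S" "y \<in> T (Suc m, j)"
      have m: "(m, j) \<in> S" using conv assms(4) y(1) step.hyps by (meson less_imp_le Suc_leD le_SucI order_refl)
      then obtain z where z: "z \<in> T (m, j)" using ne by blast
      then show "x < y" using step.IH m st[OF m y(1) z y(2)] by (meson less_trans)
    qed
  qed
  then show ?thesis using assms(5,6,8) by (simp add: Suc_le_eq)
qed

text \<open>Since \<open>l\<close> is the least label, a box to the left of an occurrence of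
  \<open>l\<close> must be exactly \<open>{l}\<close>, and no box can lie above one. So the larger
  sets containing \<open>l\<close> sit at outer corners, and deleting \<open>l\<close> from them
  leaves a valid filling; conversely \<open>l\<close> may be put back there without violating any
  inequality.\<close>

lemma sv_semistandard_split_first:
  assumes Y: "Y \<subseteq> S" and T: "T \<in> PiE (S - Y) (\<lambda>_. labelsets l n - {{l}})"
    and rconv: "\<forall>i j j' j''. (i, j) \<in> S \<and> (i, j'') \<in> S \<and> j \<le> j' \<and> j' \<le> j'' \<longrightarrow> (i, j') \<in> S"
    and cconv: "\<forall>i i' i'' j. (i, j) \<in> S \<and> (i'', j) \<in> S \<and> i \<le> i' \<and> i' \<le> i'' \<longrightarrow> (i', j) \<in> S"
  shows "sv_semistandard S (\<lambda>b. if b \<in> Y then {l} else T b) \<longleftrightarrow> ssyt_first S Y \<and>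
    ({b \<in> S - Y. l \<in> T b} \<subseteq> outer_corners S Y \<and> sv_semistandard (S - Y) (restrict (\<lambda>b. T b - {l}) (S - Y)))"
    (is "sv_semistandard S ?T \<longleftrightarrow> _ \<and> (_ \<and> sv_semistandard _ ?T')")
proof -
  have Tb: "finite (T b)" "T b \<noteq> {}" "T b \<noteq> {l}" "\<forall>x\<in>T b. l \<le> x" if "b \<in> S" "b \<notin> Y" for b
    using PiE_mem[OF T, of b] that finite_labelset[of "T b" l n] by (auto simp: labelsets_def)
  have ge: "\<forall>x\<in>?T b. l \<le> x" if "b \<in> S" for b using Tb that by auto
  have ne: "\<forall>b\<in>S. finite (?T b) \<and> ?T b \<noteq> {}" using Tb by auto
  have ne': "\<forall>b\<in>S - Y. finite (?T' b) \<and> ?T' b \<noteq> {}"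
    using Tb by (auto dest: subset_singletonD)
  show ?thesis
  proof
    assume ss: "sv_semistandard S ?T"
    note row = sv_semistandard_row[OF ne rconv ss] and col = sv_semistandard_col[OF ne cconv ss]
    have left: "(i, j') \<in> Y" if "l \<in> ?T (i, j)" "(i, j) \<in> S" "(i, j') \<in> S" "j' < j" for i j j'
    proof (rule ccontr)
      assume "(i, j') \<notin> Y"
      moreover have "\<forall>x\<in>?T (i, j'). x \<le> l" using row that by blast
      ultimately have "T (i, j') \<subseteq> {l}" using Tb[of "(i, j')"] that by (auto intro: antisym)
      then have "T (i, j') = {} \<or> T (i, j') = {l}" by (rule subset_singletonD)
      then show False using Tb(2,3)[OF that(3) \<open>(i, j') \<notin> Y\<close>] by blast
    qed
    have up: "i \<le> i'" if lb: "l \<in> ?T (i, j)" "(i, j) \<in> S" "(i', j) \<in> S" for i i' j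
    proof (rule ccontr)
      assume "\<not> i \<le> i'"
      moreover obtain z where "z \<in> ?T (i', j)" using bspec[OF ne lb(3)] by blast
      ultimately have "z < l" "l \<le> z" using col[OF lb(3,2) _ _ lb(1)] bspec[OF ge[OF lb(3)]] by simp_all
      then show False by simp
    qed
    have "ssyt_first S Y" unfolding ssyt_first_def
    proof (intro conjI allI impI)
      fix i j j' assume "(i, j) \<in> Y \<and> (i, j') \<in> S \<and> j' < j"
      then show "(i, j') \<in> Y" by (intro left[of i j]) (use Y in auto)
    next
      fix i i' j assume "(i, j) \<in> Y \<and> (i', j) \<in> S"
      then show "i \<le> i'" by (intro up[of i j]) (use Y in auto)
    qed
    moreover have "{b \<in> S - Y. l \<in> T b} \<subseteq> outer_corners S Y"
    proof
      fix b assume b: "b \<in> {b \<in> S - Y. l \<in> T b}"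
      obtain i j where ij: "b = (i, j)" by fastforce
      have "l \<in> ?T (i, j)" "(i, j) \<in> S" using b ij by auto
      then have "(i', j) \<notin> S" if "i' < i" for i' using up[of i j i'] that by (meson leD)
      moreover have "(i, j') \<in> Y" if "(i, j') \<in> S" "j' < j" for j'
        by (rule left[of i j]) (use \<open>l \<in> ?T (i, j)\<close> \<open>(i, j) \<in> S\<close> that in auto)
      ultimately show "b \<in> outer_corners S Y" using b by (simp add: outer_corners_def ij)
    qed
    moreover have "sv_semistandard (S - Y) ?T'"
      unfolding sv_semistandard_iff[OF ne']
    proof (intro conjI allI impI ballI)
      fix i j x y assume "(i, j) \<in> S - Y \<and> (i, j + 1) \<in> S - Y" "x \<in> ?T' (i, j)" "y \<in> ?T' (i, j + 1)"
      then show "x \<le> y" using row[of i j "j + 1" x y] by simp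
    next
      fix i j x y assume "(i, j) \<in> S - Y \<and> (i + 1, j) \<in> S - Y" "x \<in> ?T' (i, j)" "y \<in> ?T' (i + 1, j)"
      then show "x < y" using col[of i j "i + 1" x y] by simp
    qed
    ultimately show "ssyt_first S Y \<and>
      ({b \<in> S - Y. l \<in> T b} \<subseteq> outer_corners S Y \<and> sv_semistandard (S - Y) ?T')" by blast
  next
    assume R: "ssyt_first S Y \<and>
      ({b \<in> S - Y. l \<in> T b} \<subseteq> outer_corners S Y \<and> sv_semistandard (S - Y) ?T')"
    have fA: "(i, j') \<in> Y" if "(i, j) \<in> Y" "(i, j') \<in> S" "j' < j" for i j j'
      using R that unfolding ssyt_first_def by blast
    have fB: "i \<le> i'" if "(i, j) \<in> Y" "(i', j) \<in> S" for i i' j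
      using R that unfolding ssyt_first_def by blast
    have corn: "(i, j) \<in> outer_corners S Y" if "(i, j) \<in> S" "(i, j) \<notin> Y" "l \<in> T (i, j)" for i j
      using R that by auto
    have ss': "sv_semistandard (S - Y) ?T'" using R by blast
    show "sv_semistandard S ?T" unfolding sv_semistandard_iff[OF ne]
    proof (intro conjI allI impI ballI)
      fix i j x y assume S: "(i, j) \<in> S \<and> (i, j + 1) \<in> S" and x: "x \<in> ?T (i, j)" and y: "y \<in> ?T (i, j + 1)"
      show "x \<le> y"
      proof (cases "(i, j) \<in> Y")
        case True
        then show ?thesis using x bspec[OF ge y] S by simp
      next
        case False
        then have n: "(i, j + 1) \<notin> Y" using fA[of i "j + 1" j] S by auto
        then have "l \<notin> T (i, j + 1)" using corn[of i "j + 1"] S False by (auto simp: outer_corners_def)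
        then have y': "y \<in> ?T' (i, j + 1)" "l \<le> y" using y n S ge by auto
        show ?thesis
        proof (cases "x = l")
          case False
          then have "x \<in> ?T' (i, j)" using x S \<open>(i, j) \<notin> Y\<close> by simp
          then show ?thesis using ss' y' S n \<open>(i, j) \<notin> Y\<close> unfolding sv_semistandard_iff[OF ne'] by blast
        qed (use y' in simp)
      qed
    next
      fix i j x y assume S: "(i, j) \<in> S \<and> (i + 1, j) \<in> S" and x: "x \<in> ?T (i, j)" and y: "y \<in> ?T (i + 1, j)"
      have n: "(i + 1, j) \<notin> Y" using fB[of "i + 1" j i] S by auto
      then have "l \<notin> T (i + 1, j)" using corn[of "i + 1" j] S by (auto simp: outer_corners_def)
      then have y': "y \<in> ?T' (i + 1, j)" "l < y" using y n S ge[of "(i + 1, j)"] by (auto simp: le_less)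
      show "x < y"
      proof (cases "x = l")
        case False
        then have "(i, j) \<notin> Y" "x \<in> ?T' (i, j)" using x S by (auto split: if_splits)
        then show ?thesis using ss' y' S n unfolding sv_semistandard_iff[OF ne'] by blast
      qed (use y' in simp)
    qed
  qed
qed

lemma sv_weight_insert:
  fixes x :: "nat \<Rightarrow> 'r::comm_ring_1"
  assumes "L \<in> labelsets (Suc l) n"
  shows "sv_weight x (insert l L) = - x l * sv_weight x L"
proof -
  have L: "finite L" "l \<notin> L" "L \<noteq> {}" using assms finite_labelset[OF assms] by (auto simp: labelsets_def)
  then obtain k where "card L = Suc k" by (cases "card L") auto
  then show ?thesis using L by (simp add: sv_weight_def)
qed

text \<open>Each box of \<open>K\<close> chooses independently whether \<open>l\<close> joins its
  set, and joining multiplies the weight by \<open>- x l\<close>. Summing over the subsets of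
  \<open>K\<close> gives the power of \<open>1 - x l\<close>.\<close>

lemma sv_sum_remove_label:
  fixes x :: "nat \<Rightarrow> 'r::comm_ring_1"
  assumes S: "finite S" and K: "K \<subseteq> S" and l: "l \<le> n"
  shows "tabsum (\<lambda>_ T. {b \<in> S. l \<in> T b} \<subseteq> K \<and> P (restrict (\<lambda>b. T b - {l}) S)) S
      (\<lambda>_. labelsets l n - {{l}}) (sv_weight x)
    = (1 - x l) ^ card K * tabsum (\<lambda>_. P) S (\<lambda>_. labelsets (Suc l) n) (sv_weight x)"
proof -
  define F where "F = {T. T \<in> PiE S (\<lambda>_. labelsets (Suc l) n) \<and> P T}"
  have finF: "finite F"
    by (rule finite_subset[of _ "PiE S (\<lambda>_. labelsets (Suc l) n)"])
      (auto simp: F_def S finite_labelsets intro!: finite_PiE)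
  have finK: "finite K" using S K finite_subset by blast
  have "tabsum (\<lambda>_ T. {b \<in> S. l \<in> T b} \<subseteq> K \<and> P (restrict (\<lambda>b. T b - {l}) S)) S
      (\<lambda>_. labelsets l n - {{l}}) (sv_weight x)
    = (\<Sum>(I, T)\<in>Sigma (Pow K) (\<lambda>_. F). (- x l) ^ card I * (\<Prod>b\<in>S. sv_weight x (T b)))"
    unfolding tabsum_def
  proof (rule sum.reindex_bij_witness[where
        j = "\<lambda>T. ({b \<in> S. l \<in> T b}, restrict (\<lambda>b. T b - {l}) S)" and
        i = "\<lambda>(I, T). restrict (\<lambda>b. if b \<in> I then insert l (T b) else T b) S"])
    fix T assume "T \<in> {T. T \<in> PiE S (\<lambda>_. labelsets l n - {{l}}) \<and>
      {b \<in> S. l \<in> T b} \<subseteq> K \<and> P (restrict (\<lambda>b. T b - {l}) S)}"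
    then have T: "T \<in> PiE S (\<lambda>_. labelsets l n - {{l}})" "{b \<in> S. l \<in> T b} \<subseteq> K"
      "P (restrict (\<lambda>b. T b - {l}) S)" by auto
    let ?I = "{b \<in> S. l \<in> T b}" and ?T = "restrict (\<lambda>b. T b - {l}) S"
    show "(case (?I, ?T) of (I, T) \<Rightarrow> restrict (\<lambda>b. if b \<in> I then insert l (T b) else T b) S) = T"
      using T(1) by (auto simp: fun_eq_iff PiE_def extensional_def)
    have T': "?T b \<in> labelsets (Suc l) n" if "b \<in> S" for b
    proof -
      have "T b \<in> labelsets l n - {{l}}" using T(1) that by (rule PiE_mem)
      then have "T b \<noteq> {}" "T b \<noteq> {l}" "T b \<subseteq> {l..n}" by (auto simp: labelsets_def)
      then have "T b - {l} \<noteq> {}" by (auto dest: subset_singletonD)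
      moreover have "k \<in> {Suc l..n}" if "k \<in> T b - {l}" for k
        using subsetD[OF \<open>T b \<subseteq> {l..n}\<close>, of k] that by simp
      then have "T b - {l} \<subseteq> {Suc l..n}" by blast
      ultimately have "T b - {l} \<noteq> {}" "T b - {l} \<subseteq> {Suc l..n}" by blast+
      then show ?thesis using that by (simp add: labelsets_def)
    qed
    then have "?T \<in> F" using T(3) by (auto simp: F_def)
    then show "(?I, ?T) \<in> Sigma (Pow K) (\<lambda>_. F)" using T(2) by blast
    have "(\<Prod>b\<in>S. sv_weight x (T b)) = (\<Prod>b\<in>S. (if b \<in> ?I then - x l else 1) * sv_weight x (?T b))"
    proof (rule prod.cong[OF refl])
      fix b assume b: "b \<in> S"
      show "sv_weight x (T b) = (if b \<in> ?I then - x l else 1) * sv_weight x (?T b)"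
        using sv_weight_insert[OF T'[OF b], of x] b by (cases "l \<in> T b") (simp_all add: insert_absorb)
    qed
    also have "\<dots> = (- x l) ^ card ?I * (\<Prod>b\<in>S. sv_weight x (?T b))"
      using S by (simp add: prod.distrib prod.If_cases Int_def)
    finally show "(case (?I, ?T) of (I, T) \<Rightarrow> (- x l) ^ card I * (\<Prod>b\<in>S. sv_weight x (T b)))
        = (\<Prod>b\<in>S. sv_weight x (T b))" by simp
  next
    fix IT assume "IT \<in> Sigma (Pow K) (\<lambda>_. F)"
    then obtain I T where IT: "IT = (I, T)" "I \<subseteq> K" "T \<in> PiE S (\<lambda>_. labelsets (Suc l) n)" "P T"
      by (auto simp: F_def)
    have T: "T b \<noteq> {}" "T b \<subseteq> {Suc l..n}" "l \<notin> T b" if "b \<in> S" for b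
      using PiE_mem[OF IT(3) that] by (auto simp: labelsets_def)
    let ?T = "restrict (\<lambda>b. if b \<in> I then insert l (T b) else T b) S"
    have i: "(case IT of (I, T) \<Rightarrow> restrict (\<lambda>b. if b \<in> I then insert l (T b) else T b) S) = ?T"
      by (simp add: IT)
    have 1: "{b \<in> S. l \<in> ?T b} = I" using T(3) IT(2) K by auto
    have 2: "restrict (\<lambda>b. ?T b - {l}) S = T"
    proof
      fix b show "restrict (\<lambda>b. ?T b - {l}) S b = T b"
      proof (cases "b \<in> S")
        case True
        then show ?thesis using T(3)[OF True] by simp
      next
        case False
        then show ?thesis using PiE_arb[OF IT(3) False] by simp
      qed
    qed
    show "({b \<in> S. l \<in> (case IT of (I, T) \<Rightarrow> restrict (\<lambda>b. if b \<in> I then insert l (T b) else T b) S) b},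
        restrict (\<lambda>b. (case IT of (I, T) \<Rightarrow> restrict (\<lambda>b. if b \<in> I then insert l (T b) else T b) S) b - {l}) S) = IT"
      unfolding i 1 2 by (simp add: IT)
    have "?T b \<in> labelsets l n - {{l}}" if "b \<in> S" for b
    proof -
      have "{Suc l..n} \<subseteq> {l..n}" "l \<in> {l..n}" using l by auto
      then have "?T b \<subseteq> {l..n}" using T(2)[OF that] that by auto
      moreover have "?T b \<noteq> {}" "?T b \<noteq> {l}" using T(1,3)[OF that] that by auto
      ultimately show ?thesis by (simp add: labelsets_def)
    qed
    then show "(case IT of (I, T) \<Rightarrow> restrict (\<lambda>b. if b \<in> I then insert l (T b) else T b) S)
        \<in> {T. T \<in> PiE S (\<lambda>_. labelsets l n - {{l}}) \<and>
      {b \<in> S. l \<in> T b} \<subseteq> K \<and> P (restrict (\<lambda>b. T b - {l}) S)}"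
      unfolding i mem_Collect_eq 1 2 using IT by auto
  qed
  also have "\<dots> = (\<Sum>I\<in>Pow K. (- x l) ^ card I) * (\<Sum>T\<in>F. \<Prod>b\<in>S. sv_weight x (T b))"
    using finF finK by (simp add: sum.Sigma[symmetric] sum_product)
  also have "(\<Sum>I\<in>Pow K. (- x l) ^ card I) = (1 - x l) ^ card K"
    using prod_add[OF finK, of "\<lambda>_. - x l" "\<lambda>_. 1"] by simp
  finally show ?thesis unfolding tabsum_def F_def .
qed

section \<open>Set-valued tableau sums as iterated operators\<close>

context columns begin

lemma skew_row_convex: "(i, j) \<in> skew q p \<Longrightarrow> (i, j'') \<in> skew q p \<Longrightarrow> j \<le> j' \<Longrightarrow> j' \<le> j'' \<Longrightarrow> (i, j') \<in> skew q p"
  by (auto simp: skew_def)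

lemma skew_col_convex:
  assumes "p \<in> shapes" "q \<in> shapes" "(i, j) \<in> skew q p" "(i'', j) \<in> skew q p" "i \<le> i'" "i' \<le> i''"
  shows "(i', j) \<in> skew q p"
  using assms shapes_antimono[OF assms(1) assms(5)] shapes_antimono[OF assms(2) assms(6)]
  by (auto simp: skew_def)

text \<open>An outer corner is the first box beyond \<open>c\<close> in its row; nothing lies above
  it exactly if the previous row of \<open>p\<close> covers its column. The cap \<open>q\<close>
  expresses that the box belongs to the diagram.\<close>

lemma card_outer_corners:
  assumes p: "p \<in> shapes" and q: "q \<in> shapes" and le: "\<And>i. p i \<le> q i"
    and c: "hstrip p c" "\<And>i. c i \<le> q i"
  shows "card (outer_corners (skew q p) (skew c p)) = card (corners q p c)"
proof -
  have pc: "p i \<le> c i" "c (Suc i) \<le> p i" for i using c by (auto simp: hstrip_def)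
  have "outer_corners (skew q p) (skew c p) = (\<lambda>i. (Suc i, off + c (Suc i) + 1)) ` corners q p c"
  proof
    show "outer_corners (skew q p) (skew c p) \<subseteq> (\<lambda>i. (Suc i, off + c (Suc i) + 1)) ` corners q p c"
    proof
      fix b assume b: "b \<in> outer_corners (skew q p) (skew c p)"
      obtain i j where ij: "b = (i, j)" by fastforce
      have j1: "off + c i < j" "j \<le> off + q i" using b pc[of i] by (auto simp: outer_corners_def ij skew_def)
      have "j = off + c i + 1"
      proof (rule ccontr)
        assume "j \<noteq> off + c i + 1"
        then have "(i, off + c i + 1) \<in> skew q p" "off + c i + 1 < j" "(i, off + c i + 1) \<notin> skew c p"
          using j1 pc(1)[of i] by (auto simp: skew_def)
        then show False using b by (auto simp: outer_corners_def ij)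
      qed
      moreover obtain k where k: "i = Suc k"
        using j1 shapes_0[OF p] shapes_0[OF q] pc(1)[of 0] by (cases i) auto
      moreover have "c i < p k"
      proof -
        have "(k, j) \<notin> skew q p" using b by (auto simp: outer_corners_def ij k)
        moreover have "q i \<le> q k" using shapes_antimono[OF q, of k i] k by simp
        ultimately show ?thesis using j1 by (auto simp: skew_def)
      qed
      ultimately show "b \<in> (\<lambda>i. (Suc i, off + c (Suc i) + 1)) ` corners q p c"
        using j1 by (auto simp: corners_def ij)
    qed
    show "(\<lambda>i. (Suc i, off + c (Suc i) + 1)) ` corners q p c \<subseteq> outer_corners (skew q p) (skew c p)"
    proof clarify
      fix i assume "i \<in> corners q p c"
      then have i: "c (Suc i) < p i" "c (Suc i) < q (Suc i)" by (auto simp: corners_def)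
      have "(i', off + c (Suc i) + 1) \<notin> skew q p" if "i' < Suc i" for i'
        using i shapes_antimono[OF p, of i' i] that by (auto simp: skew_def)
      then show "(Suc i, off + c (Suc i) + 1) \<in> outer_corners (skew q p) (skew c p)"
        using i pc(1)[of "Suc i"] by (auto simp: outer_corners_def skew_def)
    qed
  qed
  moreover have "inj_on (\<lambda>i. (Suc i, off + c (Suc i) + 1)) (corners q p c)" by (rule inj_onI) simp
  ultimately show ?thesis by (simp add: card_image)
qed

lemma sv_semistandard_sum_first:
  fixes x :: "nat \<Rightarrow> 'r::comm_ring_1"
  assumes p: "p \<in> shapes" and q: "q \<in> shapes" and le: "\<And>i. p i \<le> q i" and l: "l \<le> n"
  shows "tabsum sv_semistandard (skew q p) (\<lambda>_. labelsets l n) (sv_weight x) =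
    (\<Sum>c | hstrip p c \<and> (\<forall>i. c i \<le> q i). vweight q (x l) p c *
      tabsum sv_semistandard (skew q c) (\<lambda>_. labelsets (Suc l) n) (sv_weight x))"
proof -
  let ?S = "skew q p"
  let ?Q = "\<lambda>Y T. {b \<in> ?S - Y. l \<in> T b} \<subseteq> outer_corners ?S Y \<and>
      sv_semistandard (?S - Y) (restrict (\<lambda>b. T b - {l}) (?S - Y))"
  have "tabsum sv_semistandard ?S (\<lambda>_. labelsets l n) (sv_weight x) =
    (\<Sum>c | hstrip p c \<and> (\<forall>i. c i \<le> q i). (\<Prod>b\<in>skew c p. sv_weight x {l}) *
      tabsum (\<lambda>_. ?Q (skew c p)) (?S - skew c p) (\<lambda>_. labelsets l n - {{l}}) (sv_weight x))"
  proof (rule tabsum_split_gen[where e = "\<lambda>_. {l}" and g = "\<lambda>c. skew c p" and good = "ssyt_first ?S"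
        and Q' = ?Q])
    show "finite ?S" by (rule finite_skew[OF q])
    show "bij_betw (\<lambda>c. skew c p) {c. hstrip p c \<and> (\<forall>i. c i \<le> q i)}
        {Y. Y \<subseteq> ?S \<and> (\<forall>b\<in>Y. {l} \<in> labelsets l n) \<and> ssyt_first ?S Y}"
      using bij_first_label[OF p q le] l by (simp add: ssyt_first_def labelsets_def)
    fix Y T assume "Y \<subseteq> ?S" "T \<in> PiE (?S - Y) (\<lambda>b. labelsets l n - {{l}})"
    then show "sv_semistandard ?S (\<lambda>b. if b \<in> Y then {l} else T b) \<longleftrightarrow> ssyt_first ?S Y \<and> ?Q Y T"
      by (rule sv_semistandard_split_first) (use skew_row_convex skew_col_convex[OF p q] in blast)+
  qed (rule finite_labelsets)
  also have "\<dots> = (\<Sum>c | hstrip p c \<and> (\<forall>i. c i \<le> q i). vweight q (x l) p c *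
      tabsum sv_semistandard (skew q c) (\<lambda>_. labelsets (Suc l) n) (sv_weight x))"
  proof (rule sum.cong[OF refl])
    fix c assume "c \<in> {c. hstrip p c \<and> (\<forall>i. c i \<le> q i)}"
    then have c: "hstrip p c" "\<And>i. c i \<le> q i" by auto
    have S': "?S - skew c p = skew q c" by (rule skew_diff_inner) (use c in \<open>auto simp: hstrip_def\<close>)
    have K: "outer_corners ?S (skew c p) \<subseteq> skew q c" using S' by (auto simp: outer_corners_def)
    have "tabsum (\<lambda>_. ?Q (skew c p)) (?S - skew c p) (\<lambda>_. labelsets l n - {{l}}) (sv_weight x)
      = (1 - x l) ^ card (corners q p c) *
        tabsum (\<lambda>_. sv_semistandard (skew q c)) (skew q c) (\<lambda>_. labelsets (Suc l) n) (sv_weight x)"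
      unfolding S' sv_sum_remove_label[OF finite_skew[OF q] K l] card_outer_corners[OF p q le c] ..
    moreover have "sv_weight x {l} = x l" by (simp add: sv_weight_def)
    ultimately show "(\<Prod>b\<in>skew c p. sv_weight x {l}) *
      tabsum (\<lambda>_. ?Q (skew c p)) (?S - skew c p) (\<lambda>_. labelsets l n - {{l}}) (sv_weight x) =
      vweight q (x l) p c * tabsum sv_semistandard (skew q c) (\<lambda>_. labelsets (Suc l) n) (sv_weight x)"
      by (simp add: vweight_def mult.assoc tabsum_def)
  qed
  finally show ?thesis .
qed

lemma foldr_Vop_sv_semistandard:
  fixes x :: "nat \<Rightarrow> 'r::comm_ring_1"
  assumes q: "q \<in> shapes"
  shows "p \<in> shapes \<Longrightarrow> (\<And>i. p i \<le> q i) \<Longrightarrow>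
    foldr (Vop q) (map x [l..<Suc n]) (delta q) p =
    tabsum sv_semistandard (skew q p) (\<lambda>_. labelsets l n) (sv_weight x)"
proof (induction "Suc n - l" arbitrary: l p)
  case 0
  then have "map x [l..<Suc n] = []" by simp
  moreover have "tabsum sv_semistandard (skew q p) (\<lambda>_. labelsets l n) (sv_weight x) = of_bool (q = p)"
    by (rule tabsum_no_labels) (use 0 in \<open>auto simp: labelsets_def sv_semistandard_def\<close>)
  ultimately show ?case by (auto simp: delta_def simp del: upt_Suc)
next
  case (Suc k)
  then have l: "l \<le> n" "map x [l..<Suc n] = x l # map x [Suc l..<Suc n]"
    by (simp_all add: upt_conv_Cons del: upt_Suc)
  have "foldr (Vop q) (map x [l..<Suc n]) (delta q) p
      = (\<Sum>c | hstrip p c. vweight q (x l) p c * foldr (Vop q) (map x [Suc l..<Suc n]) (delta q) c)"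
    unfolding l(2) foldr_Vop_Cons ..
  also have "\<dots> = (\<Sum>c | hstrip p c \<and> (\<forall>i. c i \<le> q i). vweight q (x l) p c *
      foldr (Vop q) (map x [Suc l..<Suc n]) (delta q) c)"
  proof (rule sum.mono_neutral_right[OF finite_hstrip])
    have "foldr (Vop q) (map x [Suc l..<Suc n]) (delta q) c = 0"
      if "hstrip p c" "\<not> (\<forall>i. c i \<le> q i)" for c
      by (rule foldr_Vop_delta_zero) (use that in \<open>auto simp: hstrip_def\<close>)
    then show "\<forall>c\<in>{c. hstrip p c} - {c. hstrip p c \<and> (\<forall>i. c i \<le> q i)}.
        vweight q (x l) p c * foldr (Vop q) (map x [Suc l..<Suc n]) (delta q) c = 0"
      by (simp del: upt_Suc)
  qed auto
  also have "\<dots> = (\<Sum>c | hstrip p c \<and> (\<forall>i. c i \<le> q i). vweight q (x l) p c *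
      tabsum sv_semistandard (skew q c) (\<lambda>_. labelsets (Suc l) n) (sv_weight x))"
    by (rule sum.cong[OF refl]) (use Suc in \<open>auto simp: hstrip_def simp del: upt_Suc\<close>)
  also have "\<dots> = tabsum sv_semistandard (skew q p) (\<lambda>_. labelsets l n) (sv_weight x)"
    by (rule sv_semistandard_sum_first[symmetric]) (use Suc q l in auto)
  finally show ?case .
qed

end

section \<open>Skew shapes with prescribed columns\<close>

context columns begin

text \<open>The theorem in \<open>n\<close> variables. The vector \<open>\<beta>\<close> is the
  preimage of \<open>delta q\<close> under the product of the \<open>Dop k\<close>, so the Schur
  operators may act on that product applied to \<open>\<beta>\<close> and commute past it into
  Grothendieck operators. As \<open>p\<close> has at most \<open>h\<close> rows and each label adds
  at most one, \<open>K = h + n\<close> bounds everything that occurs.\<close>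

lemma schur_grothendieck_identity:
  fixes x :: "nat \<Rightarrow> 'r::comm_ring_1"
  assumes p: "p \<in> shapes_upto h" and q: "q \<in> shapes" and le: "\<And>i. p i \<le> q i"
  shows "tabsum semistandard (skew q p) (\<lambda>_. {1..n}) x =
    (\<Sum>p' | p' \<in> shapes \<and> (\<forall>i. p' i \<le> p i). \<Sum>\<kappa> | \<kappa> \<in> shapes_upto (h + n) \<and> (\<forall>i. q i \<le> \<kappa> i).
      tabsum reverse_row_strict (skew p p') (\<lambda>b. {1..fst b}) (\<lambda>_. - 1) *
      tabsum semistandard (skew \<kappa> q) (\<lambda>b. {1..<fst b}) (\<lambda>_. 1) *
      tabsum sv_semistandard (skew \<kappa> p') (\<lambda>_. labelsets 1 n) (sv_weight x))"
proof -
  define K where "K = h + n"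
  define xs where "xs = map x [1..<Suc n]"
  define \<beta> where "\<beta> = fold Hop [1..<Suc K] (delta q :: _ \<Rightarrow> 'r)"
  define F where "F = {\<kappa>. \<kappa> \<in> shapes_upto K \<and> (\<forall>i. q i \<le> \<kappa> i)}"
  let ?A = "\<lambda>p'. tabsum reverse_row_strict (skew p p') (\<lambda>b. {1..fst b}) (\<lambda>_. - 1) :: 'r"
  let ?B = "\<lambda>\<kappa>. tabsum semistandard (skew \<kappa> q) (\<lambda>b. {1..<fst b}) (\<lambda>_. 1) :: 'r"
  let ?G = "\<lambda>p' \<kappa>. tabsum sv_semistandard (skew \<kappa> p') (\<lambda>_. labelsets 1 n) (sv_weight x)"
  have len: "length xs = n" by (simp add: xs_def)
  have ps: "p \<in> shapes" using p by (rule shapes_upto_shapes)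
  have pK: "p \<in> shapes_upto K" using p shapes_upto_mono[of h K] by (auto simp: K_def)
  have finF: "finite F" unfolding F_def by (rule finite_subset[OF _ finite_shapes_upto[of K]]) auto
  \<comment> \<open>\<open>delta \<kappa> (min d \<kappa>)\<close> indicates
    \<open>\<kappa> \<le> d\<close>. Here \<open>\<kappa>\<close> is the shape left after deleting
    from \<open>d\<close> the boxes that hold their own row index, so the inner labels are strictly
    below their rows. Written with \<open>min\<close>, the indicator has the form that truncation
    handles.\<close>
  have beta: "\<beta> d = (\<Sum>\<kappa>\<in>F. ?B \<kappa> * delta \<kappa> (\<lambda>i. min (d i) (\<kappa> i)))" if d: "d \<in> shapes_upto K" for d
  proof -
    have ds: "d \<in> shapes" using d by (rule shapes_upto_shapes)
    have eq: "(\<lambda>i. min (d i) (\<kappa> i)) = \<kappa> \<longleftrightarrow> (\<forall>i. \<kappa> i \<le> d i)" for \<kappa>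
      by (simp add: fun_eq_iff min.absorb_iff2[symmetric])
    have "(\<Sum>\<kappa>\<in>F. ?B \<kappa> * delta \<kappa> (\<lambda>i. min (d i) (\<kappa> i))) = (\<Sum>\<kappa>\<in>F. if \<forall>i. \<kappa> i \<le> d i then ?B \<kappa> else 0)"
      unfolding delta_def eq by (rule sum.cong[OF refl]) simp
    also have "\<dots> = (\<Sum>\<kappa>\<in>{\<kappa>\<in>F. \<forall>i. \<kappa> i \<le> d i}. ?B \<kappa>)"
      by (rule sum.inter_filter[OF finF, symmetric])
    also have "{\<kappa>\<in>F. \<forall>i. \<kappa> i \<le> d i} = {\<kappa>. \<kappa> \<in> shapes \<and> (\<forall>i. q i \<le> \<kappa> i) \<and> (\<forall>i. \<kappa> i \<le> d i)}"
      using le_upto[OF _ _ d] by (auto simp: F_def intro: shapes_upto_shapes)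
    finally have R: "(\<Sum>\<kappa>\<in>F. ?B \<kappa> * delta \<kappa> (\<lambda>i. min (d i) (\<kappa> i)))
        = (\<Sum>\<kappa> | \<kappa> \<in> shapes \<and> (\<forall>i. q i \<le> \<kappa> i) \<and> (\<forall>i. \<kappa> i \<le> d i). ?B \<kappa>)" .
    show ?thesis
    proof (cases "\<forall>i. q i \<le> d i")
      case True
      have "min K (fst b) = fst b" if "b \<in> skew d q" for b
      proof -
        have "d (fst b) \<noteq> 0" using that by (auto simp: skew_def)
        then have "fst b \<le> K" using d unfolding shapes_upto_def by (metis (mono_tags, lifting) mem_Collect_eq not_le)
        then show ?thesis by (rule min_absorb2)
      qed
      then have tc: "tabsum semistandard (skew d q) (\<lambda>b. {1..min K (fst b)}) (\<lambda>_. 1 :: 'r)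
          = tabsum semistandard (skew d q) (\<lambda>b. {1..fst b}) (\<lambda>_. 1)"
        by (intro tabsum_cong) simp
      show ?thesis
        unfolding R \<beta>_def fold_Hop_semistandard[OF q ds] if_P[OF True] tc
        by (rule semistandard_sum_diagonal[OF q ds]) (use True in blast)
    next
      case False
      then have "{\<kappa>. \<kappa> \<in> shapes \<and> (\<forall>i. q i \<le> \<kappa> i) \<and> (\<forall>i. \<kappa> i \<le> d i)} = {}"
        by (auto intro: le_trans)
      then show ?thesis
        unfolding R \<beta>_def fold_Hop_semistandard[OF q ds] using False by (simp only: if_False sum.empty)
    qed
  qed
  \<comment> \<open>For each \<open>\<kappa>\<close>, truncation turns the operator with all corners
    into the one capped by \<open>\<kappa>\<close>, whose iterate is the set-valued sum of the
    diagram between \<open>p'\<close> and \<open>\<kappa>\<close>.\<close>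
  have G: "foldr (Vop (rect K)) xs \<beta> p' = (\<Sum>\<kappa>\<in>F. ?B \<kappa> * ?G p' \<kappa>)"
    if p': "p' \<in> shapes" "\<forall>i. p' i \<le> p i" for p'
  proof -
    have p'h: "p' \<in> shapes_upto h" using le_upto[OF p'(1) _ p] p'(2) by blast
    have "foldr (Vop (rect K)) xs \<beta> p'
        = foldr (Vop (rect K)) xs (\<lambda>d. \<Sum>\<kappa>\<in>F. ?B \<kappa> * delta \<kappa> (\<lambda>i. min (d i) (\<kappa> i))) p'"
      by (rule foldr_Vop_cong[OF beta p'h]) (simp add: len K_def)
    also have "\<dots> = (\<Sum>\<kappa>\<in>F. ?B \<kappa> * foldr (Vop (rect K)) xs (\<lambda>d. delta \<kappa> (\<lambda>i. min (d i) (\<kappa> i))) p')"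
      by (rule foldr_Vop_sum[OF finF])
    also have "\<dots> = (\<Sum>\<kappa>\<in>F. ?B \<kappa> * ?G p' \<kappa>)"
    proof (rule sum.cong[OF refl])
      fix \<kappa> assume "\<kappa> \<in> F"
      then have \<kappa>: "\<kappa> \<in> shapes" "\<And>i. q i \<le> \<kappa> i" by (auto simp: F_def intro: shapes_upto_shapes)
      have pk: "p' i \<le> \<kappa> i" for i using p'(2) le[of i] \<kappa>(2)[of i] by (meson le_trans)
      have "foldr (Vop (rect K)) xs (\<lambda>d. delta \<kappa> (\<lambda>i. min (d i) (\<kappa> i))) p'
          = foldr (Vop \<kappa>) xs (delta \<kappa>) (\<lambda>i. min (p' i) (\<kappa> i))"
        by (rule foldr_Vop_truncate[OF \<kappa>(1) _ p'h]) (auto simp: delta_def len K_def)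
      also have "(\<lambda>i. min (p' i) (\<kappa> i)) = p'" using pk by (simp add: min_absorb1)
      also have "foldr (Vop \<kappa>) xs (delta \<kappa>) p' = ?G p' \<kappa>"
        unfolding xs_def by (rule foldr_Vop_sv_semistandard[OF \<kappa>(1) p'(1) pk])
      finally show "?B \<kappa> * foldr (Vop (rect K)) xs (\<lambda>d. delta \<kappa> (\<lambda>i. min (d i) (\<kappa> i))) p' = ?B \<kappa> * ?G p' \<kappa>"
        by simp
    qed
    finally show ?thesis .
  qed
  have "tabsum semistandard (skew q p) (\<lambda>_. {1..n}) x = foldr (Vop (rect 0)) xs (delta q) p"
    unfolding xs_def by (rule foldr_Vop_semistandard[OF q ps le, symmetric])
  also have "\<dots> = foldr (Vop (rect 0)) xs (foldr Dop [1..<Suc K] \<beta>) p"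
    unfolding \<beta>_def by (rule foldr_Vop_cong[OF foldr_Dop_Hop[symmetric] p]) (rule shapes_upto_shapes)
  also have "\<dots> = foldr Dop [1..<Suc K] (foldr (Vop (rect K)) xs \<beta>) p"
    by (simp only: foldr_Dop_foldr_Vop)
  also have "\<dots> = (\<Sum>p' | p' \<in> shapes \<and> (\<forall>i. p' i \<le> p i). ?A p' * foldr (Vop (rect K)) xs \<beta> p')"
    by (rule foldr_Dop_reverse_row_strict[OF pK])
  also have "\<dots> = (\<Sum>p' | p' \<in> shapes \<and> (\<forall>i. p' i \<le> p i). \<Sum>\<kappa>\<in>F. ?A p' * ?B \<kappa> * ?G p' \<kappa>)"
    by (rule sum.cong[OF refl]) (simp add: G sum_distrib_left mult.assoc)
  finally show ?thesis by (simp only: F_def K_def)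
qed

text \<open>If \<open>q\<close> has more than \<open>h + n\<close> rows, the first column meets more
  than \<open>n\<close> rows below row \<open>h\<close>, too many for strictly increasing labels up
  to \<open>n\<close>. The proof reads this off from the growth of rows under the operators.\<close>

lemma sv_sum_zero:
  assumes "p \<in> shapes_upto h" "q \<in> shapes" "q \<notin> shapes_upto (h + n)" "\<And>i. p i \<le> q i"
  shows "tabsum sv_semistandard (skew q p) (\<lambda>_. labelsets 1 n) (sv_weight x) = 0"
proof -
  have "foldr (Vop q) (map x [1..<Suc n]) (delta q) p = 0"
    by (rule foldr_Vop_zero[OF _ assms(1)]) (use assms(3) in \<open>auto simp: delta_def simp del: upt_Suc\<close>)
  then show ?thesis
    using foldr_Vop_sv_semistandard[OF assms(2) shapes_upto_shapes[OF assms(1)] assms(4), of x 1 n] by simp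
qed

section \<open>Boundary functions of a skew shape\<close>

definition upper :: "box set \<Rightarrow> nat \<Rightarrow> nat" where
  "upper \<mu> i = card {j \<in> {off<..off + width}. \<forall>i'\<le>i. (i', j) \<notin> \<mu>}"

text \<open>Both boundaries count columns instead of reading off row lengths, so they are also
  meaningful in rows that contain no box.\<close>

definition lower :: "box set \<Rightarrow> nat \<Rightarrow> nat" where
  "lower \<mu> i = card {j \<in> {off<..off + width}. \<exists>i'\<ge>i. (i', j) \<in> \<mu>}"

context
  fixes \<mu> :: "box set"
  assumes skew: "skew_shape \<mu>" and cols: "snd ` \<mu> = {off<..off + width}"
begin

lemma shape_interval:
  "(i, j) \<in> \<mu> \<Longrightarrow> (i'', j'') \<in> \<mu> \<Longrightarrow> i \<le> i' \<Longrightarrow> i' \<le> i'' \<Longrightarrow> j \<le> j' \<Longrightarrow> j' \<le> j'' \<Longrightarrow> (i', j') \<in> \<mu>"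
  using skew unfolding skew_shape_def box_le_def by fastforce

lemma column_box: "j \<in> {off<..off + width} \<Longrightarrow> \<exists>i. (i, j) \<in> \<mu>"
  using cols by (metis imageE prod.collapse)

text \<open>If a column further left had a box in a row \<open>i' \<le> i\<close>, interval closure
  with a lower box of column \<open>j\<close> would put \<open>(i', j)\<close> into the shape. So
  the columns lying wholly below row \<open>i\<close> come first.\<close>

lemma upper_set: "{j \<in> {off<..off + width}. \<forall>i'\<le>i. (i', j) \<notin> \<mu>} = {off<..off + upper \<mu> i}"
  unfolding upper_def
proof (rule initial_segment[of _ _ "off + width"])
  fix j j' assume j: "j \<in> {j \<in> {off<..off + width}. \<forall>i'\<le>i. (i', j) \<notin> \<mu>}" "off < j'" "j' < j"
  obtain k where k: "(k, j) \<in> \<mu>" using column_box j by blast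
  then have "i < k" using j by (auto simp: not_le[symmetric])
  then have "(i', j') \<notin> \<mu>" if "i' \<le> i" for i'
    using shape_interval[of i' j' k j i' j] j k that by auto
  then show "j' \<in> {j \<in> {off<..off + width}. \<forall>i'\<le>i. (i', j) \<notin> \<mu>}" using j by auto
qed auto

text \<open>If the column further left has a box above row \<open>i\<close>, interval closure with
  the box \<open>(i', j)\<close> carries row \<open>i'\<close> over to that column.\<close>

lemma lower_set: "{j \<in> {off<..off + width}. \<exists>i'\<ge>i. (i', j) \<in> \<mu>} = {off<..off + lower \<mu> i}"
  unfolding lower_def
proof (rule initial_segment[of _ _ "off + width"])
  fix j j' assume j: "j \<in> {j \<in> {off<..off + width}. \<exists>i'\<ge>i. (i', j) \<in> \<mu>}" "off < j'" "j' < j"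
  then obtain i' where i': "i \<le> i'" "(i', j) \<in> \<mu>" by auto
  have j': "j' \<in> {off<..off + width}" using j by auto
  then obtain k where k: "(k, j') \<in> \<mu>" using column_box by blast
  have "\<exists>i'\<ge>i. (i', j') \<in> \<mu>"
  proof (cases "i \<le> k")
    case False
    then have "(i', j') \<in> \<mu>" using shape_interval[of k j' i' j i' j'] k i' j by auto
    then show ?thesis using i' by blast
  qed (use k in blast)
  then show "j' \<in> {j \<in> {off<..off + width}. \<exists>i'\<ge>i. (i', j) \<in> \<mu>}" using j' by blast
qed auto

lemma rows_bounded: "\<exists>N. \<forall>(i, j)\<in>\<mu>. 1 \<le> i \<and> i \<le> N"
proof -
  have "finite (fst ` \<mu>)" using skew by (simp add: skew_shape_def)
  then obtain N where "\<forall>i\<in>fst ` \<mu>. i \<le> N" using finite_nat_set_iff_bounded_le by blast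
  then show ?thesis using skew by (force simp: skew_shape_def)
qed

lemma upper_shapes: "upper \<mu> \<in> shapes"
proof -
  obtain N where N: "\<forall>(i, j)\<in>\<mu>. 1 \<le> i \<and> i \<le> N" using rows_bounded by blast
  show ?thesis
  proof (rule shapesI(2)[of _ N])
    have "{j \<in> {off<..off + width}. \<forall>i'\<le>0. (i', j) \<notin> \<mu>} = {off<..off + width}" using N by fastforce
    then show "upper \<mu> 0 = width" by (simp add: upper_def)
    show "upper \<mu> (Suc i) \<le> upper \<mu> i" for i
      unfolding upper_def by (rule card_mono) auto
    show "upper \<mu> i = 0" if "N < i" for i
    proof -
      have "\<exists>i'\<le>i. (i', j) \<in> \<mu>" if "j \<in> {off<..off + width}" for j
        using column_box[OF that] N \<open>N < i\<close> by (metis (no_types, lifting) case_prodD le_less_trans less_imp_le)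
      then have "{j \<in> {off<..off + width}. \<forall>i'\<le>i. (i', j) \<notin> \<mu>} = {}" by blast
      then show ?thesis unfolding upper_def by simp
    qed
  qed
qed

lemma lower_shapes: "lower \<mu> \<in> shapes"
proof -
  obtain N where N: "\<forall>(i, j)\<in>\<mu>. 1 \<le> i \<and> i \<le> N" using rows_bounded by blast
  show ?thesis
  proof (rule shapesI(2)[of _ N])
    have "{j \<in> {off<..off + width}. \<exists>i'\<ge>0. (i', j) \<in> \<mu>} = {off<..off + width}"
      using column_box by blast
    then show "lower \<mu> 0 = width" by (simp add: lower_def)
    show "lower \<mu> (Suc i) \<le> lower \<mu> i" for i
      unfolding lower_def by (rule card_mono) (auto dest: Suc_leD)
    show "lower \<mu> i = 0" if "N < i" for i
    proof -
      have "{j \<in> {off<..off + width}. \<exists>i'\<ge>i. (i', j) \<in> \<mu>} = {}" using N that by fastforce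
      then show ?thesis unfolding lower_def by simp
    qed
  qed
qed

lemma upper_le_lower: "upper \<mu> i \<le> lower \<mu> i"
  unfolding upper_def lower_def
proof (rule card_mono)
  show "{j \<in> {off<..off + width}. \<forall>i'\<le>i. (i', j) \<notin> \<mu>} \<subseteq> {j \<in> {off<..off + width}. \<exists>i'\<ge>i. (i', j) \<in> \<mu>}"
    using column_box by (auto) (metis greaterThanAtMost_iff nat_le_linear)
qed auto

lemma skew_lower_upper: "skew (lower \<mu>) (upper \<mu>) = \<mu>"
proof (rule set_eqI)
  fix b :: box
  obtain i j where b: "b = (i, j)" by fastforce
  have "(i, j) \<in> skew (lower \<mu>) (upper \<mu>) \<longleftrightarrow>
      j \<in> {off<..off + width} \<and> j \<notin> {off<..off + upper \<mu> i} \<and> j \<in> {off<..off + lower \<mu> i}"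
    using shapes_le_width[OF lower_shapes, of i] by (auto simp: skew_def)
  also have "\<dots> \<longleftrightarrow> j \<in> {off<..off + width} \<and> (\<exists>i'\<le>i. (i', j) \<in> \<mu>) \<and> (\<exists>i'\<ge>i. (i', j) \<in> \<mu>)"
    unfolding upper_set[symmetric] lower_set[symmetric] by auto
  also have "\<dots> \<longleftrightarrow> (i, j) \<in> \<mu>"
  proof
    assume "(i, j) \<in> \<mu>"
    moreover from this have "j \<in> {off<..off + width}" unfolding cols[symmetric] by force
    ultimately show "j \<in> {off<..off + width} \<and> (\<exists>i'\<le>i. (i', j) \<in> \<mu>) \<and> (\<exists>i'\<ge>i. (i', j) \<in> \<mu>)" by blast
  qed (use shape_interval[of _ j _ j i j] in auto)
  finally show "b \<in> skew (lower \<mu>) (upper \<mu>) \<longleftrightarrow> b \<in> \<mu>" by (simp add: b)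
qed

end

lemma upper_mono: "\<sigma> \<subseteq> \<mu> \<Longrightarrow> upper \<mu> i \<le> upper \<sigma> i"
  unfolding upper_def by (rule card_mono) auto

lemma lower_mono: "\<sigma> \<subseteq> \<mu> \<Longrightarrow> lower \<sigma> i \<le> lower \<mu> i"
  unfolding lower_def by (rule card_mono) auto

context
  fixes p q p' q' :: "nat \<Rightarrow> nat"
  assumes shapes: "p \<in> shapes" "q \<in> shapes" "p' \<in> shapes" "q' \<in> shapes"
    and le: "\<And>i. p' i \<le> p i" "\<And>i. p i \<le> q i" "\<And>i. q i \<le> q' i"
    and cols: "snd ` skew q p = {off<..off + width}"
begin

lemma skew_column: "j \<in> {off<..off + width} \<Longrightarrow> \<exists>s. off + p s < j \<and> j \<le> off + q s"
  using cols by (force simp: skew_def image_iff)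

text \<open>The boundary can be recovered because the inner diagram meets every column. A column to
  the right of \<open>p' i\<close> has an inner box in some row \<open>s\<close>; this box lies in a
  row at most \<open>i\<close>, or else \<open>q'\<close> is long enough in row \<open>i\<close> to
  contain \<open>(i, j)\<close>.\<close>

lemma upper_skew: "upper (skew q' p') = p'"
proof
  fix i
  have "{j \<in> {off<..off + width}. \<forall>i'\<le>i. (i', j) \<notin> skew q' p'} = {off<..off + p' i}"
  proof (intro set_eqI iffI)
    fix j assume j: "j \<in> {j \<in> {off<..off + width}. \<forall>i'\<le>i. (i', j) \<notin> skew q' p'}"
    then obtain s where s: "off + p s < j" "j \<le> off + q s" using skew_column by blast
    show "j \<in> {off<..off + p' i}"
    proof (rule ccontr)
      assume "j \<notin> {off<..off + p' i}"
      then have lt: "off + p' i < j" using j by auto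
      show False
      proof (cases "s \<le> i")
        case True
        have "(s, j) \<in> skew q' p'" using s le(1)[of s] le(3)[of s] by (auto simp: skew_def)
        then show False using j True by blast
      next
        case False
        then have "q s \<le> q' i" using le(3)[of s] shapes_antimono[OF shapes(4), of i s] by simp
        then have "(i, j) \<in> skew q' p'" using s lt by (auto simp: skew_def)
        then show False using j by blast
      qed
    qed
  next
    fix j assume j: "j \<in> {off<..off + p' i}"
    have "p' i \<le> p' i'" if "i' \<le> i" for i' by (rule shapes_antimono[OF shapes(3) that])
    then have "(i', j) \<notin> skew q' p'" if "i' \<le> i" for i' using j that by (fastforce simp: skew_def)
    then show "j \<in> {j \<in> {off<..off + width}. \<forall>i'\<le>i. (i', j) \<notin> skew q' p'}"
      using j shapes_le_width[OF shapes(3), of i] by auto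
  qed
  then show "upper (skew q' p') i = p' i" by (simp add: upper_def)
qed

lemma lower_skew: "lower (skew q' p') = q'"
proof
  fix i
  have "{j \<in> {off<..off + width}. \<exists>i'\<ge>i. (i', j) \<in> skew q' p'} = {off<..off + q' i}"
  proof (intro set_eqI iffI)
    fix j assume "j \<in> {j \<in> {off<..off + width}. \<exists>i'\<ge>i. (i', j) \<in> skew q' p'}"
    then obtain i' where "i \<le> i'" "(i', j) \<in> skew q' p'" "off < j" by auto
    then show "j \<in> {off<..off + q' i}" using shapes_antimono[OF shapes(4), of i i'] by (auto simp: skew_def)
  next
    fix j assume j: "j \<in> {off<..off + q' i}"
    then have jC: "j \<in> {off<..off + width}" using shapes_le_width[OF shapes(4), of i] by auto
    then obtain s where s: "off + p s < j" "j \<le> off + q s" using skew_column by blast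
    have "\<exists>i'\<ge>i. (i', j) \<in> skew q' p'"
    proof (cases "i \<le> s")
      case True
      have "(s, j) \<in> skew q' p'" using s le(1)[of s] le(3)[of s] by (auto simp: skew_def)
      then show ?thesis using True by blast
    next
      case False
      then have "p' i \<le> p s" using le(1)[of s] shapes_antimono[OF shapes(3), of s i] by simp
      then have "(i, j) \<in> skew q' p'" using s j by (auto simp: skew_def)
      then show ?thesis by blast
    qed
    then show "j \<in> {j \<in> {off<..off + width}. \<exists>i'\<ge>i. (i', j) \<in> skew q' p'}" using jC by blast
  qed
  then show "lower (skew q' p') i = q' i" by (simp add: lower_def)
qed

lemma skew_shape_skew: "skew_shape (skew q' p')"
  unfolding skew_shape_def
proof (intro conjI ballI allI impI)
  show "finite (skew q' p')" by (rule finite_skew[OF shapes(4)])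
  show "skew q' p' \<subseteq> {1..} \<times> {1..}"
    using skew_row_pos[OF shapes(3,4)] by (fastforce simp: skew_def)
  fix a b c assume *: "a \<in> skew q' p'" "b \<in> skew q' p'" "box_le a c \<and> box_le c b"
  obtain i j where c: "c = (i, j)" by fastforce
  have "p' i \<le> p' (fst a)" "q' (fst b) \<le> q' i"
    using * shapes_antimono[OF shapes(3)] shapes_antimono[OF shapes(4)] by (auto simp: box_le_def c)
  then show "c \<in> skew q' p'" using * by (auto simp: skew_def box_le_def c)
qed

lemma skew_mono: "skew q p \<subseteq> skew q' p'"
proof
  fix b assume "b \<in> skew q p"
  then show "b \<in> skew q' p'" using le(1)[of "fst b"] le(3)[of "fst b"] by (auto simp: skew_def)
qed

lemma col_contains_skew: "col_contains (skew q' p') (skew q p)"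
  unfolding col_contains_def
proof (intro conjI skew_mono ballI)
  fix b assume b: "b \<in> skew q' p'"
  obtain i j where ij: "b = (i, j)" by fastforce
  have "j \<in> {off<..off + width}" using b shapes_le_width[OF shapes(4), of i] by (auto simp: skew_def ij)
  then show "case b of (i, j) \<Rightarrow> \<exists>i'. (i', j) \<in> skew q p" using skew_column by (auto simp: ij skew_def)
qed

lemma above_skew: "above (skew q' p') (skew q p) = skew p p'"
proof (rule set_eqI)
  fix b :: box
  obtain i j where b: "b = (i, j)" by fastforce
  have "(i, j) \<in> above (skew q' p') (skew q p) \<longleftrightarrow> (i, j) \<in> skew p p'"
  proof
    assume a: "(i, j) \<in> above (skew q' p') (skew q p)"
    then obtain i' where i': "(i', j) \<in> skew q p" "i < i'" by (auto simp: above_def)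
    have "j \<le> off + p i"
    proof (rule ccontr)
      assume "\<not> j \<le> off + p i"
      then have "(i, j) \<in> skew q p"
        using i' shapes_antimono[OF shapes(2), of i i'] by (auto simp: skew_def)
      then show False using a by (auto simp: above_def)
    qed
    then show "(i, j) \<in> skew p p'" using a by (auto simp: above_def skew_def)
  next
    assume a: "(i, j) \<in> skew p p'"
    then have "j \<in> {off<..off + width}" using shapes_le_width[OF shapes(1), of i] by (auto simp: skew_def)
    then obtain s where s: "off + p s < j" "j \<le> off + q s" using skew_column by blast
    then have "i < s" using a shapes_antimono[OF shapes(1), of s i] by (auto simp: skew_def not_le[symmetric])
    moreover have "(i, j) \<in> skew q' p'" "(i, j) \<notin> skew q p"
      using a le(2)[of i] le(3)[of i] by (auto simp: skew_def)
    ultimately show "(i, j) \<in> above (skew q' p') (skew q p)" using s by (auto simp: above_def skew_def)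
  qed
  then show "b \<in> above (skew q' p') (skew q p) \<longleftrightarrow> b \<in> skew p p'" by (simp add: b)
qed

lemma below_skew: "below (skew q' p') (skew q p) = skew q' q"
proof (rule set_eqI)
  fix b :: box
  obtain i j where b: "b = (i, j)" by fastforce
  have "(i, j) \<in> below (skew q' p') (skew q p) \<longleftrightarrow> (i, j) \<in> skew q' q"
  proof
    assume a: "(i, j) \<in> below (skew q' p') (skew q p)"
    then obtain i' where i': "(i', j) \<in> skew q p" "i' < i" by (auto simp: below_def)
    have "off + q i < j"
    proof (rule ccontr)
      assume "\<not> off + q i < j"
      then have "(i, j) \<in> skew q p"
        using i' shapes_antimono[OF shapes(1), of i' i] by (auto simp: skew_def)
      then show False using a by (auto simp: below_def)
    qed
    then show "(i, j) \<in> skew q' q" using a by (auto simp: below_def skew_def)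
  next
    assume a: "(i, j) \<in> skew q' q"
    then have "j \<in> {off<..off + width}" using shapes_le_width[OF shapes(4), of i] by (auto simp: skew_def)
    then obtain s where s: "off + p s < j" "j \<le> off + q s" using skew_column by blast
    then have "s < i" using a shapes_antimono[OF shapes(2), of i s] by (auto simp: skew_def not_le[symmetric])
    moreover have "(i, j) \<in> skew q' p'" "(i, j) \<notin> skew q p"
      using a le(1)[of i] le(2)[of i] by (auto simp: skew_def)
    ultimately show "(i, j) \<in> below (skew q' p') (skew q p)" using s by (auto simp: below_def skew_def)
  qed
  then show "b \<in> below (skew q' p') (skew q p) \<longleftrightarrow> b \<in> skew q' q" by (simp add: b)
qed

end

end

text \<open>A cover moves by at most one column, since otherwise the right neighbour of its lower
  element would lie strictly between. Hence a path in the Hasse diagram cannot jump over an empty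
  column.\<close>

lemma connected_columns:
  assumes skew: "skew_shape \<sigma>" and conn: "connected_shape \<sigma>" and ne: "\<sigma> \<noteq> {}"
  obtains off width where "snd ` \<sigma> = {off<..off + width}"
proof -
  have fin: "finite (snd ` \<sigma>)" using skew by (simp add: skew_shape_def)
  have cover: "snd b \<le> snd a + 1" if "covers \<sigma> a b \<or> covers \<sigma> b a" for a b
  proof (rule ccontr)
    assume "\<not> snd b \<le> snd a + 1"
    then have c: "covers \<sigma> a b" and lt: "snd a + 1 < snd b" using that by (auto simp: covers_def box_le_def)
    let ?c = "(fst a, snd a + 1)"
    have le: "box_le a ?c" "box_le ?c b" using c lt by (auto simp: covers_def box_le_def)
    then have "?c \<in> \<sigma>" using skew c unfolding skew_shape_def covers_def by blast
    then have "?c = a \<or> ?c = b" using c le unfolding covers_def by blast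
    then show False using lt by (metis less_irrefl n_not_Suc_n add.commute plus_1_eq_Suc snd_conv)
  qed
  have conv: "j \<in> snd ` \<sigma>" if ab: "a \<in> \<sigma>" "b \<in> \<sigma>" and j: "snd a < j" "j < snd b" for a b j
  proof (rule ccontr)
    assume nj: "j \<notin> snd ` \<sigma>"
    have "(a, b) \<in> {(p, q). covers \<sigma> p q \<or> covers \<sigma> q p}\<^sup>*"
      using conn ab by (simp add: connected_shape_def)
    then have "snd b < j"
    proof (induction rule: rtrancl_induct)
      case (step y z)
      then have "z \<in> \<sigma>" "snd z \<le> snd y + 1" using cover by (auto simp: covers_def)
      moreover from this have "snd z \<noteq> j" using nj by blast
      ultimately show ?case using step by simp
    qed (use j in simp)
    then show False using j by simp
  qed
  define l r where "l = Min (snd ` \<sigma>)" and "r = Max (snd ` \<sigma>)"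
  have lr: "l \<in> snd ` \<sigma>" "r \<in> snd ` \<sigma>" using fin ne by (auto simp: l_def r_def)
  have "1 \<le> l" "l \<le> r" using lr skew fin by (auto simp: skew_shape_def r_def)
  have "snd ` \<sigma> = {l..r}"
  proof
    show "snd ` \<sigma> \<subseteq> {l..r}" using Min_le[OF fin] Max_ge[OF fin] unfolding l_def r_def by fastforce
    show "{l..r} \<subseteq> snd ` \<sigma>"
    proof
      fix j assume j: "j \<in> {l..r}"
      obtain a b where ab: "a \<in> \<sigma>" "b \<in> \<sigma>" "l = snd a" "r = snd b" using lr by blast
      show "j \<in> snd ` \<sigma>"
      proof (cases "j = l \<or> j = r")
        case False
        then show ?thesis using conv[OF ab(1,2), of j] j ab by simp
      qed (use lr in blast)
    qed
  qed
  also have "\<dots> = {l - 1<..(l - 1) + (r - (l - 1))}" using \<open>1 \<le> l\<close> \<open>l \<le> r\<close> by auto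
  finally show thesis by (rule that)
qed

section \<open>Coefficients of the series\<close>

text \<open>Polynomials as finitely supported maps on exponents: here
  \<open>Poly_Mapping.lookup\<close> reads off the very coefficients by which the series are
  defined.\<close>

definition indet :: "nat \<Rightarrow> exponent \<Rightarrow>\<^sub>0 int" where
  "indet k = Poly_Mapping.single (Poly_Mapping.single k 1) 1"

lemma prod_single:
  fixes c :: "'a \<Rightarrow> int" and f :: "'a \<Rightarrow> exponent"
  shows "finite A \<Longrightarrow>
    (\<Prod>a\<in>A. Poly_Mapping.single (f a) (c a)) = Poly_Mapping.single (\<Sum>a\<in>A. f a) (\<Prod>a\<in>A. c a)"
  by (induction A rule: finite_induct) (simp_all add: mult_single)

lemma lookup_of_int_mult:
  fixes P :: "exponent \<Rightarrow>\<^sub>0 int"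
  shows "Poly_Mapping.lookup (of_int c * P) d = c * Poly_Mapping.lookup P d"
proof -
  have "of_int c * P = Poly_Mapping.map ((*) c) P"
    unfolding mult_map_scale_conv_mult
    using single_of_int[of c, where 'a = exponent and 'b = int] by simp
  then show ?thesis by (simp add: Poly_Mapping.map.rep_eq when_def)
qed

text \<open>Every label used by a contributing tableau is a key of \<open>d\<close>, so discarding
  labels above \<open>n\<close> does not change this coefficient.\<close>

lemma lookup_tabsum_schur:
  assumes S: "finite S" and d: "Poly_Mapping.keys d \<subseteq> {..n}"
  shows "Poly_Mapping.lookup (tabsum semistandard S (\<lambda>_. {1..n}) indet) d = schur S d"
proof -
  let ?A = "{T. T \<in> PiE S (\<lambda>_. {1..n}) \<and> semistandard S T}"
  have mono: "(\<Prod>b\<in>S. indet (T b)) = Poly_Mapping.single (content S T) 1" for T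
    unfolding indet_def prod_single[OF S] content_def by simp
  have "finite ?A" by (rule finite_subset[of _ "PiE S (\<lambda>_. {1..n})"]) (auto intro!: finite_PiE S)
  moreover have "{T \<in> SSYT S. monomial (content S T) d \<noteq> 0} \<subseteq> ?A"
  proof
    fix T assume "T \<in> {T \<in> SSYT S. monomial (content S T) d \<noteq> 0}"
    then have T: "T \<in> S \<rightarrow>\<^sub>E {1..}" "semistandard S T" and c: "d = content S T"
      by (auto simp: SSYT_def tableaux_def monomial_def split: if_splits)
    have "T b \<in> {1..n}" if "b \<in> S" for b
    proof -
      have "{b' \<in> S. T b' = T b} \<noteq> {}" using that by blast
      then have "T b \<in> Poly_Mapping.keys d"
        using S unfolding c in_keys_iff lookup_content[OF S] by (simp only: card_eq_0_iff) simp
      then show ?thesis using d PiE_mem[OF T(1) that] by auto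
    qed
    then show "T \<in> ?A" using T by (auto simp: PiE_iff)
  qed
  moreover have "monomial (content S T) d = 0"
    if "T \<in> ?A - {T \<in> SSYT S. monomial (content S T) d \<noteq> 0}" for T
    using that by (auto simp: SSYT_def tableaux_def PiE_iff)
  ultimately have "schur S d = (\<Sum>T\<in>?A. monomial (content S T) d)"
    unfolding schur_def formal_sum_def by (intro sum.mono_neutral_left) blast+
  also have "\<dots> = Poly_Mapping.lookup (tabsum semistandard S (\<lambda>_. {1..n}) indet) d"
    unfolding tabsum_def mono lookup_sum
    by (rule sum.cong[OF refl]) (auto simp: monomial_def lookup_single when_def)
  finally show ?thesis ..
qed

lemma sv_weight_indet:
  assumes "finite L"
  shows "sv_weight indet L = Poly_Mapping.single (\<Sum>k\<in>L. Poly_Mapping.single k 1) ((- 1) ^ (card L - 1))"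
proof -
  have "(- 1) ^ m = (Poly_Mapping.single 0 ((- 1) ^ m) :: exponent \<Rightarrow>\<^sub>0 int)" for m
    using single_of_int[of "(- 1) ^ m", where 'a = exponent and 'b = int] by simp
  then show ?thesis
    unfolding sv_weight_def indet_def prod_single[OF assms] by (simp add: mult_single)
qed

lemma lookup_tabsum_grothendieck:
  assumes S: "finite S" and d: "Poly_Mapping.keys d \<subseteq> {..n}"
  shows "Poly_Mapping.lookup (tabsum sv_semistandard S (\<lambda>_. labelsets 1 n) (sv_weight indet)) d
    = grothendieck S d"
proof -
  let ?A = "{T. T \<in> PiE S (\<lambda>_. labelsets 1 n) \<and> sv_semistandard S T}"
  let ?t = "\<lambda>T. scale ((- 1) ^ (sv_size S T - card S)) (monomial (sv_content S T)) d"
  have lab: "L \<in> labelsets 1 n \<Longrightarrow> finite L \<and> L \<noteq> {} \<and> L \<subseteq> {1..}" for L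
    using finite_labelset[of L 1 n] by (auto simp: labelsets_def)
  have mono: "(\<Prod>b\<in>S. sv_weight indet (T b))
      = Poly_Mapping.single (sv_content S T) ((- 1) ^ (sv_size S T - card S))"
    if "T \<in> ?A" for T
  proof -
    have T: "finite (T b)" "T b \<noteq> {}" if "b \<in> S" for b
      using \<open>T \<in> ?A\<close> lab that by (auto simp: PiE_iff)
    \<comment> \<open>\<open>card S\<close> is added first so that the truncated subtractions in the
      single boxes combine into one.\<close>
    have "(\<Sum>b\<in>S. card (T b) - 1) + card S = (\<Sum>b\<in>S. (card (T b) - 1) + 1)"
      unfolding sum.distrib by simp
    also have "\<dots> = sv_size S T"
      unfolding sv_size_def
    proof (rule sum.cong[OF refl])
      fix b assume "b \<in> S"
      then have "0 < card (T b)" using T by (simp add: card_gt_0_iff)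
      then show "card (T b) - 1 + 1 = card (T b)" by simp
    qed
    finally have sz: "(\<Sum>b\<in>S. card (T b) - 1) = sv_size S T - card S" by simp
    have "(\<Prod>b\<in>S. sv_weight indet (T b)) = (\<Prod>b\<in>S. Poly_Mapping.single (\<Sum>k\<in>T b. Poly_Mapping.single k 1)
        ((- 1) ^ (card (T b) - 1)))"
      by (rule prod.cong[OF refl]) (simp add: sv_weight_indet T(1))
    then show ?thesis
      unfolding prod_single[OF S] sv_content_def power_sum[symmetric] sz .
  qed
  have "finite ?A"
    by (rule finite_subset[of _ "PiE S (\<lambda>_. labelsets 1 n)"]) (auto intro!: finite_PiE S finite_labelsets)
  moreover have "{T \<in> SVT S. ?t T \<noteq> 0} \<subseteq> ?A"
  proof
    fix T assume "T \<in> {T \<in> SVT S. ?t T \<noteq> 0}"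
    then have T: "T \<in> sv_tableaux S" "sv_semistandard S T" and c: "d = sv_content S T"
      by (auto simp: SVT_def scale_def monomial_def split: if_splits)
    have "T b \<in> labelsets 1 n" if b: "b \<in> S" for b
    proof -
      have Tb: "finite (T b)" "T b \<noteq> {}" "T b \<subseteq> {1..}" using T(1) b by (auto simp: sv_tableaux_def PiE_iff)
      have "k \<le> n" if "k \<in> T b" for k
      proof -
        have "{b \<in> S. k \<in> T b} \<noteq> {}" using b that by blast
        then have "k \<in> Poly_Mapping.keys d"
          using S unfolding c in_keys_iff lookup_sv_content[OF S T(1)] by (simp only: card_eq_0_iff) simp
        then show ?thesis using d by auto
      qed
      then show ?thesis using Tb by (auto simp: labelsets_def)
    qed
    then show "T \<in> ?A" using T by (auto simp: PiE_iff sv_tableaux_def)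
  qed
  moreover have "?t T = 0" if "T \<in> ?A - {T \<in> SVT S. ?t T \<noteq> 0}" for T
  proof -
    have "T \<in> SVT S" using that lab by (auto simp: SVT_def sv_tableaux_def PiE_iff)
    then show ?thesis using that by blast
  qed
  ultimately have "grothendieck S d = (\<Sum>T\<in>?A. ?t T)"
    unfolding grothendieck_def formal_sum_def by (intro sum.mono_neutral_left) blast+
  also have "\<dots> = Poly_Mapping.lookup (tabsum sv_semistandard S (\<lambda>_. labelsets 1 n) (sv_weight indet)) d"
    unfolding tabsum_def lookup_sum
  proof (rule sum.cong[OF refl])
    fix T assume "T \<in> ?A"
    then show "?t T = Poly_Mapping.lookup (\<Prod>b\<in>S. sv_weight indet (T b)) d"
      by (subst mono) (auto simp: scale_def monomial_def lookup_single when_def)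
  qed
  finally show ?thesis ..
qed

lemma tabsum_const:
  fixes c :: "'r::comm_ring_1"
  shows "tabsum Q S M (\<lambda>_. c) = of_nat (card {T. T \<in> PiE S M \<and> Q S T}) * c ^ card S"
  by (simp add: tabsum_def)

text \<open>Row bounds have become label ranges, and the weight \<open>- 1\<close> on each box of
  \<open>A\<close> turns the first count into the signed one.\<close>

lemma b_coeff_tabsum:
  assumes "\<And>b. b \<in> A \<Longrightarrow> 1 \<le> fst b"
    and "A = above \<mu> \<sigma>" "B = below \<mu> \<sigma>"
  shows "tabsum reverse_row_strict A (\<lambda>b. {1..fst b}) (\<lambda>_. - 1) * tabsum semistandard B (\<lambda>b. {1..<fst b}) (\<lambda>_. 1)
    = (of_int ((- 1) ^ card A * int (b_coeff \<sigma> \<mu>)) :: 'r::comm_ring_1)"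
proof -
  have "{T \<in> tableaux A. row_weakly_bounded A T \<and> reverse_row_strict A T}
      = {T. T \<in> PiE A (\<lambda>b. {1..fst b}) \<and> reverse_row_strict A T}"
    by (auto simp: tableaux_def row_weakly_bounded_def PiE_iff)
  moreover have "{T \<in> tableaux B. row_bounded B T \<and> semistandard B T}
      = {T. T \<in> PiE B (\<lambda>b. {1..<fst b}) \<and> semistandard B T}"
    by (auto simp: tableaux_def row_bounded_def PiE_iff)
  ultimately show ?thesis
    unfolding b_coeff_def assms(2,3)[symmetric] by (simp add: tabsum_const mult_ac del: One_nat_def)
qed

theorem theorem4p1:
  fixes \<sigma> :: "box set"
  assumes "skew_shape \<sigma>" and "connected_shape \<sigma>"
    and "\<sigma> \<noteq> {}" and "top_row \<sigma> = 1"
  shows "formally_summable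
           (\<lambda>\<mu>. scale ((-1) ^ card (above \<mu> \<sigma>) * int (b_coeff \<sigma> \<mu>)) (grothendieck \<mu>))
           {\<mu>. skew_shape \<mu> \<and> col_contains \<mu> \<sigma>}
       \<and> schur \<sigma> = formal_sum
           (\<lambda>\<mu>. scale ((-1) ^ card (above \<mu> \<sigma>) * int (b_coeff \<sigma> \<mu>)) (grothendieck \<mu>))
           {\<mu>. skew_shape \<mu> \<and> col_contains \<mu> \<sigma>}"
proof -
  obtain off width where cols: "snd ` \<sigma> = {off<..off + width}"
    using connected_columns[OF assms(1-3)] by blast
  interpret columns off width .
  define p q where "p = upper \<sigma>" and "q = lower \<sigma>"
  have p: "p \<in> shapes" and q: "q \<in> shapes" and le: "\<And>i. p i \<le> q i" and \<sigma>: "\<sigma> = skew q p"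
    using upper_shapes[OF assms(1) cols] lower_shapes[OF assms(1) cols]
      upper_le_lower[OF assms(1) cols] skew_lower_upper[OF assms(1) cols]
    by (simp_all add: p_def q_def)
  obtain h where h: "p \<in> shapes_upto h" using p by (auto simp: shapes_def)
  have cols': "snd ` skew q p = {off<..off + width}" using cols \<sigma> by simp
  define M where "M = {\<mu>. skew_shape \<mu> \<and> col_contains \<mu> \<sigma>}"
  define P where "P = {(p', q'). p' \<in> shapes \<and> q' \<in> shapes \<and> (\<forall>i. p' i \<le> p i) \<and> (\<forall>i. q i \<le> q' i)}"
  define t where "t \<mu> = scale ((-1) ^ card (above \<mu> \<sigma>) * int (b_coeff \<sigma> \<mu>)) (grothendieck \<mu>)" for \<mu>
  let ?g = "\<lambda>(p', q'). skew q' p'"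
  have inP: "p' \<in> shapes" "q' \<in> shapes" "\<And>i. p' i \<le> p i" "\<And>i. q i \<le> q' i" if "(p', q') \<in> P" for p' q'
    using that by (auto simp: P_def)
  \<comment> \<open>A shape containing \<open>\<sigma>\<close> in the sense of
    \<open>col_contains\<close> meets exactly the columns of \<open>\<sigma>\<close>, so
    \<open>off\<close> and \<open>width\<close> are the same for both, and the shape is a free
    choice of a smaller upper and a larger lower boundary.\<close>
  have bij: "bij_betw ?g P M"
  proof (rule bij_betw_byWitness[where f' = "\<lambda>\<mu>. (upper \<mu>, lower \<mu>)"])
    show "\<forall>a\<in>P. (upper (?g a), lower (?g a)) = a"
      using upper_skew[OF p q inP(1,2) inP(3) le inP(4) cols'] lower_skew[OF p q inP(1,2) inP(3) le inP(4) cols']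
      by auto
    have colM: "snd ` \<mu> = {off<..off + width}" if "\<mu> \<in> M" for \<mu>
      using that unfolding cols[symmetric] M_def col_contains_def by force
    show "\<forall>\<mu>\<in>M. ?g (upper \<mu>, lower \<mu>) = \<mu>"
      using skew_lower_upper[OF _ colM] by (auto simp: M_def)
    show "?g ` P \<subseteq> M"
      using skew_shape_skew[OF p q inP(1,2) inP(3) le inP(4) cols']
        col_contains_skew[OF p q inP(1,2) inP(3) le inP(4) cols'] by (auto simp: M_def \<sigma>)
    show "(\<lambda>\<mu>. (upper \<mu>, lower \<mu>)) ` M \<subseteq> P"
      using upper_shapes[OF _ colM] lower_shapes[OF _ colM]
      by (auto simp: M_def P_def p_def q_def col_contains_def upper_mono lower_mono)
  qed
  have "finite {\<mu> \<in> M. t \<mu> d \<noteq> 0} \<and> schur \<sigma> d = (\<Sum>\<mu>\<in>{\<mu> \<in> M. t \<mu> d \<noteq> 0}. t \<mu> d)" for d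
  proof -
    \<comment> \<open>For a fixed exponent only labels up to \<open>n\<close> matter, so the
      identity in \<open>n\<close> variables decides this coefficient.\<close>
    obtain n where n: "Poly_Mapping.keys d \<subseteq> {..n}"
      using finite_nat_set_iff_bounded_le[of "Poly_Mapping.keys d"] by auto
    define A where "A = {p'. p' \<in> shapes \<and> (\<forall>i. p' i \<le> p i)}"
    define B where "B = {\<kappa>. \<kappa> \<in> shapes_upto (h + n) \<and> (\<forall>i. q i \<le> \<kappa> i)}"
    let ?G = "\<lambda>p' \<kappa>. tabsum sv_semistandard (skew \<kappa> p') (\<lambda>_. labelsets 1 n) (sv_weight indet)"
    have fin: "finite A" "finite B"
      using finite_below[OF p] finite_subset[OF _ finite_shapes_upto[of "h + n"], of B] by (auto simp: A_def B_def)
    have AB: "A \<times> B \<subseteq> P" by (auto simp: A_def B_def P_def intro: shapes_upto_shapes)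
    have t: "t (skew \<kappa> p') d = Poly_Mapping.lookup (tabsum reverse_row_strict (skew p p') (\<lambda>b. {1..fst b}) (\<lambda>_. - 1) *
      tabsum semistandard (skew \<kappa> q) (\<lambda>b. {1..<fst b}) (\<lambda>_. 1) * ?G p' \<kappa>) d" if "(p', \<kappa>) \<in> P" for p' \<kappa>
    proof -
      note P = inP[OF that]
      note ab = above_skew[OF p q P(1,2,3) le P(4) cols'] below_skew[OF p q P(1,2,3) le P(4) cols']
      have bc: "tabsum reverse_row_strict (skew p p') (\<lambda>b. {1..fst b}) (\<lambda>_. - 1) *
          tabsum semistandard (skew \<kappa> q) (\<lambda>b. {1..<fst b}) (\<lambda>_. 1)
          = (of_int ((- 1) ^ card (skew p p') * int (b_coeff (skew q p) (skew \<kappa> p'))) :: exponent \<Rightarrow>\<^sub>0 int)"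
        by (rule b_coeff_tabsum) (use ab skew_row_pos[OF P(1) p] in auto)
      show ?thesis
        unfolding bc lookup_of_int_mult lookup_tabsum_grothendieck[OF finite_skew[OF P(2)] n]
        by (simp add: t_def scale_def \<sigma> ab)
    qed
    \<comment> \<open>Upper boundaries below \<open>p\<close> form a finite set anyway; only lower
      boundaries with more than \<open>h + n\<close> rows have to be excluded, and with
      \<open>n\<close> labels they admit no filling.\<close>
    have zero: "t (skew \<kappa> p') d = 0" if "(p', \<kappa>) \<in> P - A \<times> B" for p' \<kappa>
    proof -
      have "(p', \<kappa>) \<in> P" using that by blast
      note P = inP[OF this]
      have "\<kappa> \<notin> shapes_upto (h + n)" using that P by (auto simp: A_def B_def)
      moreover have "p' \<in> shapes_upto h" using le_upto[OF P(1) _ h] P(3) by blast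
      moreover have "p' i \<le> \<kappa> i" for i using P(3)[of i] le[of i] P(4)[of i] by linarith
      ultimately have "?G p' \<kappa> = 0" using sv_sum_zero[OF _ P(2)] by blast
      then show ?thesis by (simp add: t[OF \<open>(p', \<kappa>) \<in> P\<close>])
    qed
    have sub: "{\<mu> \<in> M. t \<mu> d \<noteq> 0} \<subseteq> ?g ` (A \<times> B)"
    proof
      fix \<mu> assume \<mu>: "\<mu> \<in> {\<mu> \<in> M. t \<mu> d \<noteq> 0}"
      then obtain p' \<kappa> where "(p', \<kappa>) \<in> P" "\<mu> = skew \<kappa> p'" using bij by (auto simp: bij_betw_def)
      then show "\<mu> \<in> ?g ` (A \<times> B)" using zero[of p' \<kappa>] \<mu> by force
    qed
    have subM: "?g ` (A \<times> B) \<subseteq> M" using AB bij unfolding bij_betw_def by blast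
    have inj: "inj_on ?g (A \<times> B)" using AB bij unfolding bij_betw_def by (blast intro: inj_on_subset)
    have finAB: "finite (?g ` (A \<times> B))" using fin by simp
    have "(\<Sum>\<mu>\<in>{\<mu> \<in> M. t \<mu> d \<noteq> 0}. t \<mu> d) = (\<Sum>\<mu>\<in>?g ` (A \<times> B). t \<mu> d)"
      by (rule sum.mono_neutral_left[OF finAB sub]) (use subM in blast)
    also have "\<dots> = (\<Sum>(p', \<kappa>)\<in>A \<times> B. t (skew \<kappa> p') d)"
      by (subst sum.reindex[OF inj]) (simp add: case_prod_unfold o_def)
    also have "\<dots> = (\<Sum>p'\<in>A. \<Sum>\<kappa>\<in>B. t (skew \<kappa> p') d)"
      by (rule sum.cartesian_product[symmetric])
    also have "\<dots> = (\<Sum>p'\<in>A. \<Sum>\<kappa>\<in>B. Poly_Mapping.lookup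
        (tabsum reverse_row_strict (skew p p') (\<lambda>b. {1..fst b}) (\<lambda>_. - 1) *
         tabsum semistandard (skew \<kappa> q) (\<lambda>b. {1..<fst b}) (\<lambda>_. 1) * ?G p' \<kappa>) d)"
      using AB by (intro sum.cong refl t) blast
    also have "\<dots> = Poly_Mapping.lookup (tabsum semistandard (skew q p) (\<lambda>_. {1..n}) indet) d"
      unfolding schur_grothendieck_identity[OF h q le, of n indet] A_def B_def lookup_sum ..
    also have "\<dots> = schur \<sigma> d"
      unfolding \<sigma> by (rule lookup_tabsum_schur[OF finite_skew[OF q] n])
    finally show ?thesis using finite_subset[OF sub finAB] by simp
  qed
  then show ?thesis
    unfolding formally_summable_def formal_sum_def M_def[symmetric] t_def[symmetric] by auto
qed

end
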